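(* Let $n\ge 1$, $R>0$, $c_1,\dots,c_n\in\mathbb{C}$ and $r_1,\dots,r_n>0$ be such that $|c_i|+r_i<R$ for all $1\le i\le n$ and the closed disks $\overline{D(c_1,r_1)},\dots,\overline{D(c_n,r_n)}$ are pairwise disjoint. For $i,j\in\{1,\dots,n\}$ with $i\ne j$, let $d_{ij}=|c_i-c_j|-r_i-r_j$ (the distance from $D(c_i,r_i)$ to $D(c_j,r_j)$), and for $1\le j\le n$ let $d_{0j}=d_{j0}=R-|c_j|-r_j$ (the distance from $D(c_j,r_j)$ to the circle $\{|z|=R\}$). Let $\epsilon>0$ and assume that $$\sum_{\substack{1\le i\le n\\ i\neq j}}\frac{r_i}{d_{ij}}+\frac{R}{d_{0j}}-1<\epsilon\quad\text{for every } 1\le j\le n,\qquad\text{and}\qquad \sum_{i=1}^n\frac{r_i}{d_{i0}}<\epsilon .$$ Then $$K_R\big((c_1,r_1),\dots,(c_n,r_n)\big)\le \frac{n+1}{2}+\sqrt{\frac{(n+1)^2}{4}+5\epsilon}.$$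
   Context: $D(c,r)$ denotes the open disk in $\mathbb{C}$ with center $c$ and radius $r$. Given $R>0$ and disks $D(c_1,r_1),\dots,D(c_n,r_n)$ with pairwise disjoint closures and $|c_i|+r_i<R$ for all $i$, define $$D_R\big((c_1,r_1),\dots,(c_n,r_n)\big)=D(0,R)\setminus\bigcup_{1\le i\le n}\overline{D(c_i,r_i)}.$$ The Badea-Beckermann-Crouzeix class $\mathscr{D}_R\big((c_1,r_1),\dots,(c_n,r_n)\big)$ is the set of all square complex matrices $A\in\mathbb{C}^{d\times d}$ (of any size $d\ge 1$) such that $\|A\|<R$ and, for each $1\le i\le n$, $A-c_iI$ is invertible with $\|(A-c_iI)^{-1}\|<r_i^{-1}$. Here $\|\cdot\|$ is the operator norm induced by the Euclidean norm. Every such $A$ has spectrum in $D_R\big((c_1,r_1),\dots,(c_n,r_n)\big)$, so $f(A)$ is defined by the holomorphic functional calculus for every $f$ holomorphic on that domain. The spectral constant $K_R\big((c_1,r_1),\dots,(c_n,r_n)\big)$ is the smallest constant $K$ such that $$\|f(A)\|\le K\sup_{z\in D_R((c_1,r_1),\dots,(c_n,r_n))}|f(z)|$$ for all $A\in\mathscr{D}_R\big((c_1,r_1),\dots,(c_n,r_n)\big)$ and all $f$ holomorphic in $D_R\big((c_1,r_1),\dots,(c_n,r_n)\big)$ (the inequality being vacuous if the supremum is infinite). *)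

theory Defs
  imports
    "HOL-Complex_Analysis.Complex_Analysis"
    "Jordan_Normal_Form.Spectral_Radius"
begin

text \<open>The disks are indexed by \<open>{1..n}\<close>: only \<open>c i\<close> and \<open>r i\<close> with \<open>1 \<le> i \<le> n\<close> matter.\<close>

definition multi_disk_domain :: "real \<Rightarrow> nat \<Rightarrow> (nat \<Rightarrow> complex) \<Rightarrow> (nat \<Rightarrow> real) \<Rightarrow> complex set" where
  "multi_disk_domain R n c r = ball 0 R - (\<Union>i\<in>{1..n}. cball (c i) (r i))"

text \<open>Index \<open>0\<close> stands for the outer circle of radius \<open>R\<close>.\<close>

definition disk_gap :: "real \<Rightarrow> (nat \<Rightarrow> complex) \<Rightarrow> (nat \<Rightarrow> real) \<Rightarrow> nat \<Rightarrow> nat \<Rightarrow> real" where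
  "disk_gap R c r i j =
     (if i = 0 then R - cmod (c j) - r j
      else if j = 0 then R - cmod (c i) - r i
      else cmod (c i - c j) - r i - r j)"

definition vec_norm2 :: "complex Matrix.vec \<Rightarrow> real" where
  "vec_norm2 v = L2_set (\<lambda>i. cmod (vec_index v i)) {..<dim_vec v}"

definition mat_opnorm :: "complex mat \<Rightarrow> real" where
  "mat_opnorm A =
     (SUP v\<in>{v \<in> carrier_vec (dim_col A). vec_norm2 v \<le> 1}. vec_norm2 (A *\<^sub>v v))"

text \<open>\<open>mat_inverse\<close> is option-valued; on invertible matrices it is \<open>Some\<close> of the inverse.\<close>

definition mat_inv :: "complex mat \<Rightarrow> complex mat" where
  "mat_inv A = the (mat_inverse A)"

text \<open>The list \<open>\<Gamma>\<close> stands for the cycle formed by the sum of its closed paths.\<close>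

definition surrounds :: "(real \<Rightarrow> complex) list \<Rightarrow> complex set \<Rightarrow> complex set \<Rightarrow> bool" where
  "surrounds \<Gamma> S U \<longleftrightarrow>
     (\<forall>\<gamma>\<in>set \<Gamma>. valid_path \<gamma> \<and> pathfinish \<gamma> = pathstart \<gamma> \<and> path_image \<gamma> \<subseteq> U - S) \<and>
     (\<forall>z\<in>S. (\<Sum>\<gamma>\<leftarrow>\<Gamma>. winding_number \<gamma> z) = 1) \<and>
     (\<forall>z. z \<notin> U \<longrightarrow> (\<Sum>\<gamma>\<leftarrow>\<Gamma>. winding_number \<gamma> z) = 0)"

text \<open>
  Holomorphic functional calculus: the integral of \<open>f z (z I - A)\<inverse> / (2 \<pi> \<i>)\<close>, taken entrywise, over
  a cycle in \<open>U\<close> surrounding the spectrum of \<open>A\<close>. When \<open>U\<close> is open and contains the spectrum and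
  \<open>f\<close> is holomorphic on \<open>U\<close>, such a cycle exists (small circles around the eigenvalues) and, by
  the homology form of Cauchy's theorem, the value does not depend on the one chosen.
\<close>

definition hol_calc :: "complex set \<Rightarrow> (complex \<Rightarrow> complex) \<Rightarrow> complex mat \<Rightarrow> complex mat" where
  "hol_calc U f A =
     (let \<Gamma> = (SOME \<Gamma>. surrounds \<Gamma> (spectrum A) U)
      in Matrix.mat (dim_row A) (dim_row A) (\<lambda>(i, j).
           1 / (2 * of_real pi * \<i>) *
           (\<Sum>\<gamma>\<leftarrow>\<Gamma>. contour_integral \<gamma>
              (\<lambda>z. f z * index_mat (mat_inv (z \<cdot>\<^sub>m 1\<^sub>m (dim_row A) - A)) (i, j)))))"

definition BBC_class :: "real \<Rightarrow> nat \<Rightarrow> (nat \<Rightarrow> complex) \<Rightarrow> (nat \<Rightarrow> real) \<Rightarrow> complex mat set" where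
  "BBC_class R n c r =
     {A. \<exists>d\<ge>1. A \<in> carrier_mat d d \<and> mat_opnorm A < R \<and>
        (\<forall>i\<in>{1..n}. invertible_mat (A - c i \<cdot>\<^sub>m 1\<^sub>m d) \<and>
                     mat_opnorm (mat_inv (A - c i \<cdot>\<^sub>m 1\<^sub>m d)) < inverse (r i))}"

text \<open>
  The infimum is taken in the extended reals, so that the constant is \<open>\<infinity>\<close> if no real \<open>K\<close> is
  admissible. The admissible \<open>K\<close> form a closed set, so an infimum in \<open>\<real>\<close> is a minimum.
\<close>

definition spectral_const :: "real \<Rightarrow> nat \<Rightarrow> (nat \<Rightarrow> complex) \<Rightarrow> (nat \<Rightarrow> real) \<Rightarrow> ereal" where
  "spectral_const R n c r =
     (let U = multi_disk_domain R n c r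
      in Inf (ereal ` {K. \<forall>A\<in>BBC_class R n c r. \<forall>f. f holomorphic_on U \<and> bounded (f ` U) \<longrightarrow>
           mat_opnorm (hol_calc U f A) \<le> K * (SUP z\<in>U. cmod (f z))}))"

end

theory Submission
  imports Defs
begin

text \<open>
  The method is that of Crouzeix and Greenbaum. For \<open>f\<close> bounded by 1 on a slightly larger domain let
  \<open>g\<close> be the Cauchy transform of \<open>cnj f\<close> over the boundary circles and let \<open>m j\<close> be the mean of \<open>f\<close>
  over circle \<open>j\<close>. On each circle the double layer kernel of \<open>A\<close> differs from a positive kernel by a
  multiple of the identity, so \<open>f A + (g A)\<^sup>*\<close> is, up to a combination of the \<open>m j\<close> times the
  identity, an operator of norm at most \<open>n + 1\<close>. The scalar version of this identity, evaluated near
  circle \<open>l\<close>, shows that \<open>k = g - cnj (m 0)\<close> is at most \<open>3 * \<epsilon>\<close> there: the kernel of circle \<open>l\<close>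
  reproduces \<open>f\<close>, the other kernels are within \<open>2 * \<epsilon>\<close> of 1, and \<open>m 0 - m l\<close> is at most \<open>\<epsilon>\<close>. By the
  maximum principle \<open>k\<close> is bounded by \<open>3 * \<epsilon>\<close>.

  Let \<open>K\<close> be the supremum of the norms of \<open>f A\<close>, and let \<open>f A x = \<mu> y\<close> for unit vectors \<open>x\<close> and \<open>y\<close> with
  \<open>\<mu>\<close> close to \<open>K > 1\<close>. Composing \<open>f\<close> with a small Moebius map shows that \<open>x\<close> and \<open>y\<close> are nearly
  orthogonal, so the multiples of the identity do not matter. Moreover \<open>\<mu>\<^sup>2\<close> times the inner product of
  \<open>k A y\<close> and \<open>x\<close> is nearly that of \<open>(f k f) A x\<close> and \<open>y\<close>, hence at most \<open>3 * \<epsilon> * K\<close>. Together these give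
  \<open>K \<le> n + 1 + 3 * \<epsilon> / K\<close>.
\<close>

section \<open>Cauchy's theorem for cycles\<close>

text \<open>The strict inequalities in the class and in the hypotheses leave a margin
  \<open>t0\<close>. Since \<open>f\<close> need have no boundary values, every integral involving
  it is taken over circles moved into the domain by some positive \<open>t \<le> t0\<close>.
  Attainment of the supremum \<open>K\<close> is never asked for: the limit is taken only in an
  inequality between real numbers. \<open>K\<close> belongs to one fixed matrix, where a crude
  estimate shows it to be finite; the bound found for it does not depend on the matrix.

  The number n + 1 is the total mass of the positive operator kernels: for f = 1 the two Cauchy
  integrals give 2 and the signed means give 1 - n. A direct bound of k(A) would only give 3
  \<epsilon> K. Placing it between two copies of f(A), which takes x to \<mu> y and whose adjoint
  takes y nearly to \<mu> x, gains a factor of about K^2, turns this into 3 \<epsilon> / K and the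
  inequality into a quadratic one for K. Because \<open>hol_calc\<close> integrates over an
  unspecified cycle, Cauchy's theorem is needed in its homology form.\<close>

lemma join_closed_paths:
  assumes W: "open W" "connected W" and p: "p \<in> W"
    and "\<And>\<nu>. \<nu> \<in> set \<Gamma> \<Longrightarrow>
      valid_path \<nu> \<and> pathfinish \<nu> = pathstart \<nu> \<and> path_image \<nu> \<subseteq> W"
  shows "\<exists>\<nu>. valid_path \<nu> \<and> pathstart \<nu> = p \<and> pathfinish \<nu> = p \<and> path_image \<nu> \<subseteq> W \<and>
    (\<forall>F. F holomorphic_on W \<longrightarrow> contour_integral \<nu> F = (\<Sum>\<nu>\<leftarrow>\<Gamma>. contour_integral \<nu> F))"
  using assms(4)
proof (induction \<Gamma>)
  case Nil
  show ?case
    using p path_image_linepath[of p p]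
    by (intro exI[of _ "linepath p p"] conjI allI impI valid_path_linepath
        pathstart_linepath pathfinish_linepath)
      (simp_all only: contour_integral_trivial list.map sum_list.Nil closed_segment_idem, simp)
next
  case (Cons \<delta> \<Gamma>)
  obtain \<nu> where \<nu>: "valid_path \<nu>" "pathstart \<nu> = p" "pathfinish \<nu> = p" "path_image \<nu> \<subseteq> W"
    and \<nu>_int: "\<And>F. F holomorphic_on W \<Longrightarrow>
      contour_integral \<nu> F = (\<Sum>\<nu>\<leftarrow>\<Gamma>. contour_integral \<nu> F)"
    using Cons by auto
  have \<delta>: "valid_path \<delta>" "pathfinish \<delta> = pathstart \<delta>" "path_image \<delta> \<subseteq> W"
    using Cons.prems by auto
  then have "pathstart \<delta> \<in> W"
    by (meson pathstart_in_path_image subsetD)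
  then obtain q where "polynomial_function q"
    and q: "path_image q \<subseteq> W" "pathstart q = p" "pathfinish q = pathstart \<delta>"
    using connected_open_polynomial_connected[OF W p] by blast
  then have vq: "valid_path q"
    by (simp add: valid_path_polynomial_function)
  \<comment> \<open>The connecting path \<open>q\<close> is run through in both directions, so its
    contribution cancels and the loop gains exactly the integral over
    \<open>\<delta>\<close>.\<close>
  define \<eta> where "\<eta> = \<nu> +++ ((q +++ \<delta>) +++ reversepath q)"
  have "valid_path \<eta>" "pathstart \<eta> = p" "pathfinish \<eta> = p" "path_image \<eta> \<subseteq> W"
    unfolding \<eta>_def using \<nu> \<delta> q vq by (auto simp: path_image_join)
  moreover have "contour_integral \<eta> F = (\<Sum>\<nu>\<leftarrow>\<delta> # \<Gamma>. contour_integral \<nu> F)"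
    if F: "F holomorphic_on W" for F
  proof -
    note intg = contour_integrable_holomorphic_simple[OF F W(1)]
    have "F contour_integrable_on \<nu>" "F contour_integrable_on \<delta>" "F contour_integrable_on q"
      using intg \<nu> \<delta> q vq by auto
    then show ?thesis
      unfolding \<eta>_def using \<nu> \<delta> q vq \<nu>_int[OF F]
      by (simp add: contour_integrable_reversepath contour_integral_reversepath
          contour_integrable_joinI)
  qed
  ultimately show ?case
    by blast
qed

text \<open>Merging the cycle into one loop reduces this to the homology form for a single closed
  path.\<close>

theorem Cauchy_theorem_cycle:
  assumes W: "open W" "connected W"
    and \<Gamma>: "\<And>\<nu>. \<nu> \<in> set \<Gamma> \<Longrightarrow>
      valid_path \<nu> \<and> pathfinish \<nu> = pathstart \<nu> \<and> path_image \<nu> \<subseteq> W"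
    and zero: "\<And>z. z \<notin> W \<Longrightarrow> (\<Sum>\<nu>\<leftarrow>\<Gamma>. winding_number \<nu> z) = 0"
    and F: "F holomorphic_on W"
  shows "(\<Sum>\<nu>\<leftarrow>\<Gamma>. contour_integral \<nu> F) = 0"
proof (cases "\<Gamma> = []")
  case False
  then have "hd \<Gamma> \<in> set \<Gamma>"
    by simp
  then obtain p where "p \<in> W"
    using \<Gamma> by (meson pathstart_in_path_image subsetD)
  obtain \<nu> where \<nu>: "valid_path \<nu>" "pathstart \<nu> = p" "pathfinish \<nu> = p" "path_image \<nu> \<subseteq> W"
    and \<nu>_int: "\<And>F. F holomorphic_on W \<Longrightarrow>
      contour_integral \<nu> F = (\<Sum>\<nu>\<leftarrow>\<Gamma>. contour_integral \<nu> F)"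
    using join_closed_paths[OF W \<open>p \<in> W\<close> \<Gamma>] by blast
  \<comment> \<open>Up to the factor 1 / (2 pi i), the winding number about a point outside
    \<open>W\<close> is the integral of a function holomorphic on \<open>W\<close>, so the merged
    loop inherits it from the cycle.\<close>
  have "winding_number \<nu> z = 0" if "z \<notin> W" for z
  proof -
    have "(\<lambda>w. 1 / (w - z)) holomorphic_on W"
      using that by (auto intro!: holomorphic_intros)
    then have "contour_integral \<nu> (\<lambda>w. 1 / (w - z)) =
        (\<Sum>\<nu>\<leftarrow>\<Gamma>. contour_integral \<nu> (\<lambda>w. 1 / (w - z)))"
      by (rule \<nu>_int)
    moreover have "winding_number \<delta> z = 1 / (2 * pi * \<i>) * contour_integral \<delta> (\<lambda>w. 1 / (w - z))"
      if "\<delta> \<in> set \<Gamma>" for \<delta>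
      using \<Gamma>[OF that] \<open>z \<notin> W\<close> by (intro winding_number_valid_path) auto
    then have "(\<Sum>\<nu>\<leftarrow>\<Gamma>. winding_number \<nu> z) =
        1 / (2 * pi * \<i>) * (\<Sum>\<nu>\<leftarrow>\<Gamma>. contour_integral \<nu> (\<lambda>w. 1 / (w - z)))"
      by (simp add: sum_list_const_mult[symmetric] cong: map_cong)
    ultimately show ?thesis
      using winding_number_valid_path[of \<nu> z] \<nu> zero[OF \<open>z \<notin> W\<close>] \<open>z \<notin> W\<close> by auto
  qed
  then have "contour_integral \<nu> F = 0"
    using Cauchy_theorem_global[OF W(1) F \<nu>(1) _ \<nu>(4)] \<nu> by (simp add: contour_integral_unique)
  then show ?thesis
    using \<nu>_int[OF F] by simp
qed simp

text \<open>Serves two ends: the cycle chosen inside \<open>hol_calc\<close> can be replaced by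
  explicit circles, and the circles can be moved within the domain.\<close>

corollary homologous_cycles_integral_eq:
  assumes W: "open W" "connected W"
    and \<Gamma>: "\<And>\<nu>. \<nu> \<in> set \<Gamma> \<union> set \<Delta> \<Longrightarrow>
      valid_path \<nu> \<and> pathfinish \<nu> = pathstart \<nu> \<and> path_image \<nu> \<subseteq> W"
    and eq: "\<And>z. z \<notin> W \<Longrightarrow>
      (\<Sum>\<nu>\<leftarrow>\<Gamma>. winding_number \<nu> z) = (\<Sum>\<nu>\<leftarrow>\<Delta>. winding_number \<nu> z)"
    and F: "F holomorphic_on W"
  shows "(\<Sum>\<nu>\<leftarrow>\<Gamma>. contour_integral \<nu> F) = (\<Sum>\<nu>\<leftarrow>\<Delta>. contour_integral \<nu> F)"
proof -
  have "(\<Sum>\<nu>\<leftarrow>\<Gamma> @ map reversepath \<Delta>. contour_integral \<nu> F) = 0"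
  proof (rule Cauchy_theorem_cycle[OF W _ _ F])
    fix z assume "z \<notin> W"
    then have "winding_number (reversepath \<nu>) z = - winding_number \<nu> z" if "\<nu> \<in> set \<Delta>" for \<nu>
      using \<Gamma>[of \<nu>] that by (intro winding_number_reversepath) (auto intro: valid_path_imp_path)
    then show "(\<Sum>\<nu>\<leftarrow>\<Gamma> @ map reversepath \<Delta>. winding_number \<nu> z) = 0"
      using eq[OF \<open>z \<notin> W\<close>] by (simp add: o_def uminus_sum_list_map[unfolded o_def, symmetric] cong: map_cong)
  qed (use \<Gamma> in fastforce)
  moreover have "contour_integral (reversepath \<nu>) F = - contour_integral \<nu> F" if "\<nu> \<in> set \<Delta>" for \<nu>
    using \<Gamma>[of \<nu>] that by (intro contour_integral_reversepath) auto
  ultimately show ?thesis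
    by (simp add: o_def uminus_sum_list_map[unfolded o_def, symmetric] cong: map_cong)
qed

text \<open>Disks are removed one at a time. Janiszewski's theorem applies because the next closed
  disk and the complement of what is left of the ball are disjoint, and neither separates the
  plane.\<close>

lemma connected_ball_minus_disjoint_cballs:
  fixes c :: "'i \<Rightarrow> complex"
  assumes "finite I" "\<And>i. i \<in> I \<Longrightarrow> cball (c i) (r i) \<subseteq> ball a \<rho>"
    and "disjoint_family_on (\<lambda>i. cball (c i) (r i)) I"
  shows "connected (ball a \<rho> - (\<Union>i\<in>I. cball (c i) (r i)))"
  using assms
proof (induction I rule: finite_induct)
  case (insert i I)
  let ?T = "- (ball a \<rho> - (\<Union>i\<in>I. cball (c i) (r i)))"
  have "connected (- (cball (c i) (r i) \<union> ?T))"
  proof (rule Janiszewski_connected)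
    have "closed (\<Union>i\<in>I. cball (c i) (r i))"
      using insert.hyps by auto
    then show "closed ?T"
      using open_Diff[OF open_ball] by (simp only: closed_def double_compl)
    have "cball (c i) (r i) \<inter> cball (c j) (r j) = {}" if "j \<in> I" for j
      using insert.hyps insert.prems(2) that unfolding disjoint_family_on_def by (metis insertCI)
    then have "cball (c i) (r i) \<inter> ?T = {}"
      using insert.prems(1)[of i] by auto
    then show "connected (cball (c i) (r i) \<inter> ?T)"
      by simp
    show "connected (- cball (c i) (r i))"
      by (intro connected_complement_bounded_convex) auto
    show "connected (- ?T)"
      unfolding double_compl
      by (rule insert.IH) (use insert.prems in \<open>auto simp: disjoint_family_on_def\<close>)
  qed auto
  moreover have "- (cball (c i) (r i) \<union> ?T) = ball a \<rho> - (\<Union>i\<in>insert i I. cball (c i) (r i))"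
    by auto
  ultimately show ?case
    by simp
qed simp

section \<open>Means over circles\<close>

text \<open>Means over normalised arc length commute with conjugation and preserve positivity, which
  contour integrals do not. The value type is left open because real kernels are averaged as well as
  complex functions.\<close>

definition circ_mean :: "complex \<Rightarrow> real \<Rightarrow> (complex \<Rightarrow> 'a::real_normed_vector) \<Rightarrow> 'a" where
  "circ_mean a \<rho> h = integral {0..1} (\<lambda>\<theta>. h (circlepath a \<rho> \<theta>))"

lemma circlepath_in_sphere: "0 \<le> \<rho> \<Longrightarrow> circlepath a \<rho> \<theta> \<in> sphere a \<rho>"
  by (simp add: circlepath dist_norm norm_mult)

lemma continuous_on_circlepath: "continuous_on S (circlepath a \<rho>)"
  unfolding circlepath by (intro continuous_intros)

lemma circ_integrable:
  fixes h :: "complex \<Rightarrow> 'a::banach"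
  assumes "continuous_on (sphere a \<rho>) h" "0 \<le> \<rho>"
  shows "(\<lambda>\<theta>. h (circlepath a \<rho> \<theta>)) integrable_on {0..1}"
  by (intro integrable_continuous_interval continuous_on_compose2[OF assms(1)]
      continuous_on_circlepath) (use circlepath_in_sphere[OF assms(2)] in auto)

lemma circ_mean_cong:
  assumes "\<And>\<xi>. \<xi> \<in> sphere a \<rho> \<Longrightarrow> g \<xi> = h \<xi>" "0 \<le> \<rho>"
  shows "circ_mean a \<rho> g = circ_mean a \<rho> h"
  unfolding circ_mean_def
  by (rule integral_cong) (use assms circlepath_in_sphere[OF assms(2)] in auto)

text \<open>On the circle the differential of \<xi> is 2 pi i (\<xi> - a) times that of the
  parameter, whence the factor \<open>\<xi> - a\<close>.\<close>

lemma circ_mean_eq_contour_integral: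
  "circ_mean a \<rho> (\<lambda>\<xi>. F \<xi> * (\<xi> - a)) =
     contour_integral (circlepath a \<rho>) F / (2 * of_real pi * \<i>)"
proof -
  have "contour_integral (circlepath a \<rho>) F =
      integral {0..1} (\<lambda>x. F (circlepath a \<rho> x) * (circlepath a \<rho> x - a) * (2 * of_real pi * \<i>))"
    unfolding contour_integral_integral vector_derivative_circlepath
    by (rule integral_cong) (simp add: circlepath)
  also have "... = circ_mean a \<rho> (\<lambda>\<xi>. F \<xi> * (\<xi> - a)) * (2 * of_real pi * \<i>)"
    unfolding circ_mean_def by (simp only: integral_mult_left)
  finally show ?thesis
    by simp
qed

lemma circ_mean_const [simp]: "circ_mean a \<rho> (\<lambda>\<xi>. k) = k"
  by (simp add: circ_mean_def)

lemma circ_mean_add: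
  fixes g :: "complex \<Rightarrow> 'a::banach"
  assumes "continuous_on (sphere a \<rho>) g" "continuous_on (sphere a \<rho>) h" "0 \<le> \<rho>"
  shows "circ_mean a \<rho> (\<lambda>\<xi>. g \<xi> + h \<xi>) = circ_mean a \<rho> g + circ_mean a \<rho> h"
  unfolding circ_mean_def
  by (intro integral_add circ_integrable[OF assms(1,3)] circ_integrable[OF assms(2,3)])

lemma circ_mean_diff:
  fixes g :: "complex \<Rightarrow> 'a::banach"
  assumes "continuous_on (sphere a \<rho>) g" "continuous_on (sphere a \<rho>) h" "0 \<le> \<rho>"
  shows "circ_mean a \<rho> (\<lambda>\<xi>. g \<xi> - h \<xi>) = circ_mean a \<rho> g - circ_mean a \<rho> h"
  unfolding circ_mean_def
  by (intro integral_diff circ_integrable[OF assms(1,3)] circ_integrable[OF assms(2,3)])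

lemma circ_mean_sum:
  fixes g :: "'i \<Rightarrow> complex \<Rightarrow> 'a::banach"
  assumes "finite I" "\<And>i. i \<in> I \<Longrightarrow> continuous_on (sphere a \<rho>) (g i)" "0 \<le> \<rho>"
  shows "circ_mean a \<rho> (\<lambda>\<xi>. \<Sum>i\<in>I. g i \<xi>) = (\<Sum>i\<in>I. circ_mean a \<rho> (g i))"
  unfolding circ_mean_def
  by (intro integral_sum assms(1) circ_integrable[OF assms(2,3)])

lemma circ_mean_mult_right:
  fixes k :: "'a::{real_normed_field}"
  shows "circ_mean a \<rho> (\<lambda>\<xi>. k * h \<xi>) = k * circ_mean a \<rho> h"
  unfolding circ_mean_def by simp

lemma circ_mean_cnj: "circ_mean a \<rho> (\<lambda>\<xi>. cnj (h \<xi>)) = cnj (circ_mean a \<rho> h)"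
  unfolding circ_mean_def by (rule integral_cnj[symmetric])

lemma circ_mean_of_real:
  assumes "continuous_on (sphere a \<rho>) h" "0 \<le> \<rho>"
  shows "circ_mean a \<rho> (\<lambda>\<xi>. complex_of_real (h \<xi>)) = of_real (circ_mean a \<rho> h)"
  unfolding circ_mean_def
  using integral_linear[OF circ_integrable[OF assms] bounded_linear_of_real]
  by (simp add: o_def)

lemma norm_circ_mean_le:
  fixes h :: "complex \<Rightarrow> 'a::banach"
  assumes "continuous_on (sphere a \<rho>) h" "continuous_on (sphere a \<rho>) b" "0 \<le> \<rho>"
    and "\<And>\<xi>. \<xi> \<in> sphere a \<rho> \<Longrightarrow> norm (h \<xi>) \<le> b \<xi>"
  shows "norm (circ_mean a \<rho> h) \<le> circ_mean a \<rho> b"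
  unfolding circ_mean_def
  by (intro integral_norm_bound_integral circ_integrable[OF assms(1,3)] circ_integrable[OF assms(2,3)]
      assms(4) circlepath_in_sphere assms(3))

lemma norm_circ_mean_le_const:
  fixes h :: "complex \<Rightarrow> 'a::banach"
  assumes "continuous_on (sphere a \<rho>) h" "0 \<le> \<rho>"
    and "\<And>\<xi>. \<xi> \<in> sphere a \<rho> \<Longrightarrow> norm (h \<xi>) \<le> b"
  shows "norm (circ_mean a \<rho> h) \<le> b"
  using norm_circ_mean_le[of a \<rho> h "\<lambda>_. b"] assms by simp

lemma winding_circle:
  assumes "0 < \<rho>" "cmod (z - a) \<noteq> \<rho>"
  shows "winding_number (circlepath a \<rho>) z = (if cmod (z - a) < \<rho> then 1 else 0)"
    "winding_number (reversepath (circlepath a \<rho>)) z = - (if cmod (z - a) < \<rho> then 1 else 0)"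
proof -
  have *: "z \<notin> path_image (circlepath a \<rho>)"
    using assms by (auto simp: dist_norm norm_minus_commute)
  show "winding_number (circlepath a \<rho>) z = (if cmod (z - a) < \<rho> then 1 else 0)"
  proof (cases "cmod (z - a) < \<rho>")
    case False
    then show ?thesis
      using assms by (simp, intro winding_number_zero_outside[of _ "cball a \<rho>"])
        (auto simp: dist_norm norm_minus_commute)
  qed (simp add: winding_number_circlepath)
  then show "winding_number (reversepath (circlepath a \<rho>)) z = - (if cmod (z - a) < \<rho> then 1 else 0)"
    using winding_number_reversepath[OF path_circlepath *] by simp
qed

lemma circ_mean_cauchy_kernel:
  assumes "0 < \<rho>" "cmod (z - a) \<noteq> \<rho>"
  shows "circ_mean a \<rho> (\<lambda>\<xi>. (\<xi> - a) / (\<xi> - z)) = (if cmod (z - a) < \<rho> then 1 else 0)"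
proof -
  have "z \<notin> path_image (circlepath a \<rho>)"
    using assms by (auto simp: dist_norm norm_minus_commute)
  then have "circ_mean a \<rho> (\<lambda>\<xi>. (\<xi> - a) / (\<xi> - z)) = winding_number (circlepath a \<rho>) z"
    using circ_mean_eq_contour_integral[of a \<rho> "\<lambda>\<xi>. 1 / (\<xi> - z)"]
    by (simp add: winding_number_valid_path)
  then show ?thesis
    using winding_circle(1)[OF assms] by simp
qed

section \<open>Multiply connected circular domains\<close>

text \<open>\<open>t0\<close> bounds how far each circle is moved into the domain. The gaps carry
  \<open>2 * t0\<close> because two facing circles may move at the same time.\<close>

locale multi_disk =
  fixes n :: nat and R t0 :: real and c :: "nat \<Rightarrow> complex" and r :: "nat \<Rightarrow> real"
  assumes t0_pos: "0 < t0" and t0_less_R: "t0 < R"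
    and r_pos: "\<And>i. i \<in> {1..n} \<Longrightarrow> 0 < r i"
    and outer_gap: "\<And>i. i \<in> {1..n} \<Longrightarrow> cmod (c i) + r i + 2 * t0 < R"
    and inner_gap: "\<And>i j. i \<in> {1..n} \<Longrightarrow> j \<in> {1..n} \<Longrightarrow> i \<noteq> j \<Longrightarrow>
      r i + r j + 2 * t0 < cmod (c i - c j)"
begin

definition cc :: "nat \<Rightarrow> complex" where "cc j = (if j = 0 then 0 else c j)"
definition rho :: "real \<Rightarrow> nat \<Rightarrow> real" where "rho t j = (if j = 0 then R - t else r j + t)"
definition sg :: "nat \<Rightarrow> complex" where "sg j = (if j = 0 then 1 else - 1)"

definition dom :: "real \<Rightarrow> complex set" where
  "dom t = multi_disk_domain (R - t) n c (\<lambda>i. r i + t)"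

definition bdry :: "real \<Rightarrow> complex set" where
  "bdry t = (\<Union>j\<le>n. sphere (cc j) (rho t j))"

text \<open>\<open>1 / (2 \<pi> \<i>)\<close> times the integral of \<open>F\<close> over the oriented boundary of \<open>dom t\<close>.\<close>

definition cyc :: "real \<Rightarrow> (complex \<Rightarrow> complex) \<Rightarrow> complex" where
  "cyc t F = (\<Sum>j\<le>n. sg j * circ_mean (cc j) (rho t j) (\<lambda>\<xi>. F \<xi> * (\<xi> - cc j)))"

text \<open>The oriented boundary once more, now as a list of paths, the form required by
  \<open>surrounds\<close> and by Cauchy's theorem; \<open>cyc\<close> is the form used for
  estimates.\<close>

definition cycle :: "real \<Rightarrow> (real \<Rightarrow> complex) list" where
  "cycle t = circlepath 0 (R - t) #
     map (\<lambda>j. reversepath (circlepath (c j) (r j + t))) [1..<Suc n]"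

lemma atMost_n: "{..n} = insert 0 {1..n}" "0 \<notin> {1..n}"
  by auto

lemma cycle_sum:
  "(\<Sum>\<nu>\<leftarrow>cycle t. g \<nu>) = g (circlepath 0 (R - t)) +
     (\<Sum>j\<in>{1..n}. g (reversepath (circlepath (c j) (r j + t))))"
proof -
  have "(\<Sum>j\<leftarrow>[1..<Suc n]. h j) = (\<Sum>j\<in>{1..n}. h j)" for h :: "nat \<Rightarrow> 'a"
    by (simp add: sum_list_distinct_conv_sum_set atLeastLessThanSuc_atLeastAtMost del: upt_Suc)
  then show ?thesis
    by (simp add: cycle_def o_def del: upt_Suc)
qed

lemma cyc_eq_cycle:
  "cyc t F = (\<Sum>\<nu>\<leftarrow>cycle t. contour_integral \<nu> F) / (2 * of_real pi * \<i>)"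
  unfolding cycle_sum cyc_def circ_mean_eq_contour_integral atMost_n
  by (simp add: cc_def rho_def sg_def contour_integral_reversepath sum_divide_distrib
      diff_divide_distrib sum_negf)

lemma rho_pos: "0 \<le> t \<Longrightarrow> t \<le> t0 \<Longrightarrow> j \<le> n \<Longrightarrow> 0 < rho t j"
  using r_pos[of j] t0_less_R by (auto simp: rho_def)

lemma rho_nonneg: "0 \<le> t \<Longrightarrow> t \<le> t0 \<Longrightarrow> j \<le> n \<Longrightarrow> 0 \<le> rho t j"
  using rho_pos by (rule less_imp_le)

lemma open_dom: "open (dom t)"
  unfolding dom_def multi_disk_domain_def by (intro open_Diff closed_UN) auto

lemma mem_dom: "z \<in> dom t \<longleftrightarrow> cmod z < R - t \<and> (\<forall>i\<in>{1..n}. r i + t < cmod (z - c i))"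
  by (auto simp: dom_def multi_disk_domain_def dist_norm norm_minus_commute not_le)

lemma mem_bdry: "z \<in> bdry t \<longleftrightarrow> cmod z = R - t \<or> (\<exists>i\<in>{1..n}. cmod (z - c i) = r i + t)"
  unfolding bdry_def atMost_n using atMost_n(2)
  by (auto simp: cc_def rho_def dist_norm norm_minus_commute)

lemma sphere_subset_bdry: "j \<le> n \<Longrightarrow> sphere (cc j) (rho t j) \<subseteq> bdry t"
  by (auto simp: bdry_def)

lemma dom_antimono: "s \<le> t \<Longrightarrow> dom t \<subseteq> dom s"
  by (fastforce simp: mem_dom)

lemma mem_dom_circle:
  assumes "j \<in> {1..n}" "cmod (z - c j) = r j + t" "0 \<le> s" "s < t" "t \<le> t0"
  shows "z \<in> dom s"
proof -
  have "cmod z < R - s"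
    using norm_triangle_ineq[of "c j" "z - c j"] outer_gap[OF assms(1)] assms by simp
  moreover have "r i + s < cmod (z - c i)" if "i \<in> {1..n}" for i
  proof (cases "i = j")
    case False
    then show ?thesis
      using norm_triangle_ineq[of "c j - z" "z - c i"] inner_gap[OF assms(1) that] assms
      by (simp add: norm_minus_commute)
  qed (use assms in simp)
  ultimately show ?thesis
    by (simp add: mem_dom)
qed

lemma bdry_subset_dom:
  assumes "0 \<le> s" "s < t" "t \<le> t0"
  shows "bdry t \<subseteq> dom s"
proof
  fix z assume "z \<in> bdry t"
  then consider "cmod z = R - t" | j where "j \<in> {1..n}" "cmod (z - c j) = r j + t"
    by (auto simp: mem_bdry)
  then show "z \<in> dom s"
  proof cases
    case 1
    have "r i + s < cmod (z - c i)" if "i \<in> {1..n}" for i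
      using norm_triangle_ineq[of "c i" "z - c i"] outer_gap[OF that] assms 1 by simp
    then show ?thesis
      using 1 assms by (simp add: mem_dom)
  qed (use mem_dom_circle assms in blast)
qed

lemma bdry_Int_dom: "bdry t \<inter> dom t = {}"
  by (metis disjoint_iff less_irrefl mem_bdry mem_dom)

lemma closure_dom: "closure (dom t) \<subseteq> dom t \<union> bdry t"
proof -
  have "closed (cball 0 (R - t) - (\<Union>i\<in>{1..n}. ball (c i) (r i + t)))"
    by (intro closed_Diff open_UN) auto
  then have "closure (dom t) \<subseteq> cball 0 (R - t) - (\<Union>i\<in>{1..n}. ball (c i) (r i + t))"
    by (intro closure_minimal) (auto simp: dom_def multi_disk_domain_def)
  also have "... \<subseteq> dom t \<union> bdry t"
  proof
    fix z assume "z \<in> cball 0 (R - t) - (\<Union>i\<in>{1..n}. ball (c i) (r i + t))"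
    then have "cmod z \<le> R - t" "\<forall>i\<in>{1..n}. r i + t \<le> cmod (z - c i)"
      by (auto simp: dist_norm norm_minus_commute not_less)
    then show "z \<in> dom t \<union> bdry t"
      unfolding Un_iff mem_dom mem_bdry by (metis order_le_less)
  qed
  finally show ?thesis .
qed

lemma connected_dom:
  assumes "0 \<le> t" "t \<le> t0"
  shows "connected (dom t)"
  unfolding dom_def multi_disk_domain_def
proof (rule connected_ball_minus_disjoint_cballs)
  fix i assume i: "i \<in> {1..n}"
  then show "cball (c i) (r i + t) \<subseteq> ball 0 (R - t)"
    using outer_gap[OF i] assms r_pos[OF i] by (simp add: cball_subset_ball_iff)
next
  have "cball (c i) (r i + t) \<inter> cball (c j) (r j + t) = {}"
    if "i \<in> {1..n}" "j \<in> {1..n}" "i \<noteq> j" for i j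
    using inner_gap[OF that] assms by (intro disjoint_cballI) (simp add: dist_norm)
  then show "disjoint_family_on (\<lambda>i. cball (c i) (r i + t)) {1..n}"
    by (auto simp: disjoint_family_on_def)
qed simp

lemma cycle_paths:
  assumes "0 \<le> t" "t \<le> t0" "\<nu> \<in> set (cycle t)"
  shows "valid_path \<nu> \<and> pathfinish \<nu> = pathstart \<nu> \<and> path_image \<nu> \<subseteq> bdry t"
proof -
  consider "\<nu> = circlepath 0 (R - t)"
    | j where "j \<in> {1..n}" "\<nu> = reversepath (circlepath (c j) (r j + t))"
    using assms(3) unfolding cycle_def
    by (auto simp: atLeastLessThanSuc_atLeastAtMost simp del: upt_Suc)
  then show ?thesis
  proof cases
    case 1
    then show ?thesis
      using assms t0_less_R by (auto simp: mem_bdry dist_norm)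
  next
    case 2
    then show ?thesis
      using assms r_pos[of j] by (auto simp: mem_bdry dist_norm norm_minus_commute)
  qed
qed

text \<open>The outer circle counts 1, and an inner disk containing \<open>z\<close> counts -1. The
  gap conditions allow at most one such disk and place it inside the outer circle.\<close>

lemma winding_cycle:
  assumes t: "0 \<le> t" "t \<le> t0" and z: "z \<notin> bdry t"
  shows "(\<Sum>\<nu>\<leftarrow>cycle t. winding_number \<nu> z) = (if z \<in> dom t then 1 else 0)"
proof -
  have nz: "cmod z \<noteq> R - t" "\<And>i. i \<in> {1..n} \<Longrightarrow> cmod (z - c i) \<noteq> r i + t"
    using z by (auto simp: mem_bdry)
  have W: "(\<Sum>\<nu>\<leftarrow>cycle t. winding_number \<nu> z) = (if cmod z < R - t then 1 else 0) +
      (\<Sum>j\<in>{1..n}. - (if cmod (z - c j) < r j + t then 1 else 0))"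
    unfolding cycle_sum
  proof (intro arg_cong2[of _ _ _ _ plus] sum.cong refl)
    show "winding_number (circlepath 0 (R - t)) z = (if cmod z < R - t then 1 else 0)"
      using winding_circle[of "R - t" z 0] nz t t0_less_R by simp
    fix i assume i: "i \<in> {1..n}"
    show "winding_number (reversepath (circlepath (c i) (r i + t))) z =
        - (if cmod (z - c i) < r i + t then 1 else 0)"
      using winding_circle(2)[of "r i + t" z "c i"] nz(2)[OF i] r_pos[OF i] t by simp
  qed
  show ?thesis
  proof (cases "\<exists>i\<in>{1..n}. cmod (z - c i) < r i + t")
    case True
    then obtain i where i: "i \<in> {1..n}" "cmod (z - c i) < r i + t"
      by blast
    have "cmod z < R - t"
      using norm_triangle_ineq[of "c i" "z - c i"] outer_gap[OF i(1)] i t by simp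
    moreover have "\<not> cmod (z - c j) < r j + t" if "j \<in> {1..n} - {i}" for j
      using norm_triangle_ineq[of "c j - z" "z - c i"] inner_gap[of j i] i t that
      by (auto simp: norm_minus_commute)
    then have "(\<Sum>j\<in>{1..n}. - (if cmod (z - c j) < r j + t then 1 else 0)) = (- 1 :: complex)"
      using i by (subst sum.remove[of _ i]) auto
    ultimately have "(\<Sum>\<nu>\<leftarrow>cycle t. winding_number \<nu> z) = 0"
      unfolding W by simp
    moreover have "z \<notin> dom t"
      using i by (force simp: mem_dom)
    ultimately show ?thesis
      by simp
  next
    case False
    then have "(\<Sum>j\<in>{1..n}. - (if cmod (z - c j) < r j + t then 1 else 0)) = (0 :: complex)"
      by (intro sum.neutral) auto
    moreover have "r i + t < cmod (z - c i)" if "i \<in> {1..n}" for i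
      using False nz(2)[OF that] that by (meson linorder_neqE_linordered_idom)
    then have "z \<in> dom t \<longleftrightarrow> cmod z < R - t"
      unfolding mem_dom by blast
    ultimately show ?thesis
      unfolding W by simp
  qed
qed

text \<open>\<open>S\<close> is a set of singularities inside both cycles: each cycle winds once
  round its points and not at all round points outside \<open>dom s\<close>. Used with the spectrum
  for \<open>S\<close> and a resolvent entry as a factor of \<open>F\<close>.\<close>

lemma cyc_eq:
  assumes "0 \<le> s" "s < t" "s < t'" "t \<le> t0" "t' \<le> t0"
    and S: "finite S" "S \<subseteq> dom t" "S \<subseteq> dom t'"
    and F: "F holomorphic_on dom s - S"
  shows "cyc t F = cyc t' F"
proof -
  have "(\<Sum>\<nu>\<leftarrow>cycle t. contour_integral \<nu> F) = (\<Sum>\<nu>\<leftarrow>cycle t'. contour_integral \<nu> F)"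
  proof (rule homologous_cycles_integral_eq[OF _ _ _ _ F])
    show "open (dom s - S)"
      using open_dom S by (intro open_Diff finite_imp_closed)
    show "connected (dom s - S)"
      using assms open_dom by (intro connected_open_delete_finite connected_dom) auto
    fix \<nu> assume "\<nu> \<in> set (cycle t) \<union> set (cycle t')"
    then show "valid_path \<nu> \<and> pathfinish \<nu> = pathstart \<nu> \<and> path_image \<nu> \<subseteq> dom s - S"
    proof -
      obtain u where u: "u \<in> {t, t'}" "\<nu> \<in> set (cycle u)"
        using \<open>\<nu> \<in> set (cycle t) \<union> set (cycle t')\<close> by blast
      then have "bdry u \<subseteq> dom s - S"
        using bdry_subset_dom[of s u] bdry_Int_dom[of u] assms by blast
      then show ?thesis
        using cycle_paths[of u \<nu>] u assms by fastforce
    qed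
  next
    fix z assume z: "z \<notin> dom s - S"
    have "z \<notin> bdry u \<and> (z \<in> dom u \<longleftrightarrow> z \<in> S)" if "u \<in> {t, t'}" for u
      using z bdry_subset_dom[of s u] bdry_Int_dom[of u] dom_antimono[of s u] that assms by auto
    then show "(\<Sum>\<nu>\<leftarrow>cycle t. winding_number \<nu> z) = (\<Sum>\<nu>\<leftarrow>cycle t'. winding_number \<nu> z)"
      using winding_cycle[of t z] winding_cycle[of t' z] assms by auto
  qed
  then show ?thesis
    by (simp add: cyc_eq_cycle)
qed

lemma cyc_zero:
  assumes "0 \<le> s" "s < t" "t \<le> t0" and F: "F holomorphic_on dom s"
  shows "cyc t F = 0"
proof -
  have "(\<Sum>\<nu>\<leftarrow>cycle t. contour_integral \<nu> F) = 0"
  proof (rule Cauchy_theorem_cycle[OF _ _ _ _ F])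
    show "open (dom s)" "connected (dom s)"
      using assms open_dom by (auto intro: connected_dom)
    fix \<nu> assume "\<nu> \<in> set (cycle t)"
    then show "valid_path \<nu> \<and> pathfinish \<nu> = pathstart \<nu> \<and> path_image \<nu> \<subseteq> dom s"
      using cycle_paths[of t \<nu>] bdry_subset_dom[of s t] assms by fastforce
  next
    fix z assume z: "z \<notin> dom s"
    then have "z \<notin> bdry t" "z \<notin> dom t"
      using bdry_subset_dom[of s t] dom_antimono[of s t] assms by auto
    then show "(\<Sum>\<nu>\<leftarrow>cycle t. winding_number \<nu> z) = 0"
      using winding_cycle[of t z] assms by auto
  qed
  then show ?thesis
    by (simp add: cyc_eq_cycle)
qed

section \<open>Cauchy integrals over the oriented boundary\<close>

abbreviation mean :: "real \<Rightarrow> nat \<Rightarrow> (complex \<Rightarrow> 'a::real_normed_vector) \<Rightarrow> 'a" where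
  "mean t j \<equiv> circ_mean (cc j) (rho t j)"

lemma continuous_on_circle:
  "continuous_on (bdry t) F \<Longrightarrow> j \<le> n \<Longrightarrow> continuous_on (sphere (cc j) (rho t j)) F"
  by (rule continuous_on_subset[OF _ sphere_subset_bdry])

lemma cyc_cong:
  assumes "\<And>\<xi>. \<xi> \<in> bdry t \<Longrightarrow> F \<xi> = G \<xi>" "0 \<le> t" "t \<le> t0"
  shows "cyc t F = cyc t G"
  unfolding cyc_def using assms rho_pos[OF assms(2,3)] sphere_subset_bdry
  by (intro sum.cong refl arg_cong2[of _ _ _ _ times] circ_mean_cong) (auto simp: subset_iff less_imp_le)

lemma cyc_mult_right: "cyc t (\<lambda>\<xi>. k * F \<xi>) = k * cyc t F"
  unfolding cyc_def by (simp add: mult.assoc circ_mean_mult_right sum_distrib_left mult.left_commute)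

lemma cyc_sum:
  assumes "finite I" "\<And>i. i \<in> I \<Longrightarrow> continuous_on (bdry t) (F i)" "0 \<le> t" "t \<le> t0"
  shows "cyc t (\<lambda>\<xi>. \<Sum>i\<in>I. F i \<xi>) = (\<Sum>i\<in>I. cyc t (F i))"
proof -
  have "mean t j (\<lambda>\<xi>. (\<Sum>i\<in>I. F i \<xi>) * (\<xi> - cc j)) =
      (\<Sum>i\<in>I. mean t j (\<lambda>\<xi>. F i \<xi> * (\<xi> - cc j)))" if "j \<le> n" for j
    unfolding sum_distrib_right
    by (intro circ_mean_sum continuous_intros continuous_on_circle assms(1,2) that
        rho_nonneg assms(3,4))
  then show ?thesis
    unfolding cyc_def by (simp add: sum_distrib_left) (rule sum.swap)
qed

lemma cyc_add:
  assumes "continuous_on (bdry t) F" "continuous_on (bdry t) G" "0 \<le> t" "t \<le> t0"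
  shows "cyc t (\<lambda>\<xi>. F \<xi> + G \<xi>) = cyc t F + cyc t G"
  using cyc_sum[of "UNIV :: bool set" t "\<lambda>b. if b then F else G"] assms by (simp add: UNIV_bool add.commute)

lemma cyc_diff:
  assumes "continuous_on (bdry t) F" "continuous_on (bdry t) G" "0 \<le> t" "t \<le> t0"
  shows "cyc t (\<lambda>\<xi>. F \<xi> - G \<xi>) = cyc t F - cyc t G"
  using cyc_add[of t F "\<lambda>\<xi>. - 1 * G \<xi>"] cyc_mult_right[of t "- 1" G] assms
  by (simp add: continuous_on_minus)

lemma continuous_on_bdry:
  "F holomorphic_on dom s \<Longrightarrow> 0 \<le> s \<Longrightarrow> s < t \<Longrightarrow> t \<le> t0 \<Longrightarrow> continuous_on (bdry t) F"
  by (meson bdry_subset_dom continuous_on_subset holomorphic_on_imp_continuous_on)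

lemma dom_bdry_neq: "z \<in> dom t \<Longrightarrow> \<xi> \<in> bdry t \<Longrightarrow> \<xi> \<noteq> z"
  using bdry_Int_dom by auto

lemma dom_not_on_circle: "z \<in> dom t \<Longrightarrow> cmod z < rho t 0"
  "z \<in> dom t \<Longrightarrow> j \<in> {1..n} \<Longrightarrow> rho t j < cmod (z - cc j)"
  by (auto simp: mem_dom rho_def cc_def)

lemma cc_rho_simps [simp]: "cc 0 = 0" "rho t 0 = R - t" "sg 0 = 1"
  by (auto simp: cc_def rho_def sg_def)

lemma cc_rho_pos: "j \<in> {1..n} \<Longrightarrow> cc j = c j \<and> rho t j = r j + t \<and> sg j = - 1"
  by (auto simp: cc_def rho_def sg_def)

lemma mean_cauchy_kernel:
  assumes "0 \<le> t" "t \<le> t0" "z \<in> dom t" "j \<le> n"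
  shows "mean t j (\<lambda>\<xi>. (\<xi> - cc j) / (\<xi> - z)) = (if j = 0 then 1 else 0)"
  using circ_mean_cauchy_kernel[OF rho_pos[OF assms(1,2,4)], of z "cc j"]
    dom_not_on_circle(1)[OF assms(3)] dom_not_on_circle(2)[OF assms(3), of j] assms(4)
  by (cases "j = 0") auto

lemma cyc_cauchy_kernel:
  assumes "0 \<le> t" "t \<le> t0" "z \<in> dom t"
  shows "cyc t (\<lambda>\<xi>. 1 / (\<xi> - z)) = 1"
proof -
  have "cyc t (\<lambda>\<xi>. 1 / (\<xi> - z)) = (\<Sum>j\<le>n. if j = 0 then 1 else 0)"
    unfolding cyc_def using mean_cauchy_kernel[OF assms]
    by (intro sum.cong refl) (auto split: if_splits)
  then show ?thesis
    by simp
qed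

lemma continuous_on_cauchy_kernel:
  assumes "continuous_on (bdry t) w" "z \<in> dom t"
  shows "continuous_on (bdry t) (\<lambda>\<xi>. w \<xi> / (\<xi> - z))"
  using dom_bdry_neq[OF assms(2)] by (intro continuous_intros assms(1)) auto

lemma cyc_cauchy_formula:
  assumes "0 \<le> s" "s < t" "t \<le> t0" and f: "f holomorphic_on dom s" and z: "z \<in> dom t"
  shows "cyc t (\<lambda>\<xi>. f \<xi> / (\<xi> - z)) = f z"
proof -
  \<comment> \<open>The difference quotient extends holomorphically over \<open>z\<close>, so its
    integral vanishes and only the integral of the kernel 1 / (\<xi> - z) remains.\<close>
  let ?h = "\<lambda>w. if w = z then deriv f z else (f w - f z) / (w - z)"
  have "?h holomorphic_on dom s"
    by (rule pole_lemma_open[OF f open_dom])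
  then have "cyc t ?h = 0"
    by (rule cyc_zero[OF assms(1-3)])
  moreover have "cyc t ?h = cyc t (\<lambda>\<xi>. f \<xi> / (\<xi> - z) - f z * (1 / (\<xi> - z)))"
    using dom_bdry_neq[OF z] assms by (intro cyc_cong) (auto simp: diff_divide_distrib)
  moreover have "... = cyc t (\<lambda>\<xi>. f \<xi> / (\<xi> - z)) - cyc t (\<lambda>\<xi>. f z * (1 / (\<xi> - z)))"
    using assms f z
    by (intro cyc_diff continuous_on_mult_left continuous_on_cauchy_kernel continuous_on_bdry
        continuous_on_const) auto
  ultimately show ?thesis
    using cyc_cauchy_kernel[of t z] assms by (simp add: cyc_mult_right[of t "f z" "\<lambda>\<xi>. 1 / (\<xi> - z)", simplified])
qed

lemma cyc_eq_sum_contour: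
  "cyc t F = (\<Sum>j\<le>n. sg j / (2 * of_real pi * \<i>) * contour_integral (circlepath (cc j) (rho t j)) F)"
  unfolding cyc_def circ_mean_eq_contour_integral by simp

text \<open>The density \<open>w\<close> is only assumed continuous, since it will be the conjugate
  of \<open>f\<close>, which in general is not holomorphic.\<close>

lemma holomorphic_cauchy_integral:
  assumes t: "0 \<le> t" "t \<le> t0" and w: "continuous_on (bdry t) w"
  shows "(\<lambda>z. cyc t (\<lambda>\<xi>. w \<xi> / (\<xi> - z))) holomorphic_on dom t"
proof -
  have "(\<lambda>z. contour_integral (circlepath (cc j) (rho t j)) (\<lambda>\<xi>. w \<xi> / (\<xi> - z)))
      holomorphic_on dom t" if j: "j \<le> n" for j
  proof -
    let ?\<nu> = "circlepath (cc j) (rho t j)"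
    have img: "path_image ?\<nu> \<subseteq> bdry t"
      using rho_pos[OF t j] sphere_subset_bdry[OF j] by simp
    have "(\<lambda>z. contour_integral ?\<nu> (\<lambda>\<xi>. w \<xi> / (\<xi> - z))) field_differentiable at z"
      if z: "z \<in> dom t" for z
    proof -
      \<comment> \<open>The exponent 1 matches the general power of the denominator in
        \<open>Cauchy_next_derivative\<close>.\<close>
      have int: "((\<lambda>\<xi>. w \<xi> / (\<xi> - z) ^ 1) has_contour_integral
          contour_integral ?\<nu> (\<lambda>\<xi>. w \<xi> / (\<xi> - z))) ?\<nu>" if "z \<in> UNIV - path_image ?\<nu>" for z
      proof -
        have "(\<lambda>\<xi>. w \<xi> / (\<xi> - z)) contour_integrable_on ?\<nu>"
          using that by (intro contour_integrable_continuous_circlepath continuous_intros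
              continuous_on_subset[OF w img]) auto
        then show ?thesis
          by (simp add: has_contour_integral_integral)
      qed
      have "norm (vector_derivative ?\<nu> (at x)) \<le> 2 * pi * \<bar>rho t j\<bar>" for x
        by (simp add: vector_derivative_circlepath norm_mult)
      then show ?thesis
        using Cauchy_next_derivative(2)[OF continuous_on_subset[OF w img] _ int _ open_UNIV
            valid_path_circlepath, of "2 * pi * \<bar>rho t j\<bar>" z]
          dom_bdry_neq[OF z] img unfolding field_differentiable_def by blast
    qed
    then show ?thesis
      by (simp add: holomorphic_on_def field_differentiable_at_within)
  qed
  then show ?thesis
    unfolding cyc_eq_sum_contour by (intro holomorphic_intros) auto
qed

section \<open>The Poisson kernels and the conjugate Cauchy transform\<close>

text \<open>The Poisson kernel of the disk bounded by the outer circle, and for \<open>j > 0\<close>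
  that of the exterior of an inner disk. It is the double layer kernel, twice the real part of
  \<open>sg j * (\<xi> - cc j) / (\<xi> - z)\<close>, shifted by the constant
  \<open>sg j\<close>.\<close>

definition poisson :: "nat \<Rightarrow> complex \<Rightarrow> complex \<Rightarrow> real" where
  "poisson j z \<xi> = Re (sg j * (2 * (\<xi> - cc j) / (\<xi> - z) - 1))"

text \<open>With u = \<xi> - cc j and w = z - cc j the kernel is, up to sign, the real part of (u +
  w) / (u - w), that is (|u|^2 - |w|^2) / |u - w|^2. The sign \<open>sg j\<close> makes it
  nonnegative, as the domain lies inside the outer circle and outside the others.\<close>

lemma poisson_props:
  assumes t: "0 \<le> t" "t \<le> t0" and z: "z \<in> dom t" and j: "j \<le> n" and \<xi>: "\<xi> \<in> sphere (cc j) (rho t j)"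
  shows "0 \<le> poisson j z \<xi>"
    and "poisson j z \<xi> * (cmod (\<xi> - z))\<^sup>2 = \<bar>(rho t j)\<^sup>2 - (cmod (z - cc j))\<^sup>2\<bar>"
proof -
  define u w where "u = \<xi> - cc j" and "w = z - cc j"
  have uw: "u - w = \<xi> - z"
    by (simp add: u_def w_def)
  have "\<xi> \<noteq> z"
    using dom_bdry_neq[OF z] sphere_subset_bdry[OF j] \<xi> by blast
  then have ne: "u - w \<noteq> 0"
    using uw by simp
  have u: "cmod u = rho t j"
    using \<xi> by (simp add: u_def dist_norm norm_minus_commute)
  have "2 * u / (u - w) - 1 = (u + w) * cnj (u - w) / of_real ((cmod (u - w))\<^sup>2)"
  proof -
    have "2 * u / (u - w) - 1 = (u + w) / (u - w)"
      using ne by (simp add: field_simps)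
    also have "... = (u + w) * cnj (u - w) / of_real ((cmod (u - w))\<^sup>2)"
      using complex_div_cnj[of "u + w" "u - w"] by simp
    finally show ?thesis .
  qed
  also have "Re ... = ((cmod u)\<^sup>2 - (cmod w)\<^sup>2) / (cmod (u - w))\<^sup>2"
  proof -
    have "Re ((u + w) * cnj (u - w)) = (cmod u)\<^sup>2 - (cmod w)\<^sup>2"
      unfolding cmod_power2 by (simp add: power2_eq_square algebra_simps)
    then show ?thesis
      by (simp add: Re_divide_of_real)
  qed
  finally have Re: "Re (2 * u / (u - w) - 1) * (cmod (u - w))\<^sup>2 = (rho t j)\<^sup>2 - (cmod w)\<^sup>2"
    using ne u by simp
  have pos: "0 < (cmod (u - w))\<^sup>2"
    using ne by simp
  have rp: "0 < rho t j"
    by (rule rho_pos[OF t j])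
  have *: "poisson j z \<xi> * (cmod (u - w))\<^sup>2 = \<bar>(rho t j)\<^sup>2 - (cmod w)\<^sup>2\<bar>"
  proof (cases "j = 0")
    case True
    then have "cmod w < rho t j"
      using dom_not_on_circle(1)[OF z] by (simp add: w_def)
    then have "(cmod w)\<^sup>2 \<le> (rho t j)\<^sup>2"
      by (intro power_mono) auto
    then show ?thesis
      using Re True unfolding poisson_def u_def[symmetric] uw[symmetric] by simp
  next
    case False
    then have "rho t j < cmod w"
      using dom_not_on_circle(2)[OF z] j by (simp add: w_def)
    then have "(rho t j)\<^sup>2 \<le> (cmod w)\<^sup>2"
      using rp by (intro power_mono) auto
    moreover have "poisson j z \<xi> = - Re (2 * u / (u - w) - 1)"
      using cc_rho_pos[of j] False j unfolding poisson_def u_def[symmetric] uw[symmetric] by simp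
    ultimately show ?thesis
      using Re by (simp only: minus_mult_left[symmetric])
  qed
  show "poisson j z \<xi> * (cmod (\<xi> - z))\<^sup>2 = \<bar>(rho t j)\<^sup>2 - (cmod (z - cc j))\<^sup>2\<bar>"
    using *[unfolded uw] unfolding w_def .
  have "0 \<le> poisson j z \<xi> * (cmod (u - w))\<^sup>2"
    unfolding * by simp
  then show "0 \<le> poisson j z \<xi>"
    using pos by (simp add: zero_le_mult_iff)
qed

lemma continuous_on_poisson:
  assumes z: "z \<in> dom t"
  shows "continuous_on (bdry t) (poisson j z)"
  unfolding poisson_def using dom_bdry_neq[OF z] by (intro continuous_intros) auto

text \<open>Twice a real part is a number plus its conjugate, and taking the conjugation out of the
  mean moves it onto \<open>h\<close>. This is how the Cauchy integral of the conjugate of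
  \<open>f\<close> enters.\<close>

lemma mean_poisson:
  assumes t: "0 \<le> t" "t \<le> t0" and z: "z \<in> dom t" and j: "j \<le> n"
    and h: "continuous_on (bdry t) h"
  shows "mean t j (\<lambda>\<xi>. h \<xi> * of_real (poisson j z \<xi>)) =
    sg j * (mean t j (\<lambda>\<xi>. h \<xi> / (\<xi> - z) * (\<xi> - cc j)) +
            cnj (mean t j (\<lambda>\<xi>. cnj (h \<xi>) / (\<xi> - z) * (\<xi> - cc j))) - mean t j h)"
proof -
  note rp = rho_nonneg[OF t j]
  have ch: "continuous_on (sphere (cc j) (rho t j)) h"
    by (rule continuous_on_circle[OF h j])
  have ne: "\<xi> \<noteq> z" if "\<xi> \<in> sphere (cc j) (rho t j)" for \<xi>
    using that sphere_subset_bdry[OF j] dom_bdry_neq[OF z] by blast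
  have "h \<xi> * complex_of_real (poisson j z \<xi>) = sg j *
      (h \<xi> / (\<xi> - z) * (\<xi> - cc j) + cnj (cnj (h \<xi>) / (\<xi> - z) * (\<xi> - cc j)) - h \<xi>)" for \<xi>
  proof -
    define a where "a = (\<xi> - cc j) / (\<xi> - z)"
    have "2 * (\<xi> - cc j) / (\<xi> - z) = 2 * a"
      by (simp add: a_def)
    then have "complex_of_real (poisson j z \<xi>) = sg j * (a + cnj a - 1)"
      unfolding poisson_def by (simp add: sg_def complex_eq_iff)
    moreover have "h \<xi> / (\<xi> - z) * (\<xi> - cc j) = h \<xi> * a"
      "cnj (cnj (h \<xi>) / (\<xi> - z) * (\<xi> - cc j)) = h \<xi> * cnj a"
      by (simp_all add: a_def)
    ultimately show ?thesis
      by (simp only:) (simp add: algebra_simps)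
  qed
  then have "mean t j (\<lambda>\<xi>. h \<xi> * of_real (poisson j z \<xi>)) = mean t j (\<lambda>\<xi>. sg j *
      (h \<xi> / (\<xi> - z) * (\<xi> - cc j) + cnj (cnj (h \<xi>) / (\<xi> - z) * (\<xi> - cc j)) - h \<xi>))"
    by (simp only:)
  also have "... = sg j * (mean t j (\<lambda>\<xi>. h \<xi> / (\<xi> - z) * (\<xi> - cc j)) +
      mean t j (\<lambda>\<xi>. cnj (cnj (h \<xi>) / (\<xi> - z) * (\<xi> - cc j))) - mean t j h)"
  proof -
    have A: "continuous_on (sphere (cc j) (rho t j)) (\<lambda>\<xi>. h \<xi> / (\<xi> - z) * (\<xi> - cc j))"
      using ne by (intro continuous_intros ch) auto
    have B: "continuous_on (sphere (cc j) (rho t j)) (\<lambda>\<xi>. cnj (cnj (h \<xi>) / (\<xi> - z) * (\<xi> - cc j)))"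
      using ne by (intro continuous_intros ch) auto
    show ?thesis
      unfolding circ_mean_mult_right circ_mean_diff[OF continuous_on_add[OF A B] ch rp]
        circ_mean_add[OF A B rp] ..
  qed
  finally show ?thesis
    by (simp only: circ_mean_cnj)
qed

text \<open>With \<open>h = 1\<close> the outer circle gives 1 + 1 - 1 and an inner circle -(0 + 0 -
  1).\<close>

lemma mean_poisson_1:
  assumes "0 \<le> t" "t \<le> t0" "z \<in> dom t" "j \<le> n"
  shows "mean t j (poisson j z) = 1"
proof -
  have "complex_of_real (mean t j (poisson j z)) = 1"
    using mean_poisson[OF assms, of "\<lambda>_. 1"] mean_cauchy_kernel[OF assms] assms(4)
      circ_mean_of_real[OF continuous_on_circle[OF continuous_on_poisson[OF assms(3)] assms(4)]
        rho_nonneg[OF assms(1,2,4)], of j]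
    by (auto simp: sg_def split: if_splits)
  then show ?thesis
    using of_real_eq_1_iff by blast
qed

text \<open>The outer mean is subtracted as a reference value; without it the transform is only
  close to a constant, not small.\<close>

definition conj_transform :: "real \<Rightarrow> (complex \<Rightarrow> complex) \<Rightarrow> complex \<Rightarrow> complex" where
  "conj_transform t f z = cyc t (\<lambda>\<xi>. cnj (f \<xi>) / (\<xi> - z)) - cnj (mean t 0 f)"

lemma holomorphic_conj_transform:
  assumes "0 \<le> t" "t \<le> t0" "continuous_on (bdry t) f"
  shows "conj_transform t f holomorphic_on dom t"
  unfolding conj_transform_def
  using holomorphic_cauchy_integral[of t "\<lambda>\<xi>. cnj (f \<xi>)"] assms
  by (intro holomorphic_intros) (simp add: continuous_on_cnj)

lemma cnj_sg: "cnj (sg j) = sg j"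
  by (simp add: sg_def)

lemma sum_sg: "(\<Sum>j\<le>n. sg j * m j) = m 0 - (\<Sum>j\<in>{1..n}. m j)"
  by (simp add: atMost_n sg_def sum_negf)

text \<open>Summing \<open>mean_poisson\<close> over all circles turns the Cauchy integrals into
  \<open>f z\<close> and the transform. The signed means are then redistributed so that every kernel
  except that of circle \<open>l\<close> has 1 subtracted; a difference of two means is left over.
  The choice of \<open>l\<close> is free and is later the circle next to \<open>z\<close>.\<close>

lemma conj_transform_eq:
  assumes "0 \<le> s" "s < t" "t \<le> t0" and f: "f holomorphic_on dom s" and z: "z \<in> dom t" and l: "l \<le> n"
  shows "cnj (conj_transform t f z) =
    (mean t l (\<lambda>\<xi>. f \<xi> * of_real (poisson l z \<xi>)) - f z) +
    (\<Sum>j\<in>{..n} - {l}. mean t j (\<lambda>\<xi>. f \<xi> * of_real (poisson j z \<xi> - 1))) + (mean t 0 f - mean t l f)"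
proof -
  have t: "0 \<le> t" "t \<le> t0"
    using assms by auto
  have cf: "continuous_on (bdry t) f"
    by (rule continuous_on_bdry[OF f assms(1-3)])
  let ?P = "\<lambda>j. mean t j (\<lambda>\<xi>. f \<xi> * of_real (poisson j z \<xi>))"
  have "(\<Sum>j\<le>n. ?P j) = cyc t (\<lambda>\<xi>. f \<xi> / (\<xi> - z)) +
      cnj (cyc t (\<lambda>\<xi>. cnj (f \<xi>) / (\<xi> - z))) - (\<Sum>j\<le>n. sg j * mean t j f)"
    unfolding cyc_def cnj_sum complex_cnj_mult cnj_sg sum.distrib[symmetric] sum_subtractf[symmetric]
    using mean_poisson[OF t z _ cf] by (intro sum.cong refl) (simp add: algebra_simps)
  also have "cyc t (\<lambda>\<xi>. f \<xi> / (\<xi> - z)) = f z"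
    by (rule cyc_cauchy_formula[OF assms(1-3) f z])
  finally have "cnj (conj_transform t f z) = (\<Sum>j\<le>n. ?P j) - f z - (\<Sum>j\<in>{1..n}. mean t j f)"
    unfolding sum_sg conj_transform_def by simp
  moreover have "(\<Sum>j\<le>n. mean t j f) = mean t 0 f + (\<Sum>j\<in>{1..n}. mean t j f)"
    by (simp add: atMost_n)
  moreover have "(\<Sum>j\<le>n. ?P j) = ?P l + (\<Sum>j\<in>{..n} - {l}. ?P j)"
    using l by (intro sum.remove) auto
  moreover have "(\<Sum>j\<le>n. mean t j f) = mean t l f + (\<Sum>j\<in>{..n} - {l}. mean t j f)"
    using l by (intro sum.remove) auto
  moreover have "mean t j (\<lambda>\<xi>. f \<xi> * of_real (poisson j z \<xi> - 1)) = ?P j - mean t j f" if j: "j \<le> n" for j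
  proof -
    have "mean t j (\<lambda>\<xi>. f \<xi> * of_real (poisson j z \<xi>) - f \<xi>) = ?P j - mean t j f"
      by (intro circ_mean_diff continuous_on_circle[OF _ j] continuous_intros cf
          continuous_on_poisson[OF z] rho_nonneg[OF t j])
    then show ?thesis
      by (simp add: algebra_simps)
  qed
  then have "(\<Sum>j\<in>{..n} - {l}. mean t j (\<lambda>\<xi>. f \<xi> * of_real (poisson j z \<xi> - 1))) =
      (\<Sum>j\<in>{..n} - {l}. ?P j) - (\<Sum>j\<in>{..n} - {l}. mean t j f)"
    by (simp add: sum_subtractf)
  moreover have "k = (Pl - v) + D + (m0 - ml)"
    if "k = P - v - M1" "M = m0 + M1" "P = Pl + P'" "M = ml + M'" "D = P' - M'"
    for k P v M M1 m0 Pl P' ml M' D :: complex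
  proof -
    have "M1 = ml + M' - m0"
      using that by (simp add: algebra_simps)
    then show ?thesis
      using that by simp
  qed
  ultimately show ?thesis
    by blast
qed

text \<open>The gaps are shortened by \<open>2 * t0\<close> to cover two circles moved towards each other by at most \<open>t0\<close> each.\<close>

definition rel_size :: "nat \<Rightarrow> nat \<Rightarrow> real" where
  "rel_size l j =
     (if j = 0 then R / (R - cmod (c l) - r l - 2 * t0) - 1
      else if l = 0 then (r j + t0) / (R - cmod (c j) - r j - 2 * t0)
      else (r j + t0) / (cmod (c j - c l) - r j - r l - 2 * t0))"

text \<open>Subtracting 1 leaves, up to sign, the real part of 2 (\<xi> - cc j) / (\<xi> - z) on an
  inner circle and of 2 z / (\<xi> - z) on the outer one. Both are at most twice a size divided by a
  distance.\<close>

lemma poisson_minus_1_le: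
  assumes t: "0 \<le> t" "t < t'" "t' \<le> t0" and l: "l \<le> n" and j: "j \<le> n" "j \<noteq> l"
    and z: "z \<in> dom t" "cmod (z - cc l) = rho t' l" and \<xi>: "\<xi> \<in> sphere (cc j) (rho t j)"
  shows "\<bar>poisson j z \<xi> - 1\<bar> \<le> 2 * rel_size l j"
proof -
  have "\<xi> \<noteq> z"
    using dom_bdry_neq[OF z(1)] sphere_subset_bdry[OF j(1)] \<xi> by blast
  have \<xi>': "cmod (\<xi> - cc j) = rho t j"
    using \<xi> by (simp add: dist_norm norm_minus_commute)
  have frac: "cmod (2 * a / (\<xi> - z)) \<le> 2 * (x / y)"
    if "cmod a \<le> x" "0 < y" "y \<le> cmod (\<xi> - z)" for a x y
    using that frac_le[of x "cmod a" y "cmod (\<xi> - z)"] order_trans[OF norm_ge_zero that(1)]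
    by (simp add: norm_divide norm_mult)
  show ?thesis
  proof (cases "j = 0")
    case True
    then have l': "l \<in> {1..n}"
      using l j by auto
    let ?D = "R - cmod (c l) - r l - 2 * t0"
    have D: "0 < ?D"
      using outer_gap[OF l'] by simp
    have zl: "cmod z \<le> cmod (c l) + r l + t'"
      using norm_triangle_ineq[of "c l" "z - c l"] z(2) cc_rho_pos[OF l'] by simp
    have \<xi>R: "cmod \<xi> = R - t"
      using \<xi>' True by simp
    have "?D \<le> cmod (\<xi> - z)"
      using norm_triangle_ineq2[of \<xi> z] zl \<xi>R t by linarith
    then have "cmod (2 * z / (\<xi> - z)) \<le> 2 * ((cmod (c l) + r l + 2 * t0) / ?D)"
      using zl t by (intro frac D) auto
    \<comment> \<open>The term -1 of the hypothesis arises here: the numerator is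
      \<open>R - ?D\<close>.\<close>
    also have "(cmod (c l) + r l + 2 * t0) / ?D = rel_size l j"
      using True D by (simp add: rel_size_def field_simps)
    also have "2 * z / (\<xi> - z) = 2 * (\<xi> - cc j) / (\<xi> - z) - 2"
      using \<open>\<xi> \<noteq> z\<close> True by (simp add: field_simps)
    finally have "cmod (2 * (\<xi> - cc j) / (\<xi> - z) - 2) \<le> 2 * rel_size l j" .
    moreover have "poisson j z \<xi> - 1 = Re (2 * (\<xi> - cc j) / (\<xi> - z) - 2)"
      using True by (simp add: poisson_def)
    ultimately show ?thesis
      using abs_Re_le_cmod order_trans by metis
  next
    case False
    then have j': "j \<in> {1..n}"
      using j by auto
    have "cmod (2 * (\<xi> - cc j) / (\<xi> - z)) \<le> 2 * rel_size l j"
    proof (cases "l = 0")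
      case True
      have "R - cmod (c j) - r j - 2 * t0 \<le> cmod (\<xi> - z)"
        using norm_triangle_ineq[of "c j - \<xi>" "\<xi> - z"] norm_triangle_ineq2[of z "c j"] z(2) \<xi>' True t cc_rho_pos[OF j']
        by (simp add: norm_minus_commute)
      then have "cmod (2 * (\<xi> - cc j) / (\<xi> - z)) \<le>
          2 * ((r j + t0) / (R - cmod (c j) - r j - 2 * t0))"
        using outer_gap[OF j'] \<xi>' cc_rho_pos[OF j'] t by (intro frac) auto
      then show ?thesis
        using True False by (simp add: rel_size_def)
    next
      case False
      then have l': "l \<in> {1..n}"
        using l by auto
      have "c j - c l = (c j - \<xi>) + (\<xi> - z) + (z - c l)"
        by simp
      then have "cmod (c j - c l) \<le> cmod (c j - \<xi>) + cmod (\<xi> - z) + cmod (z - c l)"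
        by (metis add_mono_thms_linordered_semiring(3) norm_triangle_ineq order_trans)
      then have "cmod (c j - c l) - r j - r l - 2 * t0 \<le> cmod (\<xi> - z)"
        using z(2) \<xi>' t cc_rho_pos[OF j'] cc_rho_pos[OF l'] by (simp add: norm_minus_commute)
      then have "cmod (2 * (\<xi> - cc j) / (\<xi> - z)) \<le>
          2 * ((r j + t0) / (cmod (c j - c l) - r j - r l - 2 * t0))"
        using inner_gap[OF j' l' j(2)] \<xi>' cc_rho_pos[OF j'] t by (intro frac) auto
      then show ?thesis
        using False \<open>j \<noteq> 0\<close> by (simp add: rel_size_def)
    qed
    moreover have "poisson j z \<xi> - 1 = - Re (2 * (\<xi> - cc j) / (\<xi> - z))"
      using cc_rho_pos[OF j'] by (simp add: poisson_def)
    ultimately show ?thesis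
      using abs_Re_le_cmod order_trans by (metis abs_minus_cancel)
  qed
qed

text \<open>Cauchy's theorem for f / (\<xi> - c l), which is holomorphic because \<open>c l\<close>
  lies in a hole. Circle \<open>l\<close> contributes exactly the mean of \<open>f\<close>. On the
  outer circle the weight \<xi> / (\<xi> - c l) differs from 1, and on the remaining circles (\<xi>
  - c j) / (\<xi> - c l) differs from 0, by at most \<open>rel_size l j\<close>.\<close>

lemma mean_0_minus_mean_le:
  assumes "0 \<le> s" "s < t" "t \<le> t0" and f: "f holomorphic_on dom s"
    and f1: "\<And>z. z \<in> dom s \<Longrightarrow> cmod (f z) \<le> 1" and l: "l \<in> {1..n}"
  shows "cmod (mean t 0 f - mean t l f) \<le> (\<Sum>j\<in>{..n} - {l}. rel_size l j)"
proof -
  have t: "0 \<le> t" "t \<le> t0"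
    using assms by auto
  have cf: "continuous_on (bdry t) f"
    by (rule continuous_on_bdry[OF f assms(1-3)])
  have fb: "cmod (f \<xi>) \<le> 1" if "\<xi> \<in> bdry t" for \<xi>
    using bdry_subset_dom[OF assms(1-3)] f1 that by blast
  have cl: "c l \<notin> dom s"
    using l r_pos[OF l] assms(1) by (force simp: mem_dom)
  then have ne: "\<xi> \<noteq> c l" if "\<xi> \<in> bdry t" for \<xi>
    using bdry_subset_dom[OF assms(1-3)] that by blast
  let ?g = "\<lambda>j \<xi>. f \<xi> / (\<xi> - c l) * (\<xi> - cc j)"
  have cg: "continuous_on (bdry t) (?g j)" for j
    using ne by (intro continuous_intros cf) auto
  have "(\<Sum>j\<le>n. sg j * mean t j (?g j)) = 0"
    using cyc_zero[OF assms(1-3), of "\<lambda>\<xi>. f \<xi> / (\<xi> - c l)"] cl f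
    unfolding cyc_def by (force intro: holomorphic_intros)
  moreover have "(\<Sum>j\<in>{1..n}. mean t j (?g j)) = mean t l (?g l) + (\<Sum>j\<in>{1..n} - {l}. mean t j (?g j))"
    using l by (intro sum.remove) auto
  moreover have "mean t l (?g l) = mean t l f"
    using ne rho_pos[OF t, of l] sphere_subset_bdry[of l t] l
    by (intro circ_mean_cong) (auto simp: cc_rho_pos subset_iff)
  ultimately have "mean t l f = mean t 0 (?g 0) - (\<Sum>j\<in>{1..n} - {l}. mean t j (?g j))"
    unfolding sum_sg by (simp add: algebra_simps)
  moreover have "mean t 0 (\<lambda>\<xi>. f \<xi> - ?g 0 \<xi>) = mean t 0 f - mean t 0 (?g 0)"
    by (intro circ_mean_diff continuous_on_circle cf cg rho_nonneg[OF t]) auto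
  ultimately have eq: "mean t 0 f - mean t l f =
      mean t 0 (\<lambda>\<xi>. f \<xi> - ?g 0 \<xi>) + (\<Sum>j\<in>{1..n} - {l}. mean t j (?g j))"
    by simp
  have b0: "cmod (mean t 0 (\<lambda>\<xi>. f \<xi> - ?g 0 \<xi>)) \<le> rel_size l 0"
  proof (intro norm_circ_mean_le_const continuous_on_circle continuous_on_diff cf cg
      rho_nonneg[OF t] le0)
    fix \<xi> assume \<xi>: "\<xi> \<in> sphere (cc 0) (rho t 0)"
    then have b: "\<xi> \<in> bdry t"
      using sphere_subset_bdry by blast
    let ?D = "R - cmod (c l) - r l - 2 * t0"
    have D: "0 < ?D"
      using outer_gap[OF l] by simp
    have "?D \<le> cmod (\<xi> - c l)"
      using norm_triangle_ineq2[of \<xi> "c l"] \<xi> t r_pos[OF l] t0_pos by simp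
    then have "cmod (c l) / cmod (\<xi> - c l) \<le> (cmod (c l) + r l + 2 * t0) / ?D"
      using D r_pos[OF l] t0_pos by (intro frac_le) auto
    also have "... = rel_size l 0"
      using D by (simp add: rel_size_def field_simps)
    finally have "cmod (f \<xi>) * (cmod (c l) / cmod (\<xi> - c l)) \<le> 1 * rel_size l 0"
      by (intro mult_mono fb b) auto
    moreover have "f \<xi> - ?g 0 \<xi> = - (f \<xi> * (c l / (\<xi> - c l)))"
      using ne[OF b] by (simp add: field_simps)
    ultimately show "cmod (f \<xi> - ?g 0 \<xi>) \<le> rel_size l 0"
      by (simp add: norm_mult norm_divide)
  qed
  have bj: "cmod (mean t j (?g j)) \<le> rel_size l j" if "j \<in> {1..n} - {l}" for j
  proof (intro norm_circ_mean_le_const continuous_on_circle cg rho_nonneg[OF t])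
    have j: "j \<in> {1..n}" "j \<noteq> l" "j \<noteq> 0" "l \<noteq> 0"
      using that l by auto
    show "j \<le> n" "j \<le> n"
      using j by auto
    fix \<xi> assume \<xi>: "\<xi> \<in> sphere (cc j) (rho t j)"
    moreover have "j \<le> n"
      using j by auto
    ultimately have b: "\<xi> \<in> bdry t"
      using sphere_subset_bdry[of j t] by blast
    let ?D = "cmod (c j - c l) - r j - r l - 2 * t0"
    have D: "0 < ?D"
      using inner_gap[OF j(1) l j(2)] by simp
    have \<xi>': "cmod (\<xi> - c j) = r j + t"
      using \<xi> cc_rho_pos[OF j(1)] by (simp add: dist_norm norm_minus_commute)
    have "?D \<le> cmod (\<xi> - c l)"
      using norm_triangle_ineq[of "c j - \<xi>" "\<xi> - c l"] \<xi>' t r_pos[OF l] t0_pos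
      by (simp add: norm_minus_commute)
    then have "cmod (\<xi> - c j) / cmod (\<xi> - c l) \<le> (r j + t0) / ?D"
      using D \<xi>' t r_pos[OF j(1)] by (intro frac_le) auto
    then have "cmod (f \<xi>) * (cmod (\<xi> - c j) / cmod (\<xi> - c l)) \<le> 1 * rel_size l j"
      using j by (intro mult_mono fb b) (auto simp: rel_size_def)
    then show "cmod (?g j \<xi>) \<le> rel_size l j"
      using cc_rho_pos[OF j(1)] by (simp add: norm_mult norm_divide)
  qed
  have "cmod (mean t 0 f - mean t l f) \<le> rel_size l 0 + (\<Sum>j\<in>{1..n} - {l}. rel_size l j)"
    unfolding eq using b0 bj by (intro norm_triangle_mono order_trans[OF norm_sum] sum_mono) auto
  also have "... = (\<Sum>j\<in>{..n} - {l}. rel_size l j)"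
  proof -
    have "{..n} - {l} = insert 0 ({1..n} - {l})"
      using l by auto
    then show ?thesis
      by simp
  qed
  finally show ?thesis .
qed

lemma compact_closed_dom: "compact (dom t \<union> bdry t)"
proof -
  \<comment> \<open>For arbitrary \<open>t\<close> the inner circles need not lie inside the outer
    one, hence the crude radius.\<close>
  have "dom t \<union> bdry t \<subseteq> cball 0 (max (R - t) (\<Sum>i\<in>{1..n}. cmod (c i) + \<bar>r i + t\<bar>))"
  proof
    fix z assume "z \<in> dom t \<union> bdry t"
    then consider "cmod z \<le> R - t" | i where "i \<in> {1..n}" "cmod (z - c i) = r i + t"
      by (force simp: mem_dom mem_bdry)
    then show "z \<in> cball 0 (max (R - t) (\<Sum>i\<in>{1..n}. cmod (c i) + \<bar>r i + t\<bar>))"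
    proof cases
      case 2
      have "cmod z \<le> cmod (c i) + \<bar>r i + t\<bar>"
        using norm_triangle_ineq[of "c i" "z - c i"] 2 by simp
      also have "... \<le> (\<Sum>i\<in>{1..n}. cmod (c i) + \<bar>r i + t\<bar>)"
        using 2 by (intro member_le_sum) auto
      finally show ?thesis
        by simp
    qed simp
  qed
  moreover have "closed (dom t \<union> bdry t)"
  proof -
    have "closed (bdry t)"
      unfolding bdry_def by (intro closed_UN) auto
    then have "closure (dom t \<union> bdry t) \<subseteq> dom t \<union> bdry t"
      using closure_dom[of t] by (simp add: closure_Un closure_closed)
    then show ?thesis
      by (simp only: closure_subset_eq)
  qed
  ultimately show ?thesis
    by (meson bounded_cball bounded_subset compact_eq_bounded_closed)
qed

text \<open>The kernel \<open>poisson l z\<close> concentrates near \<open>z\<close> as \<open>z\<close> approaches circle \<open>l\<close>: away from \<open>z\<close>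
  it is controlled by the second moment of \<open>\<xi> - z\<close>, which is exactly
  \<open>\<bar>(rho t l)\<^sup>2 - (cmod (z - cc l))\<^sup>2\<bar>\<close>.\<close>

lemma poisson_approximation:
  assumes "0 \<le> s" "s < t" "t < t0" and f: "f holomorphic_on dom s"
    and f1: "\<And>z. z \<in> dom s \<Longrightarrow> cmod (f z) \<le> 1" and "0 < \<eta>"
  obtains \<delta> where "0 < \<delta>"
    "\<And>t' l z. t < t' \<Longrightarrow> t' < t + \<delta> \<Longrightarrow> t' \<le> t0 \<Longrightarrow> l \<le> n \<Longrightarrow> z \<in> dom t \<Longrightarrow>
      cmod (z - cc l) = rho t' l \<Longrightarrow>
      cmod (mean t l (\<lambda>\<xi>. f \<xi> * of_real (poisson l z \<xi>)) - f z) \<le> \<eta>"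
proof -
  have t: "0 \<le> t" "t \<le> t0"
    using assms by auto
  have sub: "dom t \<union> bdry t \<subseteq> dom s"
    using bdry_subset_dom[of s t] dom_antimono[of s t] assms by auto
  have cf: "continuous_on (dom t \<union> bdry t) f"
    using holomorphic_on_imp_continuous_on[OF f] sub by (rule continuous_on_subset)
  obtain d where d: "0 < d" and uc: "\<And>x y. x \<in> dom t \<union> bdry t \<Longrightarrow> y \<in> dom t \<union> bdry t \<Longrightarrow>
      dist x y < d \<Longrightarrow> dist (f x) (f y) < \<eta> / 2"
    using compact_uniformly_continuous[OF cf compact_closed_dom] half_gt_zero[OF \<open>0 < \<eta>\<close>]
    unfolding uniformly_continuous_on_def by metis
  have fb: "cmod (f z) \<le> 1" if "z \<in> dom t \<union> bdry t" for z
    using that sub f1 by blast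
  \<comment> \<open>Makes \<open>2 / d\<^sup>2 * (2 * R * \<delta>)\<close> equal to
    \<open>\<eta> / 2\<close>.\<close>
  define \<delta> where "\<delta> = \<eta> * d\<^sup>2 / (8 * R)"
  have R: "0 < R"
    using t0_pos t0_less_R by simp
  show ?thesis
  proof (rule that[of \<delta>])
    show "0 < \<delta>"
      using d \<open>0 < \<eta>\<close> R by (simp add: \<delta>_def)
    fix t' l z
    assume t': "t < t'" "t' < t + \<delta>" "t' \<le> t0" and l: "l \<le> n" and z: "z \<in> dom t"
      and zl: "cmod (z - cc l) = rho t' l"
    note rp = rho_nonneg[OF t l]
    have cP: "continuous_on (sphere (cc l) (rho t l)) (poisson l z)"
      by (rule continuous_on_circle[OF continuous_on_poisson[OF z] l])
    have cf': "continuous_on (sphere (cc l) (rho t l)) f"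
      using cf sphere_subset_bdry[OF l] by (meson Un_upper2 continuous_on_subset)
    have rhoR: "rho u l \<le> R" if "0 \<le> u" "u \<le> t0" for u
    proof (cases "l = 0")
      case False
      then have l': "l \<in> {1..n}"
        using l by auto
      show ?thesis
        using outer_gap[OF l'] cc_rho_pos[OF l', of u] that norm_ge_zero[of "c l"] t0_pos
        by linarith
    qed (use that in simp)
    let ?\<Delta> = "2 * R * (t' - t)"
    have \<Delta>: "\<bar>(rho t l)\<^sup>2 - (cmod (z - cc l))\<^sup>2\<bar> \<le> ?\<Delta>"
    proof -
      have "\<bar>(rho t l)\<^sup>2 - (rho t' l)\<^sup>2\<bar> = \<bar>rho t l - rho t' l\<bar> * \<bar>rho t l + rho t' l\<bar>"
        by (simp add: power2_eq_square abs_mult[symmetric] algebra_simps)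
      also have "\<bar>rho t l - rho t' l\<bar> = t' - t"
        using t' by (auto simp: rho_def)
      also have "\<bar>rho t l + rho t' l\<bar> \<le> 2 * R"
        using rhoR[of t] rhoR[of t'] rp rho_pos[of t' l] l t t' by simp
      finally show ?thesis
        unfolding zl using t' by (simp add: mult_left_mono mult.commute)
    qed
    have "mean t l (\<lambda>\<xi>. f \<xi> * of_real (poisson l z \<xi>)) - f z =
        mean t l (\<lambda>\<xi>. f \<xi> * of_real (poisson l z \<xi>)) - mean t l (\<lambda>\<xi>. f z * of_real (poisson l z \<xi>))"
      using mean_poisson_1[OF t z l] by (simp add: circ_mean_mult_right circ_mean_of_real[OF cP rp])
    also have "... = mean t l (\<lambda>\<xi>. f \<xi> * of_real (poisson l z \<xi>) - f z * of_real (poisson l z \<xi>))"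
      by (intro circ_mean_diff[symmetric] continuous_intros cf' cP rp)
    also have "cmod ... \<le> mean t l (\<lambda>\<xi>. \<eta> / 2 * poisson l z \<xi> + 2 / d\<^sup>2 * ?\<Delta>)"
    proof (intro norm_circ_mean_le continuous_intros cf' cP rp)
      fix \<xi> assume \<xi>: "\<xi> \<in> sphere (cc l) (rho t l)"
      then have b: "\<xi> \<in> dom t \<union> bdry t" "z \<in> dom t \<union> bdry t"
        using subsetD[OF sphere_subset_bdry[OF l] \<xi>] z by simp_all
      note P = poisson_props[OF t z l \<xi>]
      \<comment> \<open>Near \<open>z\<close> this is uniform continuity; at distance at least
        \<open>d\<close> it holds because the left side never exceeds 2. The quadratic term is there
        to cancel the denominator of the kernel.\<close>
      have "cmod (f \<xi> - f z) \<le> \<eta> / 2 + 2 / d\<^sup>2 * (cmod (\<xi> - z))\<^sup>2"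
      proof (cases "dist \<xi> z < d")
        case True
        then have "cmod (f \<xi> - f z) < \<eta> / 2"
          using uc[OF b] by (simp add: dist_norm)
        moreover have "0 \<le> 2 / d\<^sup>2 * (cmod (\<xi> - z))\<^sup>2"
          by simp
        ultimately show ?thesis
          by linarith
      next
        case False
        then have "1 * d\<^sup>2 \<le> (cmod (\<xi> - z))\<^sup>2"
          using d by (simp add: dist_norm power_mono)
        then have "2 * 1 \<le> 2 / d\<^sup>2 * (cmod (\<xi> - z))\<^sup>2"
          using d by (simp add: field_simps)
        moreover have "cmod (f \<xi> - f z) \<le> 1 + 1"
          using fb[OF b(1)] fb[OF b(2)] by (rule norm_triangle_le_diff[OF add_mono])
        ultimately show ?thesis
          using \<open>0 < \<eta>\<close> by simp
      qed
      then have "cmod (f \<xi> - f z) * poisson l z \<xi> \<le>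
          (\<eta> / 2 + 2 / d\<^sup>2 * (cmod (\<xi> - z))\<^sup>2) * poisson l z \<xi>"
        using P(1) by (intro mult_right_mono)
      also have "... = \<eta> / 2 * poisson l z \<xi> + 2 / d\<^sup>2 * (poisson l z \<xi> * (cmod (\<xi> - z))\<^sup>2)"
        by (simp add: algebra_simps)
      also have "... \<le> \<eta> / 2 * poisson l z \<xi> + 2 / d\<^sup>2 * ?\<Delta>"
        unfolding P(2) using \<Delta> by (intro add_left_mono mult_left_mono) auto
      finally show "cmod (f \<xi> * of_real (poisson l z \<xi>) - f z * of_real (poisson l z \<xi>)) \<le>
          \<eta> / 2 * poisson l z \<xi> + 2 / d\<^sup>2 * ?\<Delta>"
        using P(1) by (simp add: left_diff_distrib[symmetric] norm_mult)
    qed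
    also have "... = \<eta> / 2 + 2 / d\<^sup>2 * ?\<Delta>"
    proof -
      have "mean t l (\<lambda>\<xi>. \<eta> / 2 * poisson l z \<xi> + 2 / d\<^sup>2 * ?\<Delta>) =
          mean t l (\<lambda>\<xi>. \<eta> / 2 * poisson l z \<xi>) + mean t l (\<lambda>\<xi>. 2 / d\<^sup>2 * ?\<Delta>)"
        by (intro circ_mean_add continuous_intros cP rp)
      then show ?thesis
        unfolding circ_mean_mult_right mean_poisson_1[OF t z l] circ_mean_const by simp
    qed
    also have "... \<le> \<eta> / 2 + 2 / d\<^sup>2 * (2 * R * \<delta>)"
      using t' R by (intro add_left_mono mult_left_mono) auto
    also have "... = \<eta>"
      using d R by (simp add: \<delta>_def field_simps)
    finally show "cmod (mean t l (\<lambda>\<xi>. f \<xi> * of_real (poisson l z \<xi>)) - f z) \<le> \<eta>" .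
  qed
qed

lemma eventually_dom:
  assumes "z \<in> dom t"
  shows "\<forall>\<^sub>F t' in at_right t. z \<in> dom t'"
proof -
  have "((\<lambda>u. R - u) \<longlongrightarrow> R - t) (at_right t)" "\<And>i. ((\<lambda>u. r i + u) \<longlongrightarrow> r i + t) (at_right t)"
    by (intro tendsto_intros)+
  then show ?thesis
    using assms unfolding mem_dom
    by (intro eventually_conj eventually_ball_finite ballI finite_atLeastAtMost)
      (blast dest: order_tendstoD)+
qed

lemma conj_transform_bound:
  assumes "0 \<le> s" "s < t" "t < t0" and f: "f holomorphic_on dom s"
    and f1: "\<And>z. z \<in> dom s \<Longrightarrow> cmod (f z) \<le> 1"
    and \<epsilon>: "\<And>l. l \<le> n \<Longrightarrow> (\<Sum>j\<in>{..n} - {l}. rel_size l j) \<le> \<epsilon>" and "0 \<le> \<epsilon>" and z: "z \<in> dom t"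
  shows "cmod (conj_transform t f z) \<le> 3 * \<epsilon>"
proof (rule field_le_epsilon)
  fix \<eta> :: real assume "0 < \<eta>"
  have t: "0 \<le> t" "t \<le> t0"
    using assms by auto
  have cf: "continuous_on (bdry t) f"
    using continuous_on_bdry[OF f] assms by simp
  have fb: "cmod (f z) \<le> 1" if "z \<in> bdry t" for z
    using that bdry_subset_dom[of s t] assms by auto
  obtain \<delta> where "0 < \<delta>" and \<delta>: "\<And>t' l z. t < t' \<Longrightarrow> t' < t + \<delta> \<Longrightarrow> t' \<le> t0 \<Longrightarrow> l \<le> n \<Longrightarrow>
      z \<in> dom t \<Longrightarrow> cmod (z - cc l) = rho t' l \<Longrightarrow>
      cmod (mean t l (\<lambda>\<xi>. f \<xi> * of_real (poisson l z \<xi>)) - f z) \<le> \<eta>"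
    using poisson_approximation[OF assms(1-3) f f1 \<open>0 < \<eta>\<close>] by blast
  have "\<forall>\<^sub>F t' in at_right t. z \<in> dom t' \<and> t < t' \<and> t' < t + \<delta> \<and> t' < t0"
    using \<open>0 < \<delta>\<close> \<open>t < t0\<close>
    by (intro eventually_conj eventually_dom z eventually_at_right_less
        order_tendstoD(2)[OF tendsto_ident_at]) auto
  \<comment> \<open>The maximum principle is applied on \<open>dom t'\<close> with \<open>t'\<close>
    slightly above \<open>t\<close>: the Cauchy kernel of the transform is singular on
    \<open>bdry t\<close>, whereas \<open>bdry t'\<close> lies inside \<open>dom t\<close>, and
    close enough to \<open>bdry t\<close> for the approximation of \<open>f\<close> to hold
    there.\<close>
  then obtain t' where t': "z \<in> dom t'" "t < t'" "t' < t + \<delta>" "t' < t0"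
    using eventually_happens' trivial_limit_at_right_real by blast
  have sub: "dom t' \<union> bdry t' \<subseteq> dom t"
    using bdry_subset_dom[of t t'] dom_antimono[of t t'] t t' by auto
  note hol = holomorphic_conj_transform[OF t cf]
  show "cmod (conj_transform t f z) \<le> 3 * \<epsilon> + \<eta>"
  proof (rule maximum_modulus_frontier[OF _ _ _ _ t'(1)])
    show "conj_transform t f holomorphic_on interior (dom t')"
      using hol sub interior_subset by (meson Un_subset_iff holomorphic_on_subset subset_trans)
    show "continuous_on (closure (dom t')) (conj_transform t f)"
      using closure_dom[of t'] sub hol
      by (meson continuous_on_subset holomorphic_on_imp_continuous_on subset_trans)
    show "bounded (dom t')"
      using compact_closed_dom[of t'] by (meson Un_upper1 bounded_subset compact_imp_bounded)
    fix w assume "w \<in> frontier (dom t')"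
    then have "w \<in> bdry t'"
      using closure_dom[of t'] open_dom[of t'] by (auto simp: frontier_def interior_open)
    then obtain l where l: "l \<le> n" and wl: "cmod (w - cc l) = rho t' l"
      by (auto simp: bdry_def dist_norm norm_minus_commute)
    have w: "w \<in> dom t"
      using \<open>w \<in> bdry t'\<close> sub by blast
    have "cmod (cnj (conj_transform t f w)) \<le> \<eta> + (\<Sum>j\<in>{..n} - {l}. 2 * rel_size l j) + \<epsilon>"
      unfolding conj_transform_eq[OF assms(1,2) t(2) f w l]
    proof (intro norm_triangle_mono order_trans[OF norm_sum] sum_mono)
      show "cmod (mean t l (\<lambda>\<xi>. f \<xi> * of_real (poisson l w \<xi>)) - f w) \<le> \<eta>"
        using \<delta> t' l w wl by simp
      show "cmod (mean t 0 f - mean t l f) \<le> \<epsilon>"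
      proof (cases "l = 0")
        case False
        then have "cmod (mean t 0 f - mean t l f) \<le> (\<Sum>j\<in>{..n} - {l}. rel_size l j)"
          using l by (intro mean_0_minus_mean_le[OF assms(1,2) t(2) f f1]) auto
        then show ?thesis
          using \<epsilon>[OF l] by simp
      qed (use \<open>0 \<le> \<epsilon>\<close> in simp)
      fix j assume "j \<in> {..n} - {l}"
      then have j: "j \<le> n" "j \<noteq> l"
        by auto
      show "cmod (mean t j (\<lambda>\<xi>. f \<xi> * of_real (poisson j w \<xi> - 1))) \<le> 2 * rel_size l j"
      proof (intro norm_circ_mean_le_const rho_nonneg[OF t j(1)])
        show "continuous_on (sphere (cc j) (rho t j)) (\<lambda>\<xi>. f \<xi> * of_real (poisson j w \<xi> - 1))"
          by (intro continuous_on_circle[OF _ j(1)] continuous_intros cf continuous_on_poisson w)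
        fix \<xi> assume \<xi>: "\<xi> \<in> sphere (cc j) (rho t j)"
        then have b: "\<xi> \<in> bdry t"
          using sphere_subset_bdry[OF j(1)] by blast
        have "cmod (f \<xi>) * \<bar>poisson j w \<xi> - 1\<bar> \<le> 1 * (2 * rel_size l j)"
          using poisson_minus_1_le[OF t(1) t'(2) _ l j w wl \<xi>] t' by (intro mult_mono fb b) auto
        then show "cmod (f \<xi> * of_real (poisson j w \<xi> - 1)) \<le> 2 * rel_size l j"
          by (simp only: norm_mult norm_of_real mult_1)
      qed
    qed
    then show "cmod (conj_transform t f w) \<le> 3 * \<epsilon> + \<eta>"
      using \<epsilon>[OF l] by (simp add: sum_distrib_left[symmetric])
  qed
qed

end

section \<open>Vector and operator norms\<close>

lemma scalar_prod_conjugate_eq: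
  assumes "x \<in> carrier_vec d" "y \<in> carrier_vec d"
  shows "x \<bullet>c y = (\<Sum>i<d. vec_index x i * cnj (vec_index y i))"
  using assms by (simp add: scalar_prod_def lessThan_atLeast0)

lemma vec_norm2_nonneg: "0 \<le> vec_norm2 v"
  by (simp add: vec_norm2_def)

lemma vec_norm2_eq: "v \<in> carrier_vec d \<Longrightarrow> vec_norm2 v = L2_set (\<lambda>i. cmod (vec_index v i)) {..<d}"
  by (simp add: vec_norm2_def)

lemma self_scalar_prod: "v \<in> carrier_vec d \<Longrightarrow> v \<bullet>c v = of_real ((vec_norm2 v)\<^sup>2)"
  by (simp add: scalar_prod_conjugate_eq vec_norm2_eq L2_set_def sum_nonneg
      complex_norm_square[symmetric])

lemma scalar_prod_commute_cnj:
  "x \<in> carrier_vec d \<Longrightarrow> y \<in> carrier_vec d \<Longrightarrow> cnj (x \<bullet>c y) = y \<bullet>c x"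
  by (simp add: scalar_prod_conjugate_eq mult.commute)

lemma scalar_prod_cauchy_schwarz:
  assumes "x \<in> carrier_vec d" "y \<in> carrier_vec d"
  shows "cmod (x \<bullet>c y) \<le> vec_norm2 x * vec_norm2 y"
proof -
  have "cmod (x \<bullet>c y) \<le> (\<Sum>i<d. \<bar>cmod (vec_index x i)\<bar> * \<bar>cmod (vec_index y i)\<bar>)"
    unfolding scalar_prod_conjugate_eq[OF assms]
    by (rule order_trans[OF norm_sum]) (simp add: norm_mult)
  also have "... \<le> vec_norm2 x * vec_norm2 y"
    unfolding vec_norm2_eq[OF assms(1)] vec_norm2_eq[OF assms(2)] by (rule L2_set_mult_ineq)
  finally show ?thesis .
qed

lemma vec_norm2_smult: "vec_norm2 (a \<cdot>\<^sub>v v) = cmod a * vec_norm2 v"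
  unfolding vec_norm2_def L2_set_right_distrib[OF norm_ge_zero]
  by (intro L2_set_cong) (auto simp: norm_mult)

lemma vec_norm2_zero_iff:
  assumes "v \<in> carrier_vec d"
  shows "vec_norm2 v = 0 \<longleftrightarrow> v = 0\<^sub>v d"
proof
  assume "vec_norm2 v = 0"
  then have "\<forall>i<d. vec_index v i = 0"
    unfolding vec_norm2_eq[OF assms] by (subst (asm) L2_set_eq_0_iff) auto
  then show "v = 0\<^sub>v d"
    using assms by auto
qed (simp add: vec_norm2_def L2_set_def)

lemma vec_norm2_le_dual:
  assumes v: "v \<in> carrier_vec d" and "0 \<le> B"
    and le: "\<And>y. y \<in> carrier_vec d \<Longrightarrow> vec_norm2 y = 1 \<Longrightarrow> cmod (v \<bullet>c y) \<le> B"
  shows "vec_norm2 v \<le> B"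
proof (cases "vec_norm2 v = 0")
  case False
  define y where "y = of_real (1 / vec_norm2 v) \<cdot>\<^sub>v v"
  have y: "y \<in> carrier_vec d" "vec_norm2 y = 1"
    using v False vec_norm2_nonneg[of v] by (simp_all add: y_def vec_norm2_smult norm_divide)
  have "y \<bullet>c v = of_real (vec_norm2 v)"
    using v False by (simp add: y_def self_scalar_prod power2_eq_square)
  then have "cmod (v \<bullet>c y) = vec_norm2 v"
    using scalar_prod_commute_cnj[OF y(1) v] vec_norm2_nonneg[of v] by (metis abs_of_nonneg complex_cnj_complex_of_real norm_of_real)
  then show ?thesis
    using le[OF y] by simp
qed (use \<open>0 \<le> B\<close> in simp)

lemma form_expand:
  assumes "M \<in> carrier_mat d d" "x \<in> carrier_vec d" "y \<in> carrier_vec d"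
  shows "(M *\<^sub>v x) \<bullet>c y = (\<Sum>i<d. \<Sum>j<d. M $$ (i, j) * (vec_index x j * cnj (vec_index y i)))"
proof -
  have "vec_index (M *\<^sub>v x) i = (\<Sum>j<d. M $$ (i, j) * vec_index x j)" if "i < d" for i
    using assms that by (auto simp: scalar_prod_def lessThan_atLeast0 intro!: sum.cong)
  then show ?thesis
    using assms by (subst scalar_prod_conjugate_eq[of _ d]) (auto simp: sum_distrib_right mult.assoc)
qed

text \<open>Crude, but independent of the vectors, which is enough to make the suprema over vectors,
  and later over functions, finite.\<close>

lemma form_le_sum_entries:
  assumes "M \<in> carrier_mat d d" "x \<in> carrier_vec d" "y \<in> carrier_vec d"
    and "vec_norm2 x \<le> 1" "vec_norm2 y \<le> 1"
  shows "cmod ((M *\<^sub>v x) \<bullet>c y) \<le> (\<Sum>i<d. \<Sum>j<d. cmod (M $$ (i, j)))"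
proof -
  have comp: "cmod (vec_index v i) \<le> 1" if "v \<in> carrier_vec d" "vec_norm2 v \<le> 1" "i < d" for v i
    using member_le_L2_set[of "{..<d}" i "\<lambda>i. cmod (vec_index v i)"] that vec_norm2_eq[OF that(1)]
    by simp
  show ?thesis
    unfolding form_expand[OF assms(1-3)]
  proof (intro order_trans[OF norm_sum] sum_mono)
    fix i j assume "i \<in> {..<d}" "j \<in> {..<d}"
    then have "cmod (vec_index x j) * cmod (vec_index y i) \<le> 1 * 1"
      using comp assms by (intro mult_mono) auto
    then show "cmod (M $$ (i, j) * (vec_index x j * cnj (vec_index y i))) \<le> cmod (M $$ (i, j))"
      by (simp add: norm_mult mult_left_le)
  qed
qed

lemma bdd_above_mat_opnorm:
  assumes M: "M \<in> carrier_mat d d"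
  shows "bdd_above ((\<lambda>v. vec_norm2 (M *\<^sub>v v)) ` {v \<in> carrier_vec (dim_col M). vec_norm2 v \<le> 1})"
proof (rule bdd_aboveI2)
  fix v assume "v \<in> {v \<in> carrier_vec (dim_col M). vec_norm2 v \<le> 1}"
  then have "v \<in> carrier_vec d" "vec_norm2 v \<le> 1"
    using M by auto
  then show "vec_norm2 (M *\<^sub>v v) \<le> (\<Sum>i<d. \<Sum>j<d. cmod (M $$ (i, j)))"
    using M by (intro vec_norm2_le_dual[OF _ _ form_le_sum_entries[OF M]]) (auto intro!: sum_nonneg)
qed

lemma mat_opnorm_bound:
  assumes M: "M \<in> carrier_mat d d" and v: "v \<in> carrier_vec d"
  shows "vec_norm2 (M *\<^sub>v v) \<le> mat_opnorm M * vec_norm2 v"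
proof (cases "vec_norm2 v = 0")
  case True
  then have "v = 0\<^sub>v d"
    using vec_norm2_zero_iff[OF v] by simp
  then have "M *\<^sub>v v = 0\<^sub>v d"
    using M by (intro eq_vecI) auto
  then show ?thesis
    using True vec_norm2_zero_iff[of "0\<^sub>v d" d] by simp
next
  case False
  define w where "w = of_real (1 / vec_norm2 v) \<cdot>\<^sub>v v"
  have pos: "0 < vec_norm2 v"
    using False vec_norm2_nonneg[of v] by simp
  have "w \<in> {v \<in> carrier_vec (dim_col M). vec_norm2 v \<le> 1}"
    using v M pos by (simp add: w_def vec_norm2_smult norm_divide)
  then have "vec_norm2 (M *\<^sub>v w) \<le> mat_opnorm M"
    unfolding mat_opnorm_def by (rule cSUP_upper[OF _ bdd_above_mat_opnorm[OF M]])
  moreover have "M *\<^sub>v w = of_real (1 / vec_norm2 v) \<cdot>\<^sub>v (M *\<^sub>v v)"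
    unfolding w_def by (rule mult_mat_vec[OF M v])
  then have "vec_norm2 (M *\<^sub>v w) = vec_norm2 (M *\<^sub>v v) / vec_norm2 v"
    using pos by (simp add: vec_norm2_smult norm_divide)
  ultimately show ?thesis
    using pos by (simp add: divide_le_eq)
qed

lemma mat_opnorm_le:
  assumes M: "M \<in> carrier_mat d d" and "0 \<le> B"
    and le: "\<And>x y. x \<in> carrier_vec d \<Longrightarrow> y \<in> carrier_vec d \<Longrightarrow> vec_norm2 x \<le> 1 \<Longrightarrow> vec_norm2 y = 1 \<Longrightarrow>
      cmod ((M *\<^sub>v x) \<bullet>c y) \<le> B"
  shows "mat_opnorm M \<le> B"
  unfolding mat_opnorm_def
proof (rule cSUP_least)
  have "0\<^sub>v d \<in> {v \<in> carrier_vec (dim_col M). vec_norm2 v \<le> 1}"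
    using M vec_norm2_zero_iff[of "0\<^sub>v d" d] by simp
  then show "{v \<in> carrier_vec (dim_col M). vec_norm2 v \<le> 1} \<noteq> {}"
    by blast
  fix v assume "v \<in> {v \<in> carrier_vec (dim_col M). vec_norm2 v \<le> 1}"
  then show "vec_norm2 (M *\<^sub>v v) \<le> B"
    using M by (intro vec_norm2_le_dual[OF _ \<open>0 \<le> B\<close> le]) auto
qed

section \<open>Inverses and determinants of complex matrices\<close>

lemma mat_inv_inverts:
  assumes M: "(M :: complex mat) \<in> carrier_mat d d" and "det M \<noteq> 0"
  shows "M * mat_inv M = 1\<^sub>m d" "mat_inv M * M = 1\<^sub>m d" "mat_inv M \<in> carrier_mat d d"
proof -
  have "M \<in> Units (ring_mat TYPE(complex) d ())"
    by (rule det_non_zero_imp_unit[OF M assms(2)])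
  then obtain N where "mat_inverse M = Some N"
    using mat_inverse(1)[OF M, of "()"] by (cases "mat_inverse M") auto
  then show "M * mat_inv M = 1\<^sub>m d" "mat_inv M * M = 1\<^sub>m d" "mat_inv M \<in> carrier_mat d d"
    using mat_inverse(2)[OF M] by (auto simp: mat_inv_def)
qed

lemma det_nonzero_if_bounded_below:
  assumes M: "(M :: complex mat) \<in> carrier_mat d d" and "0 < b"
    and le: "\<And>v. v \<in> carrier_vec d \<Longrightarrow> b * vec_norm2 v \<le> vec_norm2 (M *\<^sub>v v)"
  shows "det M \<noteq> 0"
proof
  assume "det M = 0"
  then obtain v where v: "v \<in> carrier_vec d" "v \<noteq> 0\<^sub>v d" "M *\<^sub>v v = 0\<^sub>v d"
    using det_0_iff_vec_prod_zero[OF M] by blast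
  then have "b * vec_norm2 v \<le> 0"
    using le[OF v(1)] vec_norm2_zero_iff[of "0\<^sub>v d" d] by simp
  then have "vec_norm2 v = 0"
    using \<open>0 < b\<close> vec_norm2_nonneg[of v] by (simp add: mult_le_0_iff)
  then show False
    using vec_norm2_zero_iff[OF v(1)] v(2) by simp
qed

lemma holomorphic_on_det:
  assumes M: "\<And>z. M z \<in> carrier_mat d d"
    and hol: "\<And>i j. i < d \<Longrightarrow> j < d \<Longrightarrow> (\<lambda>z. M z $$ (i, j)) holomorphic_on S"
  shows "(\<lambda>z. det (M z)) holomorphic_on S"
proof -
  have "(\<lambda>z. \<Sum>p | p permutes {0..<d}. signof p * (\<Prod>i = 0..<d. M z $$ (i, p i))) holomorphic_on S"
    by (intro holomorphic_intros hol) (auto simp: permutes_in_image[of _ "{0..<d}", simplified])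
  then show ?thesis
    by (simp only: det_def'[OF M])
qed

text \<open>Cramer's rule: an entry of the inverse is a cofactor, hence a polynomial in the entries,
  divided by the determinant.\<close>

lemma holomorphic_on_inverse_mat:
  assumes M: "\<And>z. M z \<in> carrier_mat d d"
    and hol: "\<And>i j. i < d \<Longrightarrow> j < d \<Longrightarrow> (\<lambda>z. M z $$ (i, j)) holomorphic_on S"
    and ne: "\<And>z. z \<in> S \<Longrightarrow> det (M z) \<noteq> 0"
    and ij: "i < d" "j < d"
  shows "(\<lambda>z. mat_inv (M z) $$ (i, j)) holomorphic_on S"
proof -

  have del: "(\<lambda>z. det (mat_delete (M z) j i)) holomorphic_on S"
  proof (rule holomorphic_on_det)
    show "mat_delete (M z) j i \<in> carrier_mat (d - 1) (d - 1)" for z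
      by (rule mat_delete_carrier[OF M])
    fix k l assume "k < d - 1" "l < d - 1"
    moreover have "dim_row (M z) = d" "dim_col (M z) = d" for z
      using M[of z] by auto
    ultimately show "(\<lambda>z. mat_delete (M z) j i $$ (k, l)) holomorphic_on S"
      by (auto simp: mat_delete_def intro!: hol)
  qed
  have adj: "adj_mat (M z) \<in> carrier_mat d d" "adj_mat (M z) * M z = det (M z) \<cdot>\<^sub>m 1\<^sub>m d" for z
    using adj_mat[OF M[of z]] by auto
  have eq: "mat_inv (M z) $$ (i, j) = adj_mat (M z) $$ (i, j) / det (M z)" if "z \<in> S" for z
  proof -
    note inv = mat_inv_inverts[OF M ne[OF that]]
    have "adj_mat (M z) = adj_mat (M z) * (M z * mat_inv (M z))"
      unfolding inv by (rule right_mult_one_mat[OF adj(1), symmetric])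
    also have "... = adj_mat (M z) * M z * mat_inv (M z)"
      by (rule assoc_mult_mat[symmetric, OF adj(1) M inv(3)])
    also have "... = det (M z) \<cdot>\<^sub>m mat_inv (M z)"
      unfolding adj using inv(3) by (simp add: mult_smult_assoc_mat[of _ d d])
    finally have "adj_mat (M z) $$ (i, j) = det (M z) * mat_inv (M z) $$ (i, j)"
      using inv(3) ij by simp
    then show ?thesis
      using ne[OF that] by simp
  qed
  have "adj_mat (M z) $$ (i, j) = (-1) ^ (j + i) * det (mat_delete (M z) j i)" for z
    using M[of z] ij by (auto simp: adj_mat_def cofactor_def)
  then have "(\<lambda>z. adj_mat (M z) $$ (i, j) / det (M z)) holomorphic_on S"
    using del ne by (simp, intro holomorphic_intros holomorphic_on_det[OF M hol]) auto
  then show ?thesis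
    by (rule holomorphic_transform) (simp add: eq)
qed

lemma smult_mat_vec:
  "A \<in> carrier_mat d e \<Longrightarrow> v \<in> carrier_vec e \<Longrightarrow> (k \<cdot>\<^sub>m A) *\<^sub>v v = (k :: complex) \<cdot>\<^sub>v (A *\<^sub>v v)"
  by (intro eq_vecI) auto

lemma pencil_mult_vec:
  assumes "A \<in> carrier_mat d d" "v \<in> carrier_vec d"
  shows "((k :: complex) \<cdot>\<^sub>m 1\<^sub>m d - A) *\<^sub>v v = k \<cdot>\<^sub>v v - A *\<^sub>v v"
  using assms by (subst minus_mult_distrib_mat_vec[of _ d d]) (auto simp: smult_mat_vec[of _ d d])

lemma vec_norm2_triangle:
  assumes "u \<in> carrier_vec d" "v \<in> carrier_vec d"
  shows "vec_norm2 (u + v) \<le> vec_norm2 u + vec_norm2 v"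
proof -
  have "vec_norm2 (u + v) = L2_set (\<lambda>i. cmod (vec_index u i + vec_index v i)) {..<d}"
    using assms by (auto simp: vec_norm2_def intro!: L2_set_cong)
  also have "... \<le> L2_set (\<lambda>i. cmod (vec_index u i) + cmod (vec_index v i)) {..<d}"
    by (intro L2_set_mono norm_triangle_ineq) auto
  also have "... \<le> vec_norm2 u + vec_norm2 v"
    unfolding vec_norm2_eq[OF assms(1)] vec_norm2_eq[OF assms(2)] by (rule L2_set_triangle_ineq)
  finally show ?thesis .
qed

text \<open>By the triangle inequality the norm of the image of \<open>v\<close> is at least
  \<open>1 - cmod w * \<alpha>\<close> times that of \<open>v\<close>, and this factor is
  positive.\<close>

lemma det_one_minus_nonzero:
  assumes A: "A \<in> carrier_mat d d" and "0 < \<alpha>" "cmod w < 1 / \<alpha>"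
    and le: "\<And>v. v \<in> carrier_vec d \<Longrightarrow> vec_norm2 (A *\<^sub>v v) \<le> \<alpha> * vec_norm2 v"
  shows "det (1\<^sub>m d - w \<cdot>\<^sub>m A) \<noteq> 0"
proof (rule det_nonzero_if_bounded_below[of _ d "1 - cmod w * \<alpha>"])
  show "1\<^sub>m d - w \<cdot>\<^sub>m A \<in> carrier_mat d d"
    using A by (intro minus_carrier_mat smult_carrier_mat)
  show "0 < 1 - cmod w * \<alpha>"
    using assms(2,3) by (simp add: field_simps)
  fix v :: "complex Matrix.vec" assume v: "v \<in> carrier_vec d"
  have Av: "A *\<^sub>v v \<in> carrier_vec d"
    using A v by simp
  have "(1\<^sub>m d - w \<cdot>\<^sub>m A) *\<^sub>v v = v - w \<cdot>\<^sub>v (A *\<^sub>v v)"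
    using A v by (subst minus_mult_distrib_mat_vec[of _ d d]) (auto simp: smult_mat_vec[of _ d d])
  then have "v = (1\<^sub>m d - w \<cdot>\<^sub>m A) *\<^sub>v v + w \<cdot>\<^sub>v (A *\<^sub>v v)"
    using v A by (intro eq_vecI) auto
  moreover have "(1\<^sub>m d - w \<cdot>\<^sub>m A) *\<^sub>v v \<in> carrier_vec d"
    using A v by (intro mult_mat_vec_carrier[of _ d d] minus_carrier_mat smult_carrier_mat)
  ultimately have "vec_norm2 v \<le> vec_norm2 ((1\<^sub>m d - w \<cdot>\<^sub>m A) *\<^sub>v v) + cmod w * vec_norm2 (A *\<^sub>v v)"
    using vec_norm2_triangle[of "(1\<^sub>m d - w \<cdot>\<^sub>m A) *\<^sub>v v" d "w \<cdot>\<^sub>v (A *\<^sub>v v)"] Av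
    by (metis smult_carrier_vec vec_norm2_smult)
  moreover have "cmod w * vec_norm2 (A *\<^sub>v v) \<le> cmod w * (\<alpha> * vec_norm2 v)"
    by (intro mult_left_mono le v) simp
  ultimately show "(1 - cmod w * \<alpha>) * vec_norm2 v \<le> vec_norm2 ((1\<^sub>m d - w \<cdot>\<^sub>m A) *\<^sub>v v)"
    by (simp add: algebra_simps)
qed

section \<open>Continuity, interchange and inversion of circular means\<close>

lemma circ_mean_continuous:
  assumes H: "continuous_on (S \<times> sphere b \<rho>) (\<lambda>(x, y). H x y)" and "0 \<le> \<rho>"
  shows "continuous_on S (\<lambda>x. circ_mean b \<rho> (H x :: complex \<Rightarrow> complex))"
proof -
  have "continuous_on (S \<times> cbox 0 1) ((\<lambda>(x, y). H x y) \<circ> (\<lambda>(x, \<theta>). (x, circlepath b \<rho> \<theta>)))"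
    unfolding case_prod_beta
    by (intro continuous_on_compose continuous_on_subset[OF H[unfolded case_prod_beta]] continuous_intros
        continuous_on_compose2[OF continuous_on_circlepath[of UNIV]])
      (use circlepath_in_sphere[OF assms(2)] in auto)
  then show ?thesis
    unfolding circ_mean_def using integral_continuous_on_param[of S 0 1 "\<lambda>x \<theta>. H x (circlepath b \<rho> \<theta>)"]
    by (simp add: o_def case_prod_beta)
qed

lemma circ_mean_swap:
  assumes H: "continuous_on (sphere a \<rho> \<times> sphere b \<tau>) (\<lambda>(x, y). H x y)" and "0 \<le> \<rho>" "0 \<le> \<tau>"
  shows "circ_mean a \<rho> (\<lambda>x. circ_mean b \<tau> (H x :: complex \<Rightarrow> complex)) =
    circ_mean b \<tau> (\<lambda>y. circ_mean a \<rho> (\<lambda>x. H x y))"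
proof -
  have "continuous_on (cbox (0, 0) (1, 1))
      ((\<lambda>(x, y). H x y) \<circ> (\<lambda>(\<theta>, \<phi>). (circlepath a \<rho> \<theta>, circlepath b \<tau> \<phi>)))"
    unfolding case_prod_beta
    by (intro continuous_on_compose continuous_on_subset[OF H[unfolded case_prod_beta]] continuous_intros
        continuous_on_compose2[OF continuous_on_circlepath[of UNIV]])
      (use circlepath_in_sphere assms in auto)
  then show ?thesis
    unfolding circ_mean_def
    using integral_swap_continuous[of 0 0 1 1 "\<lambda>\<theta> \<phi>. H (circlepath a \<rho> \<theta>) (circlepath b \<tau> \<phi>)"]
    by (simp add: o_def case_prod_beta)
qed

text \<open>Inversion maps the circle to the one of reciprocal radius and reverses it, so the
  parameter \<theta> becomes 1 - \<theta>.\<close>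

lemma circ_mean_inversion:
  fixes h :: "complex \<Rightarrow> complex"
  assumes "0 < \<rho>" and h: "continuous_on (sphere 0 (1 / \<rho>)) h"
  shows "circ_mean 0 \<rho> (\<lambda>\<xi>. h (1 / \<xi>)) = circ_mean 0 (1 / \<rho>) h"
proof -
  have "1 / circlepath 0 \<rho> \<theta> = circlepath 0 (1 / \<rho>) (1 - \<theta>)" for \<theta>
    by (simp add: circlepath exp_diff right_diff_distrib exp_minus field_simps)
  moreover have "integral {0..1} (\<lambda>\<theta>. h (circlepath 0 (1 / \<rho>) (1 - \<theta>))) =
      integral {0..1} (\<lambda>\<theta>. h (circlepath 0 (1 / \<rho>) \<theta>))"
  proof -
    have "(\<lambda>x::real. (x - 1) / - 1) ` {0..1} = {0..1}"
    proof -
      have "(\<lambda>x::real. (x - 1) / - 1) = (\<lambda>x. 1 - x)"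
        by auto
      then show ?thesis
        by (simp add: image_diff_atLeastAtMost)
    qed
    then show ?thesis
      using has_integral_affinity01[OF integrable_integral[OF circ_integrable[OF h]], of "- 1" 1] assms(1)
      by (simp add: integral_unique)
  qed
  ultimately show ?thesis
    by (simp add: circ_mean_def)
qed

lemma circ_mean_centre:
  assumes "0 < \<rho>" and h: "h holomorphic_on cball a \<rho>"
  shows "circ_mean a \<rho> h = h a"
proof -
  have "((\<lambda>u. h u / (u - a)) has_contour_integral 2 * of_real pi * \<i> * h a) (circlepath a \<rho>)"
    using Cauchy_integral_circlepath_simple[OF h, of a] assms(1) by simp
  then have "circ_mean a \<rho> (\<lambda>u. h u / (u - a) * (u - a)) = h a"
    unfolding circ_mean_eq_contour_integral by (simp add: contour_integral_unique)
  moreover have "circ_mean a \<rho> (\<lambda>u. h u / (u - a) * (u - a)) = circ_mean a \<rho> h"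
    using assms(1) by (intro circ_mean_cong) auto
  ultimately show ?thesis
    by simp
qed

context multi_disk
begin

text \<open>Fubini for each pair of circles. In the application the two levels differ, so that a
  factor 1 / (\<xi> - z) is continuous on the product of the boundaries.\<close>

lemma cyc_swap:
  assumes t: "0 \<le> t" "t \<le> t0" and t': "0 \<le> t'" "t' \<le> t0"
    and H: "continuous_on (bdry t \<times> bdry t') (\<lambda>(\<xi>, z). H \<xi> z)"
  shows "cyc t (\<lambda>\<xi>. cyc t' (H \<xi>)) = cyc t' (\<lambda>z. cyc t (\<lambda>\<xi>. H \<xi> z))"
proof -
  let ?G = "\<lambda>j k \<xi> z. H \<xi> z * (z - cc k) * (\<xi> - cc j)"
  have cG: "continuous_on (sphere (cc j) (rho t j) \<times> sphere (cc k) (rho t' k)) (\<lambda>(\<xi>, z). ?G j k \<xi> z)"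
    if "j \<le> n" "k \<le> n" for j k
    using continuous_on_subset[OF H Sigma_mono[OF sphere_subset_bdry[OF that(1)] sphere_subset_bdry[OF that(2)]]]
    unfolding case_prod_beta by (intro continuous_intros)
  have cGr: "continuous_on (sphere (cc k) (rho t' k) \<times> sphere (cc j) (rho t j)) (\<lambda>(z, \<xi>). ?G j k \<xi> z)"
    if "j \<le> n" "k \<le> n" for j k
    using continuous_on_swap_args[OF cG[OF that]] .
  note rp = rho_nonneg[OF t] rho_nonneg[OF t']
  have "mean t j (\<lambda>\<xi>. cyc t' (H \<xi>) * (\<xi> - cc j)) =
      (\<Sum>k\<le>n. sg k * mean t j (\<lambda>\<xi>. mean t' k (?G j k \<xi>)))" if j: "j \<le> n" for j
  proof -
    have "mean t j (\<lambda>\<xi>. cyc t' (H \<xi>) * (\<xi> - cc j)) =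
        mean t j (\<lambda>\<xi>. \<Sum>k\<le>n. sg k * mean t' k (?G j k \<xi>))"
    proof -
      have "cyc t' (H \<xi>) * (\<xi> - cc j) = (\<Sum>k\<le>n. sg k * mean t' k (?G j k \<xi>))" for \<xi>
      proof -
        have "mean t' k (?G j k \<xi>) = (\<xi> - cc j) * mean t' k (\<lambda>z. H \<xi> z * (z - cc k))" for k
          unfolding circ_mean_mult_right[symmetric] by (simp add: mult_ac)
        then show ?thesis
          by (simp add: cyc_def sum_distrib_left sum_distrib_right mult_ac)
      qed
      then show ?thesis
        by simp
    qed
    also have "... = (\<Sum>k\<le>n. mean t j (\<lambda>\<xi>. sg k * mean t' k (?G j k \<xi>)))"
      by (intro circ_mean_sum continuous_intros circ_mean_continuous cG j rp) auto
    finally show ?thesis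
      by (simp only: circ_mean_mult_right)
  qed
  then have 1: "cyc t (\<lambda>\<xi>. cyc t' (H \<xi>)) =
      (\<Sum>j\<le>n. \<Sum>k\<le>n. sg j * sg k * mean t j (\<lambda>\<xi>. mean t' k (?G j k \<xi>)))"
    by (simp add: cyc_def[of t] sum_distrib_left mult.assoc)
  have "mean t' k (\<lambda>z. cyc t (\<lambda>\<xi>. H \<xi> z) * (z - cc k)) =
      (\<Sum>j\<le>n. sg j * mean t' k (\<lambda>z. mean t j (\<lambda>\<xi>. ?G j k \<xi> z)))" if k: "k \<le> n" for k
  proof -
    have "mean t' k (\<lambda>z. cyc t (\<lambda>\<xi>. H \<xi> z) * (z - cc k)) =
        mean t' k (\<lambda>z. \<Sum>j\<le>n. sg j * mean t j (\<lambda>\<xi>. ?G j k \<xi> z))"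
    proof -
      have "cyc t (\<lambda>\<xi>. H \<xi> z) * (z - cc k) = (\<Sum>j\<le>n. sg j * mean t j (\<lambda>\<xi>. ?G j k \<xi> z))" for z
      proof -
        have "mean t j (\<lambda>\<xi>. ?G j k \<xi> z) = (z - cc k) * mean t j (\<lambda>\<xi>. H \<xi> z * (\<xi> - cc j))" for j
          unfolding circ_mean_mult_right[symmetric] by (simp add: mult_ac)
        then show ?thesis
          by (simp add: cyc_def sum_distrib_left sum_distrib_right mult_ac)
      qed
      then show ?thesis
        by simp
    qed
    also have "... = (\<Sum>j\<le>n. mean t' k (\<lambda>z. sg j * mean t j (\<lambda>\<xi>. ?G j k \<xi> z)))"
      by (intro circ_mean_sum continuous_intros circ_mean_continuous cGr k rp) auto
    finally show ?thesis
      by (simp only: circ_mean_mult_right)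
  qed
  then have "cyc t' (\<lambda>z. cyc t (\<lambda>\<xi>. H \<xi> z)) =
      (\<Sum>k\<le>n. \<Sum>j\<le>n. sg k * sg j * mean t' k (\<lambda>z. mean t j (\<lambda>\<xi>. ?G j k \<xi> z)))"
    by (simp add: cyc_def[of t'] sum_distrib_left mult.assoc)
  also have "... = (\<Sum>j\<le>n. \<Sum>k\<le>n. sg j * sg k * mean t j (\<lambda>\<xi>. mean t' k (?G j k \<xi>)))"
  proof (subst sum.swap, intro sum.cong refl)
    fix j k assume "j \<in> {..n}" "k \<in> {..n}"
    then have "mean t j (\<lambda>\<xi>. mean t' k (?G j k \<xi>)) = mean t' k (\<lambda>z. mean t j (\<lambda>\<xi>. ?G j k \<xi> z))"
      by (intro circ_mean_swap cG rp) auto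
    then show "sg k * sg j * mean t' k (\<lambda>z. mean t j (\<lambda>\<xi>. ?G j k \<xi> z)) =
        sg j * sg k * mean t j (\<lambda>\<xi>. mean t' k (?G j k \<xi>))"
      by (simp only: mult.commute[of "sg k"])
  qed
  finally show ?thesis
    using 1 by simp
qed

end

section \<open>The functional calculus\<close>

text \<open>The class conditions as inequalities for vectors instead of operator norms:
  \<open>\<beta> i\<close> bounds \<open>A - c i\<close> from below, which replaces the bound on the
  norm of its inverse. Both bounds leave room for moving the circles by \<open>t0\<close>.\<close>

locale disk_class_matrix = multi_disk +
  fixes d :: nat and A :: "complex mat" and \<alpha> :: real and \<beta> :: "nat \<Rightarrow> real"
  assumes A: "A \<in> carrier_mat d d"
    and \<alpha>_pos: "0 < \<alpha>" and \<alpha>_less: "\<alpha> < R - t0"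
    and upper: "\<And>v. v \<in> carrier_vec d \<Longrightarrow> vec_norm2 (A *\<^sub>v v) \<le> \<alpha> * vec_norm2 v"
    and \<beta>_greater: "\<And>i. i \<in> {1..n} \<Longrightarrow> r i + t0 < \<beta> i"
    and lower: "\<And>i v. i \<in> {1..n} \<Longrightarrow> v \<in> carrier_vec d \<Longrightarrow>
      \<beta> i * vec_norm2 v \<le> vec_norm2 (A *\<^sub>v v - c i \<cdot>\<^sub>v v)"
begin

definition Res :: "complex \<Rightarrow> complex mat" where
  "Res \<xi> = mat_inv (\<xi> \<cdot>\<^sub>m 1\<^sub>m d - A)"

lemma pencil_carrier: "\<xi> \<cdot>\<^sub>m 1\<^sub>m d - A \<in> carrier_mat d d"
  using A by (intro minus_carrier_mat)

lemma spectrum_cases: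
  assumes "k \<in> spectrum A"
  obtains v where "v \<in> carrier_vec d" "vec_norm2 v > 0" "A *\<^sub>v v = k \<cdot>\<^sub>v v"
proof -
  obtain v where v: "v \<in> carrier_vec d" "v \<noteq> 0\<^sub>v d" "A *\<^sub>v v = k \<cdot>\<^sub>v v"
    using assms A by (auto simp: spectrum_def eigenvalue_def eigenvector_def)
  then show ?thesis
    using that[of v] vec_norm2_zero_iff[OF v(1)] vec_norm2_nonneg[of v] by simp
qed

lemma spectrum_norm_le: "k \<in> spectrum A \<Longrightarrow> cmod k \<le> \<alpha>"
  by (elim spectrum_cases) (use upper in \<open>force simp: vec_norm2_smult\<close>)

lemma spectrum_dist_ge:
  assumes "k \<in> spectrum A" "i \<in> {1..n}"
  shows "\<beta> i \<le> cmod (k - c i)"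
proof -
  obtain v where v: "v \<in> carrier_vec d" "vec_norm2 v > 0" "A *\<^sub>v v = k \<cdot>\<^sub>v v"
    using spectrum_cases[OF assms(1)] by blast
  have "A *\<^sub>v v - c i \<cdot>\<^sub>v v = (k - c i) \<cdot>\<^sub>v v"
    unfolding v(3) using v(1) by (intro eq_vecI) (auto simp: algebra_simps)
  then show ?thesis
    using lower[OF assms(2) v(1)] v(2) by (simp add: vec_norm2_smult)
qed

lemma spectrum_subset_dom: "spectrum A \<subseteq> dom t0"
  using spectrum_norm_le spectrum_dist_ge \<alpha>_less \<beta>_greater by (force simp: mem_dom)

lemma finite_spectrum: "finite (spectrum A)"
  by (rule card_finite_spectrum(1)[OF A])

lemma bdry_Int_spectrum: "t \<le> t0 \<Longrightarrow> bdry t \<inter> spectrum A = {}"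
  using spectrum_subset_dom dom_antimono[of t t0] bdry_Int_dom[of t] by blast

lemma det_pencil: "k \<notin> spectrum A \<Longrightarrow> det (k \<cdot>\<^sub>m 1\<^sub>m d - A) \<noteq> 0"
proof
  assume k: "k \<notin> spectrum A" and "det (k \<cdot>\<^sub>m 1\<^sub>m d - A) = 0"
  then obtain v where v: "v \<in> carrier_vec d" "v \<noteq> 0\<^sub>v d" "k \<cdot>\<^sub>v v - A *\<^sub>v v = 0\<^sub>v d"
    using det_0_iff_vec_prod_zero[OF pencil_carrier] pencil_mult_vec[OF A] by metis
  have "A *\<^sub>v v = k \<cdot>\<^sub>v v"
  proof (rule eq_vecI)
    fix i assume "i < dim_vec (k \<cdot>\<^sub>v v)"
    then show "vec_index (A *\<^sub>v v) i = vec_index (k \<cdot>\<^sub>v v) i"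
      using arg_cong[OF v(3), of "\<lambda>u. vec_index u i"] v(1) A by simp
  qed (use v(1) A in auto)
  then show False
    using k v A by (auto simp: spectrum_def eigenvalue_def eigenvector_def)
qed

lemma Res_inverse:
  assumes "\<xi> \<notin> spectrum A"
  shows "(\<xi> \<cdot>\<^sub>m 1\<^sub>m d - A) * Res \<xi> = 1\<^sub>m d" "Res \<xi> * (\<xi> \<cdot>\<^sub>m 1\<^sub>m d - A) = 1\<^sub>m d"
    "Res \<xi> \<in> carrier_mat d d"
  unfolding Res_def by (rule mat_inv_inverts[OF pencil_carrier det_pencil[OF assms]])+

lemma holomorphic_Res:
  assumes "i < d" "j < d"
  shows "(\<lambda>\<xi>. Res \<xi> $$ (i, j)) holomorphic_on - spectrum A"
  unfolding Res_def
proof (rule holomorphic_on_inverse_mat[OF pencil_carrier _ _ assms])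
  fix i j assume "i < d" "j < d"
  then show "(\<lambda>\<xi>. (\<xi> \<cdot>\<^sub>m 1\<^sub>m d - A) $$ (i, j)) holomorphic_on - spectrum A"
    using A by (auto intro!: holomorphic_intros)
qed (use det_pencil in auto)

lemma continuous_on_Res:
  assumes "i < d" "j < d" "t \<le> t0"
  shows "continuous_on (bdry t) (\<lambda>\<xi>. Res \<xi> $$ (i, j))"
  using bdry_Int_spectrum[OF assms(3)]
  by (intro continuous_on_subset[OF holomorphic_on_imp_continuous_on[OF holomorphic_Res[OF assms(1,2)]]]) auto

lemma Res_carrier: "\<xi> \<in> bdry t \<Longrightarrow> t \<le> t0 \<Longrightarrow> Res \<xi> \<in> carrier_mat d d"
  using Res_inverse(3) bdry_Int_spectrum by blast

text \<open>A level \<open>t\<close> and weights that are merely continuous are allowed because the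
  conjugate of \<open>f\<close> has to be inserted; for such weights the result may depend on
  \<open>t\<close>.\<close>

definition mint :: "real \<Rightarrow> (complex \<Rightarrow> complex) \<Rightarrow> complex mat" where
  "mint t w = mat d d (\<lambda>(i, j). cyc t (\<lambda>\<xi>. w \<xi> * Res \<xi> $$ (i, j)))"

lemma mint_carrier [simp]: "mint t w \<in> carrier_mat d d"
  "dim_row (mint t w) = d" "dim_col (mint t w) = d"
  by (auto simp: mint_def)

lemma mint_index: "i < d \<Longrightarrow> j < d \<Longrightarrow> mint t w $$ (i, j) = cyc t (\<lambda>\<xi>. w \<xi> * Res \<xi> $$ (i, j))"
  by (simp add: mint_def)

lemma form_mint:
  assumes t: "0 \<le> t" "t \<le> t0" and w: "continuous_on (bdry t) w"
    and x: "x \<in> carrier_vec d" and y: "y \<in> carrier_vec d"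
  shows "(mint t w *\<^sub>v x) \<bullet>c y = cyc t (\<lambda>\<xi>. w \<xi> * ((Res \<xi> *\<^sub>v x) \<bullet>c y))"
proof -
  let ?a = "\<lambda>i j. vec_index x j * cnj (vec_index y i)"
  have "cyc t (\<lambda>\<xi>. w \<xi> * ((Res \<xi> *\<^sub>v x) \<bullet>c y)) =
      cyc t (\<lambda>\<xi>. \<Sum>i<d. \<Sum>j<d. ?a i j * (w \<xi> * Res \<xi> $$ (i, j)))"
    using t by (intro cyc_cong)
      (auto simp: form_expand[OF Res_carrier x y] sum_distrib_left mult_ac)
  also have "... = (\<Sum>i<d. \<Sum>j<d. cyc t (\<lambda>\<xi>. ?a i j * (w \<xi> * Res \<xi> $$ (i, j))))"
    using t w by (subst cyc_sum, auto intro!: continuous_intros continuous_on_Res sum.cong cyc_sum)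
  also have "... = (mint t w *\<^sub>v x) \<bullet>c y"
    unfolding cyc_mult_right form_expand[OF mint_carrier(1) x y]
    by (intro sum.cong refl) (simp add: mint_index mult.commute)
  finally show ?thesis ..
qed

text \<open>Integration at the fixed level \<open>t0\<close> serves all functions holomorphic on
  some \<open>dom s\<close> with \<open>s < t0\<close> at once.\<close>

definition \<Phi> :: "(complex \<Rightarrow> complex) \<Rightarrow> complex mat" where
  "\<Phi> f = mint t0 f"

lemma \<Phi>_carrier [simp]: "\<Phi> f \<in> carrier_mat d d" "dim_row (\<Phi> f) = d" "dim_col (\<Phi> f) = d"
  by (auto simp: \<Phi>_def)

lemma \<Phi>_eq_mint:
  assumes "0 \<le> s" "s < t" "t \<le> t0" and f: "f holomorphic_on dom s"
  shows "\<Phi> f = mint t f"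
  unfolding \<Phi>_def
proof (rule eq_matI)
  fix i j assume "i < dim_row (mint t f)" "j < dim_col (mint t f)"
  then have ij: "i < d" "j < d"
    by auto
  have "cyc t0 (\<lambda>\<xi>. f \<xi> * Res \<xi> $$ (i, j)) = cyc t (\<lambda>\<xi>. f \<xi> * Res \<xi> $$ (i, j))"
  proof (rule cyc_eq[of s _ _ "spectrum A"])
    show "spectrum A \<subseteq> dom t"
      using spectrum_subset_dom dom_antimono[of t t0] assms by blast
    show "(\<lambda>\<xi>. f \<xi> * Res \<xi> $$ (i, j)) holomorphic_on dom s - spectrum A"
      by (intro holomorphic_intros holomorphic_on_subset[OF f] holomorphic_on_subset[OF holomorphic_Res[OF ij]]) auto
  qed (use assms finite_spectrum spectrum_subset_dom in auto)
  then show "mint t0 f $$ (i, j) = mint t f $$ (i, j)"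
    using ij by (simp add: mint_index)
qed auto

lemma surrounds_cycle:
  assumes "0 \<le> s" "s < t0"
  shows "surrounds (cycle t0) (spectrum A) (dom s)"
proof -
  have t: "0 \<le> t0" "t0 \<le> t0"
    using t0_pos by auto
  have b: "bdry t0 \<subseteq> dom s" "bdry t0 \<inter> dom t0 = {}" "dom t0 \<subseteq> dom s"
    using bdry_subset_dom[of s t0] bdry_Int_dom dom_antimono[of s t0] assms by auto
  have "\<forall>\<nu>\<in>set (cycle t0). valid_path \<nu> \<and> pathfinish \<nu> = pathstart \<nu> \<and> path_image \<nu> \<subseteq> dom s - spectrum A"
    using cycle_paths[OF t] b spectrum_subset_dom by blast
  moreover have "(\<Sum>\<nu>\<leftarrow>cycle t0. winding_number \<nu> z) = 1" if "z \<in> spectrum A" for z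
  proof -
    have "z \<in> dom t0" "z \<notin> bdry t0"
      using that spectrum_subset_dom b by auto
    then show ?thesis
      using winding_cycle[OF t] by simp
  qed
  moreover have "(\<Sum>\<nu>\<leftarrow>cycle t0. winding_number \<nu> z) = 0" if "z \<notin> dom s" for z
  proof -
    have "z \<notin> dom t0" "z \<notin> bdry t0"
      using that b by auto
    then show ?thesis
      using winding_cycle[OF t] by simp
  qed
  ultimately show ?thesis
    by (simp add: surrounds_def)
qed

text \<open>\<open>cycle t0\<close> shows that the choice in \<open>hol_calc\<close> has a
  candidate. Any two cycles surrounding the spectrum are homologous in the domain minus the
  spectrum, where the integrand is holomorphic.\<close>

lemma hol_calc_eq_\<Phi>:
  assumes f: "f holomorphic_on dom 0"
  shows "hol_calc (dom 0) f A = \<Phi> f"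
proof -
  define \<Gamma> where "\<Gamma> = (SOME \<Gamma>. surrounds \<Gamma> (spectrum A) (dom 0))"
  have sur: "surrounds (cycle t0) (spectrum A) (dom 0)"
    by (rule surrounds_cycle) (use t0_pos in auto)
  then have \<Gamma>: "surrounds \<Gamma> (spectrum A) (dom 0)"
    unfolding \<Gamma>_def by (rule someI)
  have eq: "(\<Sum>\<nu>\<leftarrow>\<Gamma>. contour_integral \<nu> F) = (\<Sum>\<nu>\<leftarrow>cycle t0. contour_integral \<nu> F)"
    if F: "F holomorphic_on dom 0 - spectrum A" for F
  proof (rule homologous_cycles_integral_eq[OF _ _ _ _ F])
    show "open (dom 0 - spectrum A)"
      using open_dom finite_spectrum by (intro open_Diff finite_imp_closed)
    show "connected (dom 0 - spectrum A)"
      using open_dom finite_spectrum t0_pos by (intro connected_open_delete_finite connected_dom) auto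
    fix z assume "z \<notin> dom 0 - spectrum A"
    then show "(\<Sum>\<nu>\<leftarrow>\<Gamma>. winding_number \<nu> z) = (\<Sum>\<nu>\<leftarrow>cycle t0. winding_number \<nu> z)"
      using \<Gamma> sur unfolding surrounds_def by (cases "z \<in> dom 0") auto
  qed (use \<Gamma> sur in \<open>auto simp: surrounds_def\<close>)
  have dimA: "dim_row A = d"
    using A by auto
  show ?thesis
  proof (rule eq_matI)
    fix i j assume "i < dim_row (\<Phi> f)" "j < dim_col (\<Phi> f)"
    then have ij: "i < d" "j < d"
      by auto
    have "(\<lambda>\<xi>. f \<xi> * Res \<xi> $$ (i, j)) holomorphic_on dom 0 - spectrum A"
      by (intro holomorphic_intros holomorphic_on_subset[OF f] holomorphic_on_subset[OF holomorphic_Res[OF ij]]) auto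
    from eq[OF this] show "hol_calc (dom 0) f A $$ (i, j) = \<Phi> f $$ (i, j)"
      using ij unfolding \<Phi>_def hol_calc_def Let_def \<Gamma>_def[symmetric] dimA Res_def[symmetric]
      by (simp add: mint_index cyc_eq_cycle)
  qed (simp_all add: hol_calc_def Let_def dimA)
qed

text \<open>On the outer circle the substitution \<open>w = 1 / \<xi>\<close> turns \<open>\<xi> (\<xi> - A)\<inverse>\<close> into \<open>(1 - w A)\<inverse>\<close>,
  which is holomorphic at \<open>w = 0\<close>; the inner circles contribute nothing.\<close>

lemma \<Phi>_one: "\<Phi> (\<lambda>_. 1) = 1\<^sub>m d"
proof (rule eq_matI)
  fix i j assume "i < dim_row (1\<^sub>m d :: complex mat)" "j < dim_col (1\<^sub>m d :: complex mat)"
  then have ij: "i < d" "j < d"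
    by auto
  have t: "0 \<le> t0" "t0 \<le> t0"
    using t0_pos by auto
  define \<rho> where "\<rho> = R - t0"
  have \<rho>: "0 < \<rho>" "\<alpha> < \<rho>"
    using \<alpha>_pos \<alpha>_less by (auto simp: \<rho>_def)
  define S where "S w = mat_inv (1\<^sub>m d - w \<cdot>\<^sub>m A)" for w
  have car: "1\<^sub>m d - w \<cdot>\<^sub>m A \<in> carrier_mat d d" for w
    using A by (intro minus_carrier_mat smult_carrier_mat)
  have det: "det (1\<^sub>m d - w \<cdot>\<^sub>m A) \<noteq> 0" if "w \<in> ball 0 (1 / \<alpha>)" for w
    using that by (intro det_one_minus_nonzero[OF A \<alpha>_pos _ upper]) auto
  have holS: "(\<lambda>w. S w $$ (i, j)) holomorphic_on ball 0 (1 / \<alpha>)"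
    unfolding S_def
  proof (rule holomorphic_on_inverse_mat[OF car _ det ij])
    fix i j assume "i < d" "j < d"
    then show "(\<lambda>w. (1\<^sub>m d - w \<cdot>\<^sub>m A) $$ (i, j)) holomorphic_on ball 0 (1 / \<alpha>)"
      using A by (auto intro!: holomorphic_intros)
  qed
  have sub: "cball (0::complex) (1 / \<rho>) \<subseteq> ball 0 (1 / \<alpha>)"
  proof -
    have "1 / \<rho> < 1 / \<alpha>"
      using \<rho> \<alpha>_pos by (simp add: frac_less2)
    then show ?thesis
      by (simp add: cball_subset_ball_iff)
  qed
  have contS: "continuous_on (sphere 0 (1 / \<rho>)) (\<lambda>w. S w $$ (i, j))"
    by (rule continuous_on_subset[OF holomorphic_on_imp_continuous_on[OF holS]])
      (use sub sphere_cball in blast)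
  have "mean t0 0 (\<lambda>\<xi>. Res \<xi> $$ (i, j) * (\<xi> - cc 0)) = circ_mean 0 \<rho> (\<lambda>\<xi>. S (1 / \<xi>) $$ (i, j))"
    unfolding cc_rho_simps \<rho>_def[symmetric]
  proof (rule circ_mean_cong)
    fix \<xi> :: complex assume \<xi>: "\<xi> \<in> sphere 0 \<rho>"
    then have n0: "\<xi> \<noteq> 0" and "\<xi> \<notin> spectrum A"
      using \<rho> spectrum_norm_le[of \<xi>] by auto
    note Ri = Res_inverse[OF this(2)]
    have "1 / \<xi> \<in> ball 0 (1 / \<alpha>)"
      using \<xi> \<rho> \<alpha>_pos by (simp add: norm_divide frac_less2)
    note Si = mat_inv_inverts[OF car det[OF this], folded S_def]
    have eq: "\<xi> \<cdot>\<^sub>m 1\<^sub>m d - A = \<xi> \<cdot>\<^sub>m (1\<^sub>m d - (1 / \<xi>) \<cdot>\<^sub>m A)"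
      using A n0 by (intro eq_matI) (auto simp: algebra_simps)
    have "S (1 / \<xi>) = S (1 / \<xi>) * ((\<xi> \<cdot>\<^sub>m 1\<^sub>m d - A) * Res \<xi>)"
      unfolding Ri by (rule right_mult_one_mat[OF Si(3), symmetric])
    also have "... = S (1 / \<xi>) * (\<xi> \<cdot>\<^sub>m 1\<^sub>m d - A) * Res \<xi>"
      by (rule assoc_mult_mat[symmetric, OF Si(3) pencil_carrier Ri(3)])
    also have "S (1 / \<xi>) * (\<xi> \<cdot>\<^sub>m 1\<^sub>m d - A) = \<xi> \<cdot>\<^sub>m 1\<^sub>m d"
      unfolding eq mult_smult_distrib[OF Si(3) car] Si ..
    also have "\<xi> \<cdot>\<^sub>m 1\<^sub>m d * Res \<xi> = \<xi> \<cdot>\<^sub>m Res \<xi>"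
      using Ri(3) by (simp add: mult_smult_assoc_mat[of _ d d])
    finally show "Res \<xi> $$ (i, j) * (\<xi> - 0) = S (1 / \<xi>) $$ (i, j)"
      using Ri(3) ij by simp
  qed (use \<rho> in simp)
  also have "... = circ_mean 0 (1 / \<rho>) (\<lambda>w. S w $$ (i, j))"
    using \<rho> by (intro circ_mean_inversion contS)
  also have "... = S 0 $$ (i, j)"
    using \<rho> by (intro circ_mean_centre holomorphic_on_subset[OF holS sub]) auto
  also have "S 0 = 1\<^sub>m d"
  proof -
    have "1\<^sub>m d - 0 \<cdot>\<^sub>m A = 1\<^sub>m d"
      using A by (intro eq_matI) auto
    moreover have "(1\<^sub>m d - 0 \<cdot>\<^sub>m A) * S 0 = 1\<^sub>m d" "S 0 \<in> carrier_mat d d"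
      using mat_inv_inverts[OF car det[of 0]] \<alpha>_pos by (auto simp: S_def)
    ultimately show ?thesis
      by simp
  qed
  finally have outer: "mean t0 0 (\<lambda>\<xi>. Res \<xi> $$ (i, j) * (\<xi> - cc 0)) = 1\<^sub>m d $$ (i, j)" .
  have inner: "mean t0 k (\<lambda>\<xi>. Res \<xi> $$ (i, j) * (\<xi> - cc k)) = 0" if k: "k \<in> {1..n}" for k
  proof -
    have "(\<lambda>\<xi>. Res \<xi> $$ (i, j)) holomorphic_on ball (c k) (\<beta> k)"
      using spectrum_dist_ge[OF _ k]
      by (intro holomorphic_on_subset[OF holomorphic_Res[OF ij]]) (force simp: dist_norm norm_minus_commute)
    then have "((\<lambda>\<xi>. Res \<xi> $$ (i, j)) has_contour_integral 0) (circlepath (c k) (r k + t0))"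
      by (rule Cauchy_theorem_convex_simple) (use \<beta>_greater[OF k] r_pos[OF k] t0_pos in auto)
    then show ?thesis
      unfolding circ_mean_eq_contour_integral using cc_rho_pos[OF k]
      by (simp add: contour_integral_unique)
  qed
  show "\<Phi> (\<lambda>_. 1) $$ (i, j) = 1\<^sub>m d $$ (i, j)"
    using ij outer inner unfolding \<Phi>_def
    by (simp add: mint_index cyc_def sum_sg del: index_one_mat cc_rho_simps)
qed auto

section \<open>Multiplicativity of the calculus\<close>

lemma \<Phi>_cong: "(\<And>z. z \<in> bdry t0 \<Longrightarrow> f z = g z) \<Longrightarrow> \<Phi> f = \<Phi> g"
  unfolding \<Phi>_def mint_def using t0_pos by (intro cong_mat refl) (auto intro!: cyc_cong)

text \<open>Multiply by \<xi> - A and write it as (\<xi> - z) + (z - A) under the integral. The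
  first summand cancels the denominator and gives \<open>\<Phi> f\<close>; the second cancels the
  resolvent and leaves the scalar integral of a holomorphic function, which vanishes.\<close>

lemma \<Phi>_cauchy_kernel:
  assumes t: "0 \<le> t" "t < t0" and f: "f holomorphic_on dom t" and \<xi>: "\<xi> \<in> bdry t"
  shows "\<Phi> (\<lambda>z. f z / (\<xi> - z)) = Res \<xi> * \<Phi> f"
proof -
  define g where "g z = f z / (\<xi> - z)" for z
  have hg: "g holomorphic_on dom t"
    unfolding g_def using \<xi> dom_bdry_neq by (intro holomorphic_intros f) fastforce
  have \<xi>A: "\<xi> \<notin> spectrum A"
    using \<xi> bdry_Int_spectrum[of t] t by auto
  note Ri = Res_inverse[OF \<xi>A]
  have cont: "continuous_on (bdry t0) g" "continuous_on (bdry t0) f"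
    using continuous_on_bdry[OF hg] continuous_on_bdry[OF f] t by auto
  let ?P = "\<xi> \<cdot>\<^sub>m 1\<^sub>m d - A"
  have "?P * \<Phi> g = \<Phi> f"
  proof (rule eq_matI)
    fix i j assume "i < dim_row (\<Phi> f)" "j < dim_col (\<Phi> f)"
    then have ij: "i < d" "j < d"
      by auto
    have "(?P * \<Phi> g) $$ (i, j) = (\<Sum>k<d. ?P $$ (i, k) * cyc t0 (\<lambda>z. g z * Res z $$ (k, j)))"
      using ij A by (auto simp: times_mat_def scalar_prod_def lessThan_atLeast0 \<Phi>_def mint_index intro!: sum.cong)
    also have "... = cyc t0 (\<lambda>z. \<Sum>k<d. ?P $$ (i, k) * (g z * Res z $$ (k, j)))"
      unfolding cyc_mult_right[symmetric] using ij t
      by (intro cyc_sum[symmetric] continuous_intros cont continuous_on_Res) auto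
    also have "... = cyc t0 (\<lambda>z. f z * Res z $$ (i, j) + 1\<^sub>m d $$ (i, j) * g z)"
    proof (rule cyc_cong)
      fix z assume z: "z \<in> bdry t0"
      then have zA: "z \<notin> spectrum A" and "z \<in> dom t"
        using bdry_Int_spectrum[of t0] bdry_subset_dom[of t t0] t by auto
      then have neq: "\<xi> - z \<noteq> 0"
        using dom_bdry_neq[OF _ \<xi>] by auto
      note Rz = Res_inverse[OF zA]
      have "?P = (\<xi> - z) \<cdot>\<^sub>m 1\<^sub>m d + (z \<cdot>\<^sub>m 1\<^sub>m d - A)"
        using A by (intro eq_matI) (auto simp: algebra_simps)
      then have "?P * Res z = (\<xi> - z) \<cdot>\<^sub>m Res z + 1\<^sub>m d"
        using Rz add_mult_distrib_mat[of "(\<xi> - z) \<cdot>\<^sub>m 1\<^sub>m d" d d "z \<cdot>\<^sub>m 1\<^sub>m d - A" "Res z" d] pencil_carrier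
        by (simp add: mult_smult_assoc_mat[of _ d d])
      then have "(?P * Res z) $$ (i, j) = (\<xi> - z) * Res z $$ (i, j) + 1\<^sub>m d $$ (i, j)"
        using ij Rz(3) by simp
      moreover have "(?P * Res z) $$ (i, j) = (\<Sum>k<d. ?P $$ (i, k) * Res z $$ (k, j))"
        using ij A Rz(3) by (auto simp: times_mat_def scalar_prod_def lessThan_atLeast0 intro!: sum.cong)
      moreover have "(\<Sum>k<d. ?P $$ (i, k) * (g z * Res z $$ (k, j))) =
          g z * (\<Sum>k<d. ?P $$ (i, k) * Res z $$ (k, j))"
        by (simp add: sum_distrib_left mult.left_commute)
      ultimately have sum: "(\<Sum>k<d. ?P $$ (i, k) * (g z * Res z $$ (k, j))) =
          g z * ((\<xi> - z) * Res z $$ (i, j) + 1\<^sub>m d $$ (i, j))"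
        by (simp only:)
      then show "(\<Sum>k<d. ?P $$ (i, k) * (g z * Res z $$ (k, j))) =
          f z * Res z $$ (i, j) + 1\<^sub>m d $$ (i, j) * g z"
      proof -
        have fz: "f z = g z * (\<xi> - z)"
          using neq by (simp add: g_def)
        show ?thesis
          unfolding sum fz by (simp add: algebra_simps)
      qed
    qed (use t in auto)
    also have "... = cyc t0 (\<lambda>z. f z * Res z $$ (i, j)) + 1\<^sub>m d $$ (i, j) * cyc t0 g"
      unfolding cyc_mult_right[symmetric] using ij t
      by (intro cyc_add continuous_intros cont continuous_on_Res) auto
    also have "cyc t0 g = 0"
      using cyc_zero[OF t(1,2) _ hg] by simp
    finally show "(?P * \<Phi> g) $$ (i, j) = \<Phi> f $$ (i, j)"
      using ij by (simp add: \<Phi>_def mint_index)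
  qed (use A in auto)
  then have "Res \<xi> * \<Phi> f = Res \<xi> * (?P * \<Phi> g)"
    by simp
  also have "... = Res \<xi> * ?P * \<Phi> g"
    by (rule assoc_mult_mat[symmetric, OF Ri(3) pencil_carrier \<Phi>_carrier(1)])
  finally show ?thesis
    using Ri by (simp add: g_def[abs_def])
qed

text \<open>Fubini together with \<open>\<Phi>_cauchy_kernel\<close>. A holomorphic density
  \<open>w\<close> yields multiplicativity; the conjugate of a holomorphic function as density
  identifies the matrix belonging to the conjugate transform.\<close>

lemma \<Phi>_cauchy_integral_mult:
  assumes t: "0 \<le> t" "t < t0" and f: "f holomorphic_on dom t" and w: "continuous_on (bdry t) w"
  shows "\<Phi> (\<lambda>z. cyc t (\<lambda>\<xi>. w \<xi> / (\<xi> - z)) * f z) = mint t w * \<Phi> f"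
proof (rule eq_matI)
  fix i j assume "i < dim_row (mint t w * \<Phi> f)" "j < dim_col (mint t w * \<Phi> f)"
  then have ij: "i < d" "j < d"
    by auto
  have t': "0 \<le> t0" "t0 \<le> t0" "t \<le> t0"
    using t by auto
  have cf: "continuous_on (bdry t0) f"
    using continuous_on_bdry[OF f] t by auto
  let ?H = "\<lambda>\<xi> z. f z * Res z $$ (i, j) * (w \<xi> / (\<xi> - z))"
  have H: "continuous_on (bdry t \<times> bdry t0) (\<lambda>(\<xi>, z). ?H \<xi> z)"
    unfolding case_prod_beta
    by (intro continuous_intros continuous_on_compose2[OF cf] continuous_on_compose2[OF w]
        continuous_on_compose2[OF continuous_on_Res[OF ij t'(2)]])
      (use bdry_subset_dom[of t t0] dom_bdry_neq t in fastforce)+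
  have "\<Phi> (\<lambda>z. cyc t (\<lambda>\<xi>. w \<xi> / (\<xi> - z)) * f z) $$ (i, j) = cyc t0 (\<lambda>z. cyc t (\<lambda>\<xi>. ?H \<xi> z))"
    unfolding \<Phi>_def mint_index[OF ij] cyc_mult_right by (simp add: mult_ac)
  also have "... = cyc t (\<lambda>\<xi>. cyc t0 (?H \<xi>))"
    by (rule cyc_swap[symmetric, OF t(1) t'(3,1,2) H])
  also have "... = cyc t (\<lambda>\<xi>. \<Sum>k<d. \<Phi> f $$ (k, j) * (w \<xi> * Res \<xi> $$ (i, k)))"
  proof (rule cyc_cong[OF _ t(1) t'(3)])
    fix \<xi> assume \<xi>: "\<xi> \<in> bdry t"
    have "cyc t0 (?H \<xi>) = w \<xi> * \<Phi> (\<lambda>z. f z / (\<xi> - z)) $$ (i, j)"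
      unfolding \<Phi>_def mint_index[OF ij] cyc_mult_right[symmetric] by (simp add: mult_ac)
    also have "... = w \<xi> * (Res \<xi> * \<Phi> f) $$ (i, j)"
      unfolding \<Phi>_cauchy_kernel[OF t f \<xi>] ..
    also have "(Res \<xi> * \<Phi> f) $$ (i, j) = (\<Sum>k<d. Res \<xi> $$ (i, k) * \<Phi> f $$ (k, j))"
      using ij Res_carrier[OF \<xi> t'(3)]
      by (auto simp: times_mat_def scalar_prod_def lessThan_atLeast0 intro!: sum.cong)
    finally show "cyc t0 (?H \<xi>) = (\<Sum>k<d. \<Phi> f $$ (k, j) * (w \<xi> * Res \<xi> $$ (i, k)))"
      by (simp add: sum_distrib_left mult_ac)
  qed
  also have "... = (\<Sum>k<d. \<Phi> f $$ (k, j) * cyc t (\<lambda>\<xi>. w \<xi> * Res \<xi> $$ (i, k)))"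
    unfolding cyc_mult_right[symmetric] using ij t t'
    by (intro cyc_sum continuous_intros w continuous_on_Res) auto
  also have "... = (mint t w * \<Phi> f) $$ (i, j)"
    using ij by (auto simp: times_mat_def scalar_prod_def lessThan_atLeast0 mint_index mult.commute intro!: sum.cong)
  finally show "\<Phi> (\<lambda>z. cyc t (\<lambda>\<xi>. w \<xi> / (\<xi> - z)) * f z) $$ (i, j) = (mint t w * \<Phi> f) $$ (i, j)" .
qed auto

lemma \<Phi>_cauchy_integral:
  assumes t: "0 \<le> t" "t < t0" and w: "continuous_on (bdry t) w"
  shows "\<Phi> (\<lambda>z. cyc t (\<lambda>\<xi>. w \<xi> / (\<xi> - z))) = mint t w"
  using \<Phi>_cauchy_integral_mult[OF t _ w, of "\<lambda>_. 1"] by (simp add: \<Phi>_one)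

lemma \<Phi>_mult:
  assumes s: "0 \<le> s" "s < t0" and f: "f holomorphic_on dom s" and g: "g holomorphic_on dom s"
  shows "\<Phi> (\<lambda>z. f z * g z) = \<Phi> f * \<Phi> g"
proof -
  \<comment> \<open>An intermediate level: the Cauchy formula for \<open>f\<close> over
    \<open>bdry t\<close> is valid on \<open>bdry t0\<close>, where the calculus integrates.\<close>
  define t where "t = (s + t0) / 2"
  have t: "0 \<le> t" "s < t" "t < t0" "t \<le> t0"
    using s by (auto simp: t_def)
  have sub: "dom t \<subseteq> dom s" "bdry t0 \<subseteq> dom t"
    using dom_antimono[of s t] bdry_subset_dom[of t t0] t by auto
  have "\<Phi> (\<lambda>z. f z * g z) = \<Phi> (\<lambda>z. cyc t (\<lambda>\<xi>. f \<xi> / (\<xi> - z)) * g z)"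
    by (intro \<Phi>_cong) (use cyc_cauchy_formula[OF s(1) t(2,4) f] sub in auto)
  also have "... = mint t f * \<Phi> g"
    using t by (intro \<Phi>_cauchy_integral_mult holomorphic_on_subset[OF g sub(1)]
        continuous_on_bdry[OF f s(1) t(2,4)]) auto
  also have "mint t f = \<Phi> f"
    using \<Phi>_eq_mint[OF s(1) t(2,4) f] by simp
  finally show ?thesis .
qed

lemma form_\<Phi>:
  assumes "continuous_on (bdry t0) w" "x \<in> carrier_vec d" "y \<in> carrier_vec d"
  shows "(\<Phi> w *\<^sub>v x) \<bullet>c y = cyc t0 (\<lambda>\<xi>. w \<xi> * ((Res \<xi> *\<^sub>v x) \<bullet>c y))"
  unfolding \<Phi>_def using t0_pos by (intro form_mint assms) auto

lemma continuous_on_Res_form: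
  assumes "x \<in> carrier_vec d" "y \<in> carrier_vec d" "t \<le> t0"
  shows "continuous_on (bdry t) (\<lambda>\<xi>. (Res \<xi> *\<^sub>v x) \<bullet>c y)"
proof -
  have "continuous_on (bdry t)
      (\<lambda>\<xi>. \<Sum>i<d. \<Sum>j<d. Res \<xi> $$ (i, j) * (vec_index x j * cnj (vec_index y i)))"
    by (intro continuous_intros continuous_on_Res assms(3)) auto
  then show ?thesis
    by (rule continuous_on_eq) (simp add: form_expand[OF Res_carrier assms(1,2)] assms(3))
qed

text \<open>Covers both the first order Moebius perturbation of \<open>f\<close>, with
  \<open>g\<close> its square, and the subtraction of a constant, with \<open>b = 0\<close>.\<close>

lemma form_\<Phi>_lincomb:
  assumes c: "continuous_on (bdry t0) f" "continuous_on (bdry t0) g"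
    and xy: "x \<in> carrier_vec d" "y \<in> carrier_vec d"
  shows "(\<Phi> (\<lambda>z. f z - a + b * g z) *\<^sub>v x) \<bullet>c y =
    (\<Phi> f *\<^sub>v x) \<bullet>c y - a * (x \<bullet>c y) + b * ((\<Phi> g *\<^sub>v x) \<bullet>c y)"
proof -
  let ?q = "\<lambda>\<xi>. (Res \<xi> *\<^sub>v x) \<bullet>c y"
  have q: "continuous_on (bdry t0) ?q"
    by (rule continuous_on_Res_form[OF xy]) simp
  have "cyc t0 (\<lambda>\<xi>. (f \<xi> - a + b * g \<xi>) * ?q \<xi>) =
      cyc t0 (\<lambda>\<xi>. (f \<xi> * ?q \<xi> - a * (1 * ?q \<xi>)) + b * (g \<xi> * ?q \<xi>))"
    by (simp add: algebra_simps)
  also have "... = cyc t0 (\<lambda>\<xi>. f \<xi> * ?q \<xi> - a * (1 * ?q \<xi>)) + cyc t0 (\<lambda>\<xi>. b * (g \<xi> * ?q \<xi>))"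
    using t0_pos by (intro cyc_add continuous_intros c q) auto
  also have "cyc t0 (\<lambda>\<xi>. f \<xi> * ?q \<xi> - a * (1 * ?q \<xi>)) =
      cyc t0 (\<lambda>\<xi>. f \<xi> * ?q \<xi>) - cyc t0 (\<lambda>\<xi>. a * (1 * ?q \<xi>))"
    using t0_pos by (intro cyc_diff continuous_intros c q) auto
  finally have "(\<Phi> (\<lambda>z. f z - a + b * g z) *\<^sub>v x) \<bullet>c y =
      (\<Phi> f *\<^sub>v x) \<bullet>c y - a * ((\<Phi> (\<lambda>_. 1) *\<^sub>v x) \<bullet>c y) + b * ((\<Phi> g *\<^sub>v x) \<bullet>c y)"
    using form_\<Phi>[OF _ xy, of f] form_\<Phi>[OF _ xy, of g] form_\<Phi>[OF _ xy, of "\<lambda>_. 1"] c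
      form_\<Phi>[OF _ xy, of "\<lambda>z. f z - a + b * g z"]
    by (simp add: cyc_mult_right continuous_intros)
  then show ?thesis
    using xy by (simp add: \<Phi>_one)
qed

end

section \<open>Positivity of the boundary kernels\<close>

lemma vec_norm2_diff_square:
  assumes "a \<in> carrier_vec d" "b \<in> carrier_vec d"
  shows "(vec_norm2 (a - b))\<^sup>2 = (vec_norm2 a)\<^sup>2 - 2 * Re (a \<bullet>c b) + (vec_norm2 b)\<^sup>2"
proof -
  have *: "(vec_norm2 v)\<^sup>2 = (\<Sum>i<d. (cmod (vec_index v i))\<^sup>2)" if "v \<in> carrier_vec d" for v
    using vec_norm2_eq[OF that] by (simp add: L2_set_def sum_nonneg)
  have "(cmod (x - y))\<^sup>2 = (cmod x)\<^sup>2 - 2 * Re (x * cnj y) + (cmod y)\<^sup>2" for x y :: complex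
    unfolding cmod_power2 by (simp add: power2_eq_square algebra_simps)
  then have "(\<Sum>i<d. (cmod (vec_index (a - b) i))\<^sup>2) = (\<Sum>i<d. (cmod (vec_index a i))\<^sup>2) -
      2 * (\<Sum>i<d. Re (vec_index a i * cnj (vec_index b i))) + (\<Sum>i<d. (cmod (vec_index b i))\<^sup>2)"
    using assms by (simp add: sum.distrib sum_subtractf sum_distrib_left)
  then show ?thesis
    using assms by (simp add: * scalar_prod_conjugate_eq[OF assms])
qed

text \<open>The sesquilinear form of the matrix M plus its adjoint minus k times the identity,
  written without adjoints.\<close>

definition herm_form :: "complex mat \<Rightarrow> real \<Rightarrow> complex Matrix.vec \<Rightarrow> complex Matrix.vec \<Rightarrow> complex" where
  "herm_form M k x y = (M *\<^sub>v x) \<bullet>c y + cnj ((M *\<^sub>v y) \<bullet>c x) - of_real k * (x \<bullet>c y)"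

lemma herm_form_expand:
  assumes "M \<in> carrier_mat d d" "x \<in> carrier_vec d" "y \<in> carrier_vec d"
  shows "herm_form M k x y = (\<Sum>i<d. \<Sum>j<d. (M $$ (i, j) + cnj (M $$ (j, i)) - (if i = j then of_real k else 0)) *
    (vec_index x j * cnj (vec_index y i)))"
proof -
  have "cnj ((M *\<^sub>v y) \<bullet>c x) = (\<Sum>i<d. \<Sum>j<d. cnj (M $$ (j, i)) * (vec_index x j * cnj (vec_index y i)))"
    unfolding form_expand[OF assms(1,3,2)] cnj_sum by (subst sum.swap) (simp add: mult_ac)
  moreover have "of_real k * (x \<bullet>c y) = (\<Sum>i<d. \<Sum>j<d. (if i = j then of_real k else 0) * (vec_index x j * cnj (vec_index y i)))"
    unfolding scalar_prod_conjugate_eq[OF assms(2,3)] sum_distrib_left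
    by (intro sum.cong refl) (simp add: if_distrib[of "\<lambda>a. a * _"] cong: if_cong)
  ultimately show ?thesis
    unfolding herm_form_def form_expand[OF assms]
    by (simp add: algebra_simps sum.distrib sum_subtractf)
qed

lemma herm_form_real:
  assumes "M \<in> carrier_mat d d" "x \<in> carrier_vec d"
  shows "herm_form M k x x = of_real (2 * Re ((M *\<^sub>v x) \<bullet>c x) - k * (vec_norm2 x)\<^sup>2)"
  using assms by (simp add: herm_form_def self_scalar_prod complex_add_cnj)

text \<open>Cauchy-Schwarz for a positive form, with the arithmetic in place of the geometric mean:
  the right side is then linear in the form and can be integrated over the circles.\<close>

lemma herm_form_bound:
  assumes M: "M \<in> carrier_mat d d" and xy: "x \<in> carrier_vec d" "y \<in> carrier_vec d"
    and pos: "\<And>v. v \<in> carrier_vec d \<Longrightarrow> 0 \<le> Re (herm_form M k v v)"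
  shows "cmod (herm_form M k x y) \<le> (Re (herm_form M k x x) + Re (herm_form M k y y)) / 2"
proof -
  define h where "h = herm_form M k x y"
  \<comment> \<open>The unimodular factor that turns both mixed terms of the form at x + \<omega> y
    into \<open>- cmod h\<close>.\<close>
  define \<omega> where "\<omega> = (if h = 0 then 1 else - h / of_real (cmod h))"
  have \<omega>: "cmod \<omega> = 1" and \<omega>h: "cnj \<omega> * h = - of_real (cmod h)"
    by (auto simp: \<omega>_def norm_divide complex_norm_square[symmetric] mult.commute[of "cnj h"] power2_eq_square)
  have car: "x + \<omega> \<cdot>\<^sub>v y \<in> carrier_vec d"
    using xy by simp
  have "herm_form M k (x + \<omega> \<cdot>\<^sub>v y) (x + \<omega> \<cdot>\<^sub>v y) = herm_form M k x x + \<omega> * cnj \<omega> * herm_form M k y y +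
      cnj \<omega> * herm_form M k x y + \<omega> * herm_form M k y x"
    unfolding herm_form_expand[OF M car car] herm_form_expand[OF M xy] herm_form_expand[OF M xy(1) xy(1)]
      herm_form_expand[OF M xy(2) xy(2)] herm_form_expand[OF M xy(2) xy(1)] sum_distrib_left sum.distrib[symmetric]
    using xy by (intro sum.cong refl) (simp add: algebra_simps)
  moreover have "herm_form M k y x = cnj h"
    using scalar_prod_commute_cnj[OF xy] by (simp add: h_def herm_form_def)
  moreover have "\<omega> * cnj \<omega> = 1"
    using \<omega> complex_norm_square[of \<omega>] by simp
  moreover have "\<omega> * cnj h = - of_real (cmod h)"
    using arg_cong[OF \<omega>h, of cnj] by simp
  ultimately have "herm_form M k (x + \<omega> \<cdot>\<^sub>v y) (x + \<omega> \<cdot>\<^sub>v y) =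
      herm_form M k x x + herm_form M k y y - 2 * of_real (cmod h)"
    using \<omega>h by (simp add: h_def)
  then have "0 \<le> Re (herm_form M k x x) + Re (herm_form M k y y) - 2 * cmod h"
    using pos[OF car] by simp
  then show ?thesis
    by (simp add: h_def)
qed

context disk_class_matrix
begin

definition sgr :: "nat \<Rightarrow> real" where "sgr j = (if j = 0 then 1 else - 1)"

lemma sg_eq: "sg j = of_real (sgr j)"
  by (simp add: sg_def sgr_def)

text \<open>The operator version of \<open>poisson\<close>: 1 / (\<xi> - z) is replaced by the
  resolvent of \<open>A\<close>.\<close>

definition pform :: "nat \<Rightarrow> complex Matrix.vec \<Rightarrow> complex Matrix.vec \<Rightarrow> complex \<Rightarrow> complex" where
  "pform j x y \<xi> = herm_form ((sg j * (\<xi> - cc j)) \<cdot>\<^sub>m Res \<xi>) (sgr j) x y"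

lemma pform_eq:
  assumes "\<xi> \<in> bdry t" "t \<le> t0" "x \<in> carrier_vec d" "y \<in> carrier_vec d"
  shows "pform j x y \<xi> = sg j * ((Res \<xi> *\<^sub>v x) \<bullet>c y * (\<xi> - cc j) +
    cnj ((Res \<xi> *\<^sub>v y) \<bullet>c x * (\<xi> - cc j)) - x \<bullet>c y)"
  using Res_carrier[OF assms(1,2)] assms(3,4)
  by (simp add: pform_def herm_form_def sg_eq smult_mat_vec[of _ d d] algebra_simps)

text \<open>For v = Res \<xi> x one has (\<xi> - cc j) v - x = (A - cc j) v. Expanding the squared
  norm shows that the form is \<open>sgr j\<close> times the difference of the squared norms of
  \<open>rho t j\<close> v and (A - cc j) v. Its sign is decided by \<open>upper\<close> for the
  outer circle and by \<open>lower\<close> for the inner ones.\<close>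

lemma pform_nonneg:
  assumes t: "0 \<le> t" "t \<le> t0" and j: "j \<le> n" and \<xi>: "\<xi> \<in> sphere (cc j) (rho t j)" and x: "x \<in> carrier_vec d"
  shows "0 \<le> Re (pform j x x \<xi>)"
proof -
  have b: "\<xi> \<in> bdry t"
    using sphere_subset_bdry[OF j] \<xi> by blast
  have \<xi>A: "\<xi> \<notin> spectrum A"
    using b bdry_Int_spectrum[OF t(2)] by blast
  note Ri = Res_inverse[OF \<xi>A]
  define v where "v = Res \<xi> *\<^sub>v x"
  have v: "v \<in> carrier_vec d"
    using Ri(3) x by (simp add: v_def)
  have Av: "A *\<^sub>v v \<in> carrier_vec d"
    using A v by simp
  have xe: "\<xi> \<cdot>\<^sub>v v - A *\<^sub>v v = x"
    unfolding pencil_mult_vec[OF A v, symmetric]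
    unfolding v_def assoc_mult_mat_vec[symmetric, OF pencil_carrier Ri(3) x] Ri(1) using x by simp
  define u where "u = \<xi> - cc j"
  have "u \<cdot>\<^sub>v v - x = A *\<^sub>v v - cc j \<cdot>\<^sub>v v"
    unfolding xe[symmetric] u_def using v A by (intro eq_vecI) (auto simp: algebra_simps)
  moreover have "(vec_norm2 (u \<cdot>\<^sub>v v - x))\<^sup>2 =
      (vec_norm2 (u \<cdot>\<^sub>v v))\<^sup>2 - 2 * Re ((u \<cdot>\<^sub>v v) \<bullet>c x) + (vec_norm2 x)\<^sup>2"
    using v x by (intro vec_norm2_diff_square) auto
  moreover have "cmod u = rho t j"
    using \<xi> by (simp add: u_def dist_norm norm_minus_commute)
  ultimately have eq: "2 * Re (u * (v \<bullet>c x)) - (vec_norm2 x)\<^sup>2 =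
      (rho t j * vec_norm2 v)\<^sup>2 - (vec_norm2 (A *\<^sub>v v - cc j \<cdot>\<^sub>v v))\<^sup>2"
    using v x by (simp add: vec_norm2_smult)
  have P: "Re (pform j x x \<xi>) = sgr j * ((rho t j * vec_norm2 v)\<^sup>2 - (vec_norm2 (A *\<^sub>v v - cc j \<cdot>\<^sub>v v))\<^sup>2)"
  proof -
    have "pform j x x \<xi> = sg j * (u * (v \<bullet>c x) + cnj (u * (v \<bullet>c x)) - of_real ((vec_norm2 x)\<^sup>2))"
      unfolding pform_eq[OF b t(2) x x] v_def[symmetric] u_def[symmetric] self_scalar_prod[OF x]
      by (simp add: mult.commute)
    then show ?thesis
      unfolding eq[symmetric] sg_eq by simp
  qed
  have rv: "0 \<le> rho t j * vec_norm2 v"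
    using rho_pos[OF t j] vec_norm2_nonneg[of v] by simp
  show ?thesis
  proof (cases "j = 0")
    case True
    have "A *\<^sub>v v - 0 \<cdot>\<^sub>v v = A *\<^sub>v v"
      using v A by (intro eq_vecI) (simp_all del: index_mult_mat_vec)
    moreover have "\<alpha> * vec_norm2 v \<le> (R - t) * vec_norm2 v"
      using \<alpha>_less t by (intro mult_right_mono vec_norm2_nonneg) auto
    then have "(vec_norm2 (A *\<^sub>v v))\<^sup>2 \<le> ((R - t) * vec_norm2 v)\<^sup>2"
      using order_trans[OF upper[OF v]] vec_norm2_nonneg by (intro power_mono) auto
    ultimately show ?thesis
      using True unfolding P by (simp add: sgr_def)
  next
    case False
    then have j': "j \<in> {1..n}"
      using j by simp
    have "rho t j * vec_norm2 v \<le> \<beta> j * vec_norm2 v"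
      using \<beta>_greater[OF j'] cc_rho_pos[OF j'] t by (intro mult_right_mono vec_norm2_nonneg) auto
    then have "(rho t j * vec_norm2 v)\<^sup>2 \<le> (vec_norm2 (A *\<^sub>v v - cc j \<cdot>\<^sub>v v))\<^sup>2"
      using lower[OF j' v] cc_rho_pos[OF j'] rv by (intro power_mono) auto
    then show ?thesis
      using False unfolding P by (simp add: sgr_def)
  qed
qed

lemma continuous_on_pform:
  assumes "x \<in> carrier_vec d" "y \<in> carrier_vec d" "t \<le> t0"
  shows "continuous_on (bdry t) (pform j x y)"
proof -
  have "continuous_on (bdry t) (\<lambda>\<xi>. sg j * ((Res \<xi> *\<^sub>v x) \<bullet>c y * (\<xi> - cc j) +
    cnj ((Res \<xi> *\<^sub>v y) \<bullet>c x * (\<xi> - cc j)) - x \<bullet>c y))"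
    by (intro continuous_intros continuous_on_Res_form assms)
  then show ?thesis
    by (rule continuous_on_eq) (simp add: pform_eq[OF _ assms(3,1,2)])
qed

text \<open>Operator analogue of summing \<open>mean_poisson\<close> over the circles: the two
  resolvent terms add up to boundary integrals, and the shift by \<open>sg j\<close> leaves the
  signed means.\<close>

lemma sum_mean_pform:
  assumes t: "0 \<le> t" "t \<le> t0" and w: "continuous_on (bdry t) w"
    and x: "x \<in> carrier_vec d" and y: "y \<in> carrier_vec d"
  shows "(\<Sum>j\<le>n. mean t j (\<lambda>\<xi>. w \<xi> * pform j x y \<xi>)) =
    (mint t w *\<^sub>v x) \<bullet>c y + cnj ((mint t (\<lambda>\<xi>. cnj (w \<xi>)) *\<^sub>v y) \<bullet>c x)
      - (\<Sum>j\<le>n. sg j * mean t j w) * (x \<bullet>c y)"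
proof -
  let ?q = "\<lambda>\<xi>. (Res \<xi> *\<^sub>v x) \<bullet>c y" and ?p = "\<lambda>\<xi>. (Res \<xi> *\<^sub>v y) \<bullet>c x"
  have m: "mean t j (\<lambda>\<xi>. w \<xi> * pform j x y \<xi>) =
      sg j * mean t j (\<lambda>\<xi>. w \<xi> * ?q \<xi> * (\<xi> - cc j)) +
      cnj (sg j * mean t j (\<lambda>\<xi>. cnj (w \<xi>) * ?p \<xi> * (\<xi> - cc j))) - sg j * mean t j w * (x \<bullet>c y)"
    if j: "j \<le> n" for j
  proof -
    note rp = rho_nonneg[OF t j]
    have q: "continuous_on (sphere (cc j) (rho t j)) ?q" "continuous_on (sphere (cc j) (rho t j)) ?p"
      "continuous_on (sphere (cc j) (rho t j)) w"
      using continuous_on_Res_form[OF x y t(2)] continuous_on_Res_form[OF y x t(2)] w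
      by (auto intro: continuous_on_circle[OF _ j])
    have "mean t j (\<lambda>\<xi>. w \<xi> * pform j x y \<xi>) = mean t j (\<lambda>\<xi>. sg j * (w \<xi> * ?q \<xi> * (\<xi> - cc j) +
        cnj (cnj (w \<xi>) * ?p \<xi> * (\<xi> - cc j)) - (x \<bullet>c y) * w \<xi>))"
    proof (rule circ_mean_cong[OF _ rp])
      fix \<xi> assume "\<xi> \<in> sphere (cc j) (rho t j)"
      then have b: "\<xi> \<in> bdry t"
        using sphere_subset_bdry[OF j] by blast
      show "w \<xi> * pform j x y \<xi> = sg j * (w \<xi> * ?q \<xi> * (\<xi> - cc j) +
        cnj (cnj (w \<xi>) * ?p \<xi> * (\<xi> - cc j)) - (x \<bullet>c y) * w \<xi>)"
        unfolding pform_eq[OF b t(2) x y] by (simp add: algebra_simps)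
    qed
    also have "... = sg j * (mean t j (\<lambda>\<xi>. w \<xi> * ?q \<xi> * (\<xi> - cc j)) +
        mean t j (\<lambda>\<xi>. cnj (cnj (w \<xi>) * ?p \<xi> * (\<xi> - cc j))) - mean t j (\<lambda>\<xi>. (x \<bullet>c y) * w \<xi>))"
    proof -
      have "mean t j (\<lambda>\<xi>. w \<xi> * ?q \<xi> * (\<xi> - cc j) + cnj (cnj (w \<xi>) * ?p \<xi> * (\<xi> - cc j)) - (x \<bullet>c y) * w \<xi>) =
          mean t j (\<lambda>\<xi>. w \<xi> * ?q \<xi> * (\<xi> - cc j) + cnj (cnj (w \<xi>) * ?p \<xi> * (\<xi> - cc j)))
            - mean t j (\<lambda>\<xi>. (x \<bullet>c y) * w \<xi>)"
        by (intro circ_mean_diff continuous_intros q rp)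
      also have "mean t j (\<lambda>\<xi>. w \<xi> * ?q \<xi> * (\<xi> - cc j) + cnj (cnj (w \<xi>) * ?p \<xi> * (\<xi> - cc j))) =
          mean t j (\<lambda>\<xi>. w \<xi> * ?q \<xi> * (\<xi> - cc j)) + mean t j (\<lambda>\<xi>. cnj (cnj (w \<xi>) * ?p \<xi> * (\<xi> - cc j)))"
        by (intro circ_mean_add continuous_intros q rp)
      finally show ?thesis
        by (simp only: circ_mean_mult_right)
    qed
    finally show ?thesis
      unfolding circ_mean_cnj circ_mean_mult_right by (simp add: cnj_sg algebra_simps)
  qed
  have cw: "continuous_on (bdry t) (\<lambda>\<xi>. cnj (w \<xi>))"
    by (intro continuous_intros w)
  show ?thesis
    unfolding form_mint[OF t w x y] form_mint[OF t cw y x] cyc_def cnj_sum sum_distrib_right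
      sum.distrib[symmetric] sum_subtractf[symmetric]
    by (intro sum.cong refl) (use m in auto)
qed

text \<open>With weight 1 both boundary integrals are the identity and the signed count of the
  circles is 1 - n, so 2 - (1 - n) remains.\<close>

lemma sum_mean_pform_self:
  assumes t: "0 < t" "t \<le> t0" and x: "x \<in> carrier_vec d" "vec_norm2 x = 1"
  shows "(\<Sum>j\<le>n. mean t j (\<lambda>\<xi>. Re (pform j x x \<xi>))) = real n + 1"
proof -
  have t': "0 \<le> t"
    using t by simp
  have one: "mint t (\<lambda>_. 1) = 1\<^sub>m d"
    using \<Phi>_one \<Phi>_eq_mint[of 0 t "\<lambda>_. 1"] t by simp
  have xx: "x \<bullet>c x = 1"
    using self_scalar_prod[OF x(1)] x(2) by simp
  have "(\<Sum>j\<le>n. mean t j (\<lambda>\<xi>. 1 * pform j x x \<xi>)) = 2 - (\<Sum>j\<le>n. sg j * 1)"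
    using sum_mean_pform[OF t' t(2) _ x(1) x(1), of "\<lambda>_. 1"] x(1) by (simp add: one xx)
  also have "... = of_real (real n + 1)"
    unfolding sum_sg by simp
  also have "(\<Sum>j\<le>n. mean t j (\<lambda>\<xi>. 1 * pform j x x \<xi>)) =
      (\<Sum>j\<le>n. of_real (mean t j (\<lambda>\<xi>. Re (pform j x x \<xi>))))"
  proof (intro sum.cong refl)
    fix j assume "j \<in> {..n}"
    then have j: "j \<le> n"
      by simp
    note rp = rho_nonneg[OF t' t(2) j]
    have "mean t j (\<lambda>\<xi>. 1 * pform j x x \<xi>) = mean t j (\<lambda>\<xi>. of_real (Re (pform j x x \<xi>)))"
    proof (rule circ_mean_cong[OF _ rp])
      fix \<xi> assume "\<xi> \<in> sphere (cc j) (rho t j)"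
      then have "\<xi> \<in> bdry t"
        using sphere_subset_bdry[OF j] by blast
      then show "1 * pform j x x \<xi> = of_real (Re (pform j x x \<xi>))"
        unfolding pform_def
        using herm_form_real[of "(sg j * (\<xi> - cc j)) \<cdot>\<^sub>m Res \<xi>" d x "sgr j"] Res_carrier[OF _ t(2)] x(1)
        by (metis Re_complex_of_real mult_1 smult_carrier_mat)
    qed
    also have "... = of_real (mean t j (\<lambda>\<xi>. Re (pform j x x \<xi>)))"
      by (intro circ_mean_of_real continuous_on_Re rp continuous_on_circle[OF continuous_on_pform j] x t)
    finally show "mean t j (\<lambda>\<xi>. 1 * pform j x x \<xi>) = of_real (mean t j (\<lambda>\<xi>. Re (pform j x x \<xi>)))" .
  qed
  finally show ?thesis
    by (simp only: of_real_sum[symmetric] of_real_eq_iff)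
qed

text \<open>\<open>herm_form_bound\<close> is integrated against \<open>f\<close>, which is bounded
  by 1. The total masses belonging to the unit vectors \<open>x\<close> and \<open>y\<close> are
  both n + 1, and so is their average.\<close>

theorem conj_pair_bound:
  assumes s: "0 \<le> s" "s < t" "t \<le> t0" and f: "f holomorphic_on dom s"
    and f1: "\<And>z. z \<in> dom s \<Longrightarrow> cmod (f z) \<le> 1"
    and x: "x \<in> carrier_vec d" "vec_norm2 x = 1" and y: "y \<in> carrier_vec d" "vec_norm2 y = 1"
  shows "cmod ((\<Phi> f *\<^sub>v x) \<bullet>c y + cnj ((mint t (\<lambda>\<xi>. cnj (f \<xi>)) *\<^sub>v y) \<bullet>c x)
      - (\<Sum>j\<le>n. sg j * mean t j f) * (x \<bullet>c y)) \<le> real n + 1"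
proof -
  have t: "0 < t" "0 \<le> t"
    using s by auto
  have cf: "continuous_on (bdry t) f"
    by (rule continuous_on_bdry[OF f s])
  let ?b = "\<lambda>j \<xi>. (Re (pform j x x \<xi>) + Re (pform j y y \<xi>)) / 2"
  have "(\<Phi> f *\<^sub>v x) \<bullet>c y + cnj ((mint t (\<lambda>\<xi>. cnj (f \<xi>)) *\<^sub>v y) \<bullet>c x)
      - (\<Sum>j\<le>n. sg j * mean t j f) * (x \<bullet>c y) = (\<Sum>j\<le>n. mean t j (\<lambda>\<xi>. f \<xi> * pform j x y \<xi>))"
    unfolding sum_mean_pform[OF t(2) s(3) cf x(1) y(1)] \<Phi>_eq_mint[OF s f] ..
  also have "cmod ... \<le> (\<Sum>j\<le>n. mean t j (?b j))"
  proof (intro order_trans[OF norm_sum] sum_mono)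
    fix j assume "j \<in> {..n}"
    then have j: "j \<le> n"
      by simp
    show "cmod (mean t j (\<lambda>\<xi>. f \<xi> * pform j x y \<xi>)) \<le> mean t j (?b j)"
    proof (intro norm_circ_mean_le rho_nonneg[OF t(2) s(3) j])
      show "continuous_on (sphere (cc j) (rho t j)) (\<lambda>\<xi>. f \<xi> * pform j x y \<xi>)"
        "continuous_on (sphere (cc j) (rho t j)) (?b j)"
        using continuous_on_circle[OF cf j] continuous_on_circle[OF continuous_on_pform j]
          x(1) y(1) s(3)
        by (auto intro!: continuous_on_mult continuous_on_divide continuous_on_add continuous_on_Re
            continuous_on_const)
      fix \<xi> assume \<xi>: "\<xi> \<in> sphere (cc j) (rho t j)"
      then have b: "\<xi> \<in> bdry t"
        using sphere_subset_bdry[OF j] by blast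
      have "cmod (pform j x y \<xi>) \<le> ?b j \<xi>"
        unfolding pform_def
        using Res_carrier[OF b s(3)] x(1) y(1) pform_nonneg[OF t(2) s(3) j \<xi>, unfolded pform_def]
        by (intro herm_form_bound[of _ d]) auto
      moreover have "cmod (f \<xi>) \<le> 1"
        using f1 bdry_subset_dom[OF s] b by blast
      ultimately have "cmod (f \<xi>) * cmod (pform j x y \<xi>) \<le> 1 * ?b j \<xi>"
        by (intro mult_mono) auto
      then show "cmod (f \<xi> * pform j x y \<xi>) \<le> ?b j \<xi>"
        by (simp only: norm_mult mult_1)
    qed
  qed
  also have "... = ((\<Sum>j\<le>n. mean t j (\<lambda>\<xi>. Re (pform j x x \<xi>))) + (\<Sum>j\<le>n. mean t j (\<lambda>\<xi>. Re (pform j y y \<xi>)))) / 2"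
    unfolding sum.distrib[symmetric] sum_divide_distrib
  proof (intro sum.cong refl)
    fix j assume "j \<in> {..n}"
    then have j: "j \<le> n"
      by simp
    have "mean t j (?b j) = mean t j (\<lambda>\<xi>. 1 / 2 * (Re (pform j x x \<xi>) + Re (pform j y y \<xi>)))"
      by (simp add: circ_mean_def)
    also have "... = 1 / 2 * (mean t j (\<lambda>\<xi>. Re (pform j x x \<xi>)) + mean t j (\<lambda>\<xi>. Re (pform j y y \<xi>)))"
      unfolding circ_mean_mult_right
      by (intro arg_cong2[of _ _ _ _ times] refl circ_mean_add continuous_on_Re
          continuous_on_circle[OF continuous_on_pform j] x y s rho_nonneg[OF t(2) s(3) j])
    finally show "mean t j (?b j) =
        (mean t j (\<lambda>\<xi>. Re (pform j x x \<xi>)) + mean t j (\<lambda>\<xi>. Re (pform j y y \<xi>))) / 2"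
      by simp
  qed
  also have "... = real n + 1"
    unfolding sum_mean_pform_self[OF t(1) s(3) x] sum_mean_pform_self[OF t(1) s(3) y] by simp
  finally show ?thesis .
qed

end

section \<open>Near-extremal functions\<close>

lemma mat_opnorm_nonneg:
  assumes M: "M \<in> carrier_mat d d"
  shows "0 \<le> mat_opnorm M"
proof -
  have "0\<^sub>v d \<in> {v \<in> carrier_vec (dim_col M). vec_norm2 v \<le> 1}"
    using M vec_norm2_zero_iff[of "0\<^sub>v d" d] by simp
  then have "vec_norm2 (M *\<^sub>v 0\<^sub>v d) \<le> mat_opnorm M"
    unfolding mat_opnorm_def by (rule cSUP_upper[OF _ bdd_above_mat_opnorm[OF M]])
  then show ?thesis
    by (rule order_trans[OF vec_norm2_nonneg])
qed

text \<open>Expresses, without the adjoint, that \<open>M\<^sup>* y - \<mu> x\<close> has norm at most \<open>sqrt (K\<^sup>2 - \<mu>\<^sup>2)\<close>.\<close>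

lemma near_singular_vector:
  assumes M: "M \<in> carrier_mat d d" and le: "\<And>v. v \<in> carrier_vec d \<Longrightarrow> vec_norm2 (M *\<^sub>v v) \<le> K * vec_norm2 v"
    and x: "x \<in> carrier_vec d" "vec_norm2 x = 1" and y: "y \<in> carrier_vec d" "vec_norm2 y = 1"
    and Mx: "M *\<^sub>v x = of_real \<mu> \<cdot>\<^sub>v y" and v: "v \<in> carrier_vec d"
  shows "cmod ((M *\<^sub>v v) \<bullet>c y - of_real \<mu> * (v \<bullet>c x)) \<le> sqrt (K\<^sup>2 - \<mu>\<^sup>2) * vec_norm2 v"
proof -
  \<comment> \<open>This vector is the adjoint of \<open>M\<close> applied to
    \<open>y\<close>.\<close>
  define w where "w = Matrix.vec d (\<lambda>j. \<Sum>i<d. cnj (M $$ (i, j)) * vec_index y i)"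
  have w: "w \<in> carrier_vec d"
    by (simp add: w_def)
  have adj: "(M *\<^sub>v u) \<bullet>c y = u \<bullet>c w" if u: "u \<in> carrier_vec d" for u
    unfolding form_expand[OF M u y(1)] scalar_prod_conjugate_eq[OF u w]
    by (subst sum.swap) (auto simp: w_def sum_distrib_left mult_ac intro!: sum.cong)
  have "(vec_norm2 w)\<^sup>2 = cmod ((M *\<^sub>v w) \<bullet>c y)"
    unfolding adj[OF w] self_scalar_prod[OF w] by (simp only: norm_of_real) simp
  also have "... \<le> vec_norm2 (M *\<^sub>v w) * 1"
    using scalar_prod_cauchy_schwarz[of "M *\<^sub>v w" d y] M w y by simp
  also have "... \<le> K * vec_norm2 w"
    using le[OF w] by simp
  finally have "vec_norm2 w * vec_norm2 w \<le> K * vec_norm2 w"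
    by (simp add: power2_eq_square)
  moreover have "0 \<le> K"
    using le[OF x(1)] vec_norm2_nonneg[of "M *\<^sub>v x"] x(2) by simp
  ultimately have wK: "vec_norm2 w \<le> K"
    using vec_norm2_nonneg[of w] by (cases "vec_norm2 w = 0") auto
  have "x \<bullet>c w = of_real \<mu>"
    unfolding adj[OF x(1), symmetric] Mx using y by (simp add: self_scalar_prod)
  then have wx: "Re (w \<bullet>c x) = \<mu>"
    using scalar_prod_commute_cnj[OF x(1) w] by (metis Re_complex_of_real complex_cnj_complex_of_real)
  let ?e = "w - of_real \<mu> \<cdot>\<^sub>v x"
  have e: "?e \<in> carrier_vec d"
    using w x by simp
  have wkx: "w \<bullet>c (of_real \<mu> \<cdot>\<^sub>v x) = of_real \<mu> * (w \<bullet>c x)"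
    using scalar_prod_conjugate_eq[OF w, of "of_real \<mu> \<cdot>\<^sub>v x"] scalar_prod_conjugate_eq[OF w x(1)] x(1)
    by (simp add: sum_distrib_left mult_ac)
  have "(vec_norm2 ?e)\<^sup>2 = (vec_norm2 w)\<^sup>2 - \<mu>\<^sup>2"
    using vec_norm2_diff_square[OF w, of "of_real \<mu> \<cdot>\<^sub>v x"] x wx wkx
    by (simp add: vec_norm2_smult power2_eq_square)
  also have "... \<le> K\<^sup>2 - \<mu>\<^sup>2"
    using wK vec_norm2_nonneg[of w] by (simp add: power_mono)
  finally have eb: "vec_norm2 ?e \<le> sqrt (K\<^sup>2 - \<mu>\<^sup>2)"
    by (rule real_le_rsqrt)
  have "(M *\<^sub>v v) \<bullet>c y - of_real \<mu> * (v \<bullet>c x) = v \<bullet>c ?e"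
    unfolding adj[OF v] scalar_prod_conjugate_eq[OF v w] scalar_prod_conjugate_eq[OF v x(1)]
      scalar_prod_conjugate_eq[OF v e] sum_distrib_left sum_subtractf[symmetric]
    using x(1) w by (intro sum.cong refl) (simp add: algebra_simps)
  also have "cmod ... \<le> vec_norm2 v * vec_norm2 ?e"
    by (rule scalar_prod_cauchy_schwarz[OF v e])
  also have "... \<le> vec_norm2 v * sqrt (K\<^sup>2 - \<mu>\<^sup>2)"
    by (intro mult_left_mono eb vec_norm2_nonneg)
  finally show ?thesis
    by (simp add: mult.commute)
qed

text \<open>To first order in \<open>a\<close>, \<open>w - a + cnj a * w\<^sup>2\<close> is the Moebius map \<open>(w - a) / (1 - cnj a * w)\<close>.\<close>

lemma perturbed_unit_disk:
  fixes w a :: complex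
  assumes "cmod w \<le> 1" "cmod a \<le> 1 / 2"
  shows "cmod (w - a + cnj a * (w * w)) \<le> 1 + 2 * (cmod a)\<^sup>2"
proof -
  obtain \<theta> where w: "w = of_real (cmod w) * cis \<theta>"
    using rcis_cmod_Arg[of w] unfolding rcis_def by metis
  \<comment> \<open>After a rotation \<open>w\<close> becomes the real number \<rho>. The bound 1/2
    on |Re b| makes the change of the real part at most 1 - \<rho>, so the real part stays in
    [-1, 1]; the imaginary part is at most 2 |a| and enters only through its square.\<close>
  define \<rho> b where "\<rho> = cmod w" and "b = a * cnj (cis \<theta>)"
  have \<rho>: "0 \<le> \<rho>" "\<rho> \<le> 1" and b: "cmod b = cmod a"
    using assms by (auto simp: \<rho>_def b_def norm_mult)
  have cc: "cis \<theta> * cnj (cis \<theta>) = 1"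
    using complex_norm_square[of "cis \<theta>"] by simp
  have a: "a = b * cis \<theta>"
    using cc by (simp add: b_def mult.assoc mult.commute)
  have w': "w = of_real \<rho> * cis \<theta>"
    using w unfolding \<rho>_def .
  have "cnj a * (w * w) = cnj b * (of_real \<rho>)\<^sup>2 * cis \<theta> * (cis \<theta> * cnj (cis \<theta>))"
    unfolding w' a by (simp add: power2_eq_square mult_ac del: cis_cnj)
  then have "w - a + cnj a * (w * w) = (of_real \<rho> - b + cnj b * (of_real \<rho>)\<^sup>2) * cis \<theta>"
    unfolding cc unfolding w' a by (simp only: mult_1_right left_diff_distrib distrib_right)
  then have eq: "cmod (w - a + cnj a * (w * w)) = cmod (of_real \<rho> - b + cnj b * (of_real \<rho>)\<^sup>2)"
    by (simp add: norm_mult)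
  let ?z = "of_real \<rho> - b + cnj b * (of_real \<rho>)\<^sup>2"
  have re: "Re ?z = \<rho> - Re b * (1 - \<rho>\<^sup>2)" and im: "Im ?z = - Im b * (1 + \<rho>\<^sup>2)"
    by (simp_all add: power2_eq_square algebra_simps)
  have Reb: "\<bar>Re b\<bar> \<le> 1 / 2" and Imb: "\<bar>Im b\<bar> \<le> cmod a"
    using abs_Re_le_cmod[of b] abs_Im_le_cmod[of b] b assms(2) by auto
  have r2: "0 \<le> 1 - \<rho>\<^sup>2" "1 - \<rho>\<^sup>2 \<le> 2 * (1 - \<rho>)"
  proof -
    show "0 \<le> 1 - \<rho>\<^sup>2"
      using \<rho> by (simp add: power_le_one)
    show "1 - \<rho>\<^sup>2 \<le> 2 * (1 - \<rho>)"
      using zero_le_power2[of "1 - \<rho>"] by (simp add: power2_eq_square algebra_simps)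
  qed
  have "\<bar>Re b * (1 - \<rho>\<^sup>2)\<bar> \<le> 1 / 2 * (2 * (1 - \<rho>))"
    unfolding abs_mult using Reb r2 by (intro mult_mono) auto
  moreover have "\<bar>\<rho> - X\<bar> \<le> 1" if "\<bar>X\<bar> \<le> 1 / 2 * (2 * (1 - \<rho>))" for X :: real
  proof -
    have "\<bar>X\<bar> \<le> 1 - \<rho>"
      using that by simp
    then have "X \<le> 1 - \<rho>" "- X \<le> 1 - \<rho>"
      using abs_ge_self abs_ge_minus_self order_trans by blast+
    then show ?thesis
      using \<rho> by (intro abs_leI) simp_all
  qed
  ultimately have "\<bar>Re ?z\<bar> \<le> 1"
    unfolding re by blast
  then have "(Re ?z)\<^sup>2 \<le> 1"
    by (simp add: abs_square_le_1)
  moreover have "\<bar>Im ?z\<bar> \<le> cmod a * 2"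
    unfolding im abs_mult using Imb \<rho> by (intro mult_mono) (auto simp: power_le_one)
  then have "(Im ?z)\<^sup>2 \<le> (cmod a * 2)\<^sup>2"
    by (metis abs_ge_zero power2_abs power_mono)
  ultimately have "(cmod ?z)\<^sup>2 \<le> 1 + (cmod a * 2)\<^sup>2"
    unfolding cmod_power2 by simp
  also have "... \<le> (1 + 2 * (cmod a)\<^sup>2)\<^sup>2"
    by (simp add: power2_eq_square algebra_simps)
  finally show ?thesis
    unfolding eq by (rule power2_le_imp_le) simp
qed

text \<open>Here \<xi> stands for the modulus of the inner product of \<open>x\<close> and
  \<open>y\<close>. As \<delta> tends to 0, \<mu> tends to K; since \<mu>^2 - 1 tends to a positive
  limit, the first inequality forces \<xi> to 0, and the second one passes to the limit.\<close>

lemma near_extremal_limit: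
  fixes K N C E D :: real
  assumes "1 < K" "0 < D"
    and ex: "\<And>\<delta>. 0 < \<delta> \<Longrightarrow> \<delta> < D \<Longrightarrow> \<exists>\<mu> \<xi>. K - \<delta> \<le> \<mu> \<and> \<mu> \<le> K \<and> 0 \<le> \<xi> \<and>
      (\<mu>\<^sup>2 - 1) * \<xi>\<^sup>2 \<le> sqrt \<delta> + 2 * K * sqrt \<delta> + K * sqrt (K\<^sup>2 - \<mu>\<^sup>2) \<and>
      \<mu> \<le> N + C * \<xi> + (E * K / \<mu>\<^sup>2 + E * K * sqrt (K\<^sup>2 - \<mu>\<^sup>2) / \<mu>)"
  shows "K \<le> N + E / K"
proof -
  \<comment> \<open>The numerator keeps \<delta> below K - 1, so that every \<mu> exceeds 1, and
    below D.\<close>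
  define \<delta> where "\<delta> m = (min D (K - 1) / 2) / real (Suc m)" for m
  have \<delta>0: "\<delta> \<longlonglongrightarrow> 0"
    unfolding \<delta>_def by (rule LIMSEQ_Suc[OF lim_const_over_n])
  have \<delta>: "0 < \<delta> m" "\<delta> m < D" "\<delta> m < K - 1" for m
  proof -
    let ?q = "min D (K - 1)"
    have q: "0 < ?q"
      using assms(1,2) by simp
    then have "?q / 2 / real (Suc m) \<le> ?q / 2 / 1"
      by (intro divide_left_mono) auto
    then have "\<delta> m \<le> ?q / 2"
      unfolding \<delta>_def by (simp only: div_by_1)
    also have "... < ?q"
    proof -
      have "b / 2 < b" if "0 < b" for b :: real
        using that by simp
      then show ?thesis
        using q by blast
    qed
    finally have "\<delta> m < ?q" .
    then show "\<delta> m < D" "\<delta> m < K - 1"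
      by auto
    show "0 < \<delta> m"
      using q by (simp add: \<delta>_def)
  qed
  obtain \<mu> \<xi> where \<mu>: "\<And>m. K - \<delta> m \<le> \<mu> m" "\<And>m. \<mu> m \<le> K" and \<xi>: "\<And>m. 0 \<le> \<xi> m"
    and sm: "\<And>m. ((\<mu> m)\<^sup>2 - 1) * (\<xi> m)\<^sup>2 \<le>
      sqrt (\<delta> m) + 2 * K * sqrt (\<delta> m) + K * sqrt (K\<^sup>2 - (\<mu> m)\<^sup>2)"
    and le: "\<And>m. \<mu> m \<le> N + C * \<xi> m + (E * K / (\<mu> m)\<^sup>2 + E * K * sqrt (K\<^sup>2 - (\<mu> m)\<^sup>2) / \<mu> m)"
    using ex[OF \<delta>(1,2)] by metis
  have \<mu>K: "\<mu> \<longlonglongrightarrow> K"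
  proof (rule tendsto_sandwich[of "\<lambda>m. K - \<delta> m" _ _ "\<lambda>_. K"])
    show "(\<lambda>m. K - \<delta> m) \<longlonglongrightarrow> K"
      using tendsto_diff[OF tendsto_const \<delta>0] by simp
  qed (use \<mu> in auto)
  have \<eta>: "(\<lambda>m. sqrt (K\<^sup>2 - (\<mu> m)\<^sup>2)) \<longlonglongrightarrow> 0"
    using tendsto_real_sqrt[OF tendsto_diff[OF tendsto_const[of "K\<^sup>2"] tendsto_power[OF \<mu>K]], of 2] by simp
  have s\<delta>: "(\<lambda>m. sqrt (\<delta> m)) \<longlonglongrightarrow> 0"
    using tendsto_real_sqrt[OF \<delta>0] by simp
  have k1: "1 < \<mu> m" for m
    using \<mu>(1)[of m] \<delta>(3)[of m] by linarith
  then have k2: "0 < (\<mu> m)\<^sup>2 - 1" for m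
    by (simp add: one_less_power)
  have K1: "K\<^sup>2 - 1 \<noteq> 0"
    using one_less_power[OF assms(1), of 2] by simp
  have "(\<lambda>m. (\<xi> m)\<^sup>2) \<longlonglongrightarrow> 0"
  proof (rule tendsto_sandwich[of "\<lambda>_. 0" _ _
        "\<lambda>m. (sqrt (\<delta> m) + 2 * K * sqrt (\<delta> m) + K * sqrt (K\<^sup>2 - (\<mu> m)\<^sup>2)) / ((\<mu> m)\<^sup>2 - 1)"])
    have "(\<xi> m)\<^sup>2 \<le> (sqrt (\<delta> m) + 2 * K * sqrt (\<delta> m) + K * sqrt (K\<^sup>2 - (\<mu> m)\<^sup>2)) / ((\<mu> m)\<^sup>2 - 1)" for m
      using sm[of m] k2[of m] by (simp add: pos_le_divide_eq mult.commute)
    then show "\<forall>\<^sub>F m in sequentially. (\<xi> m)\<^sup>2 \<le>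
        (sqrt (\<delta> m) + 2 * K * sqrt (\<delta> m) + K * sqrt (K\<^sup>2 - (\<mu> m)\<^sup>2)) / ((\<mu> m)\<^sup>2 - 1)"
      by simp
    have "(\<lambda>m. (sqrt (\<delta> m) + 2 * K * sqrt (\<delta> m) + K * sqrt (K\<^sup>2 - (\<mu> m)\<^sup>2)) / ((\<mu> m)\<^sup>2 - 1))
        \<longlonglongrightarrow> (0 + 2 * K * 0 + K * 0) / (K\<^sup>2 - 1)"
      by (intro tendsto_intros s\<delta> \<eta> \<mu>K K1)
    then show "(\<lambda>m. (sqrt (\<delta> m) + 2 * K * sqrt (\<delta> m) + K * sqrt (K\<^sup>2 - (\<mu> m)\<^sup>2)) / ((\<mu> m)\<^sup>2 - 1)) \<longlonglongrightarrow> 0"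
      by simp
  qed auto
  then have \<xi>0: "\<xi> \<longlonglongrightarrow> 0"
    using tendsto_real_sqrt[of "\<lambda>m. (\<xi> m)\<^sup>2" 0] \<xi> by simp
  have "(\<lambda>m. N + C * \<xi> m + (E * K / (\<mu> m)\<^sup>2 + E * K * sqrt (K\<^sup>2 - (\<mu> m)\<^sup>2) / \<mu> m))
      \<longlonglongrightarrow> N + C * 0 + (E * K / K\<^sup>2 + E * K * 0 / K)"
    using assms(1) by (intro tendsto_intros \<xi>0 \<eta> \<mu>K) auto
  then have "K \<le> N + C * 0 + (E * K / K\<^sup>2 + E * K * 0 / K)"
    by (rule LIMSEQ_le[OF \<mu>K]) (use le in auto)
  then show ?thesis
    using assms(1) by (simp add: power2_eq_square)
qed

section \<open>The extremal problem for a fixed matrix\<close>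

context disk_class_matrix
begin

text \<open>The level \<open>s\<close> is allowed to vary because the product of \<open>f\<close>, its \<open>conj_transform\<close> and \<open>f\<close> is only
  defined on a smaller domain than \<open>f\<close>.\<close>

definition unit_class :: "(complex \<Rightarrow> complex) set" where
  "unit_class = {f. \<exists>s\<ge>0. s < t0 \<and> f holomorphic_on dom s \<and> (\<forall>z\<in>dom s. cmod (f z) \<le> 1)}"

text \<open>\<open>A\<close> is fixed by the locale, so finiteness (\<open>bdd_above_\<Phi>\<close>)
  is available before any bound uniform in the matrix.\<close>

definition K :: real where
  "K = (SUP f\<in>unit_class. mat_opnorm (\<Phi> f))"

lemma unit_class_cases:
  assumes "f \<in> unit_class"
  obtains s where "0 \<le> s" "s < t0" "f holomorphic_on dom s" "\<forall>z\<in>dom s. cmod (f z) \<le> 1"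
  using assms by (auto simp: unit_class_def)

lemma one_in_unit_class: "(\<lambda>_. 1) \<in> unit_class"
  using t0_pos by (auto simp: unit_class_def)

text \<open>All functions are integrated over the same circles, on which the resolvent is continuous
  and every member of the class is bounded by 1.\<close>

lemma bdd_above_\<Phi>: "bdd_above ((\<lambda>f. mat_opnorm (\<Phi> f)) ` unit_class)"
proof (rule bdd_aboveI2)
  have t: "0 \<le> t0" "t0 \<le> t0"
    using t0_pos by auto
  define b where "b i j = (\<Sum>k\<le>n. mean t0 k (\<lambda>\<xi>. cmod (Res \<xi> $$ (i, j) * (\<xi> - cc k))))" for i j
  fix f assume "f \<in> unit_class"
  then obtain s where s: "0 \<le> s" "s < t0" and f: "f holomorphic_on dom s"
    and f1: "\<forall>z\<in>dom s. cmod (f z) \<le> 1"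
    by (rule unit_class_cases)
  have cf: "continuous_on (bdry t0) f"
    using continuous_on_bdry[OF f] s by simp
  have fb: "cmod (f \<xi>) \<le> 1" if "\<xi> \<in> bdry t0" for \<xi>
    using that f1 bdry_subset_dom[of s t0] s by auto
  have entry: "cmod (\<Phi> f $$ (i, j)) \<le> b i j" if ij: "i < d" "j < d" for i j
    unfolding \<Phi>_def mint_index[OF ij] cyc_def b_def
  proof (intro order_trans[OF norm_sum] sum_mono)
    fix k assume "k \<in> {..n}"
    then have k: "k \<le> n"
      by simp
    have "cmod (mean t0 k (\<lambda>\<xi>. f \<xi> * Res \<xi> $$ (i, j) * (\<xi> - cc k))) \<le>
        mean t0 k (\<lambda>\<xi>. cmod (Res \<xi> $$ (i, j) * (\<xi> - cc k)))"
    proof (intro norm_circ_mean_le rho_nonneg[OF t k] continuous_intros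
        continuous_on_circle[OF _ k] cf continuous_on_Res ij t)
      fix \<xi> assume "\<xi> \<in> sphere (cc k) (rho t0 k)"
      then have "cmod (f \<xi>) \<le> 1"
        using sphere_subset_bdry[OF k] fb by blast
      then show "cmod (f \<xi> * Res \<xi> $$ (i, j) * (\<xi> - cc k)) \<le> cmod (Res \<xi> $$ (i, j) * (\<xi> - cc k))"
        by (simp add: norm_mult mult.assoc mult_left_le_one_le)
    qed
    then show "cmod (sg k * mean t0 k (\<lambda>\<xi>. f \<xi> * Res \<xi> $$ (i, j) * (\<xi> - cc k))) \<le>
        mean t0 k (\<lambda>\<xi>. cmod (Res \<xi> $$ (i, j) * (\<xi> - cc k)))"
    proof -
      have "cmod (sg k) = 1"
        by (simp add: sg_def)
      with \<open>cmod (mean t0 k _) \<le> _\<close> show ?thesis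
        unfolding norm_mult[of "sg k"] by simp
    qed
  qed
  show "mat_opnorm (\<Phi> f) \<le> (\<Sum>i<d. \<Sum>j<d. b i j)"
  proof (rule mat_opnorm_le[OF \<Phi>_carrier(1)])
    have "0 \<le> b i j" if "i < d" "j < d" for i j
      using entry[OF that] norm_ge_zero order_trans by blast
    then show "0 \<le> (\<Sum>i<d. \<Sum>j<d. b i j)"
      by (intro sum_nonneg) auto
    fix x y :: "complex Matrix.vec"
    assume "x \<in> carrier_vec d" "y \<in> carrier_vec d" "vec_norm2 x \<le> 1" "vec_norm2 y = 1"
    then have "cmod ((\<Phi> f *\<^sub>v x) \<bullet>c y) \<le> (\<Sum>i<d. \<Sum>j<d. cmod (\<Phi> f $$ (i, j)))"
      by (intro form_le_sum_entries) auto
    also have "... \<le> (\<Sum>i<d. \<Sum>j<d. b i j)"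
      by (intro sum_mono entry) auto
    finally show "cmod ((\<Phi> f *\<^sub>v x) \<bullet>c y) \<le> (\<Sum>i<d. \<Sum>j<d. b i j)" .
  qed
qed

lemma \<Phi>_le_K: "f \<in> unit_class \<Longrightarrow> mat_opnorm (\<Phi> f) \<le> K"
  unfolding K_def by (rule cSUP_upper[OF _ bdd_above_\<Phi>])

lemma K_nonneg: "0 \<le> K"
  using mat_opnorm_nonneg[OF \<Phi>_carrier(1)] \<Phi>_le_K[OF one_in_unit_class] by (rule order_trans)

lemma \<Phi>_bound:
  assumes s: "0 \<le> s" "s < t0" and f: "f holomorphic_on dom s"
    and fB: "\<And>z. z \<in> dom s \<Longrightarrow> cmod (f z) \<le> B" and "0 < B" and v: "v \<in> carrier_vec d"
  shows "vec_norm2 (\<Phi> f *\<^sub>v v) \<le> B * K * vec_norm2 v"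
proof -
  define g where "g z = f z / of_real B" for z
  have "g holomorphic_on dom s"
    unfolding g_def using \<open>0 < B\<close> by (intro holomorphic_intros f) auto
  moreover have "cmod (g z) \<le> 1" if "z \<in> dom s" for z
    using fB[OF that] \<open>0 < B\<close> by (simp add: g_def norm_divide)
  ultimately have g: "g \<in> unit_class"
    using s by (auto simp: unit_class_def)
  have "\<Phi> f = \<Phi> (\<lambda>z. of_real B * g z)"
    using \<open>0 < B\<close> by (simp add: g_def)
  also have "... = of_real B \<cdot>\<^sub>m \<Phi> g"
    by (rule eq_matI) (auto simp: \<Phi>_def mint_index mult.assoc cyc_mult_right)
  finally have "vec_norm2 (\<Phi> f *\<^sub>v v) = B * vec_norm2 (\<Phi> g *\<^sub>v v)"
    using v \<open>0 < B\<close> by (simp add: smult_mat_vec[of _ d d] vec_norm2_smult)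
  also have "... \<le> B * (mat_opnorm (\<Phi> g) * vec_norm2 v)"
    using \<open>0 < B\<close> by (intro mult_left_mono mat_opnorm_bound[OF _ v]) auto
  also have "... \<le> B * (K * vec_norm2 v)"
    using \<open>0 < B\<close> by (intro mult_left_mono mult_right_mono \<Phi>_le_K g vec_norm2_nonneg) auto
  finally show ?thesis
    by (simp add: mult.assoc)
qed

lemma near_extremal:
  assumes "0 < \<delta>" "\<delta> < K"
  obtains f x where "f \<in> unit_class" "x \<in> carrier_vec d" "vec_norm2 x = 1" "K - \<delta> < vec_norm2 (\<Phi> f *\<^sub>v x)"
proof -
  have "K - \<delta> < (SUP f\<in>unit_class. mat_opnorm (\<Phi> f))"
    using assms by (simp add: K_def[symmetric])
  then obtain f where f: "f \<in> unit_class" "K - \<delta> < mat_opnorm (\<Phi> f)"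
    using less_cSUP_iff[OF _ bdd_above_\<Phi>] one_in_unit_class by (metis empty_iff)
  have "0\<^sub>v d \<in> {v \<in> carrier_vec (dim_col (\<Phi> f)). vec_norm2 v \<le> 1}"
    using vec_norm2_zero_iff[of "0\<^sub>v d" d] by simp
  then have "{v \<in> carrier_vec (dim_col (\<Phi> f)). vec_norm2 v \<le> 1} \<noteq> {}"
    by blast
  then obtain v where v: "v \<in> carrier_vec d" "vec_norm2 v \<le> 1" "K - \<delta> < vec_norm2 (\<Phi> f *\<^sub>v v)"
    using f(2) less_cSUP_iff[OF _ bdd_above_mat_opnorm[OF \<Phi>_carrier(1)], of f "K - \<delta>"]
    unfolding mat_opnorm_def by auto
  have v0: "vec_norm2 v \<noteq> 0"
  proof
    assume "vec_norm2 v = 0"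
    then have "vec_norm2 (\<Phi> f *\<^sub>v v) = 0"
      using mat_opnorm_bound[OF \<Phi>_carrier(1) v(1)] vec_norm2_nonneg by (metis mult_zero_right order_antisym)
    then show False
      using v(3) assms by simp
  qed
  define x where "x = of_real (1 / vec_norm2 v) \<cdot>\<^sub>v v"
  have x: "x \<in> carrier_vec d" "vec_norm2 x = 1"
    using v v0 vec_norm2_nonneg[of v] by (simp_all add: x_def vec_norm2_smult norm_divide)
  have "vec_norm2 (\<Phi> f *\<^sub>v x) = vec_norm2 (\<Phi> f *\<^sub>v v) / vec_norm2 v"
    unfolding x_def mult_mat_vec[OF \<Phi>_carrier(1) v(1)] vec_norm2_smult
    using vec_norm2_nonneg[of v] by (simp add: norm_divide)
  also have "... \<ge> vec_norm2 (\<Phi> f *\<^sub>v v)"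
    using v(2) v0 vec_norm2_nonneg[of v] vec_norm2_nonneg[of "\<Phi> f *\<^sub>v v"]
    by (simp add: le_divide_eq mult_left_le)
  finally show ?thesis
    using that[OF f(1) x] v(3) by simp
qed

text \<open>Three estimates for one near-extremal pair: \<open>orth\<close> for the inner product of
  \<open>x\<close> and \<open>y\<close>, \<open>Nyx\<close> for the part coming from the conjugate
  transform, and \<open>main\<close> from \<open>conj_pair_bound\<close>. The result has the shape
  required by \<open>near_extremal_limit\<close>, with \<open>3 * \<epsilon>\<close> for E and n for
  C.\<close>

lemma extremal_step:
  assumes \<epsilon>: "\<And>l. l \<le> n \<Longrightarrow> (\<Sum>j\<in>{..n} - {l}. rel_size l j) \<le> \<epsilon>" and "0 < \<epsilon>"
    and "1 < K" and \<delta>: "0 < \<delta>" "\<delta> < min (K - 1) (1 / 4)"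
  shows "\<exists>\<mu> \<xi>. K - \<delta> \<le> \<mu> \<and> \<mu> \<le> K \<and> 0 \<le> \<xi> \<and>
      (\<mu>\<^sup>2 - 1) * \<xi>\<^sup>2 \<le> sqrt \<delta> + 2 * K * sqrt \<delta> + K * sqrt (K\<^sup>2 - \<mu>\<^sup>2) \<and>
      \<mu> \<le> (real n + 1) + real n * \<xi> + ((3 * \<epsilon>) * K / \<mu>\<^sup>2 + (3 * \<epsilon>) * K * sqrt (K\<^sup>2 - \<mu>\<^sup>2) / \<mu>)"
proof -
  have "\<delta> < K"
    using \<delta> by simp
  obtain f x where "f \<in> unit_class" and x: "x \<in> carrier_vec d" "vec_norm2 x = 1"
    and \<mu>\<delta>: "K - \<delta> < vec_norm2 (\<Phi> f *\<^sub>v x)"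
    using near_extremal[OF \<delta>(1) \<open>\<delta> < K\<close>] by blast
  then obtain s where s: "0 \<le> s" "s < t0" and f: "f holomorphic_on dom s"
    and "\<forall>z\<in>dom s. cmod (f z) \<le> 1"
    by (elim unit_class_cases)
  then have f1: "cmod (f z) \<le> 1" if "z \<in> dom s" for z
    using that by blast
  define M where "M = \<Phi> f"
  define \<mu> where "\<mu> = vec_norm2 (M *\<^sub>v x)"
  define y where "y = of_real (1 / \<mu>) \<cdot>\<^sub>v (M *\<^sub>v x)"
  define \<eta> where "\<eta> = sqrt (K\<^sup>2 - \<mu>\<^sup>2)"
  have M: "M \<in> carrier_mat d d"
    by (simp add: M_def)
  have MK: "vec_norm2 (M *\<^sub>v v) \<le> K * vec_norm2 v" if "v \<in> carrier_vec d" for v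
    using \<Phi>_bound[of s f 1 v] s f f1 that by (simp add: M_def)
  have \<mu>K: "K - \<delta> < \<mu>" "\<mu> \<le> K"
    using \<mu>\<delta> MK[OF x(1)] x(2) by (auto simp: \<mu>_def M_def)
  then have \<mu>1: "1 < \<mu>"
    using \<delta> by simp
  have y: "y \<in> carrier_vec d" "vec_norm2 y = 1"
    using M x \<mu>1 by (auto simp: y_def vec_norm2_smult norm_divide \<mu>_def[symmetric])
  have Mx: "M *\<^sub>v x = of_real \<mu> \<cdot>\<^sub>v y"
    using \<mu>1 by (simp add: y_def smult_smult_assoc)
  have \<eta>0: "0 \<le> \<eta>"
    using \<mu>K \<mu>1 by (simp add: \<eta>_def power_mono)
  have err: "cmod ((M *\<^sub>v v) \<bullet>c y - of_real \<mu> * (v \<bullet>c x)) \<le> \<eta> * vec_norm2 v"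
    if "v \<in> carrier_vec d" for v
    unfolding \<eta>_def by (rule near_singular_vector[OF M MK x y Mx that])
  define \<xi> where "\<xi> = x \<bullet>c y"
  have \<xi>1: "cmod \<xi> \<le> 1"
    using scalar_prod_cauchy_schwarz[OF x(1) y(1)] x y by (simp add: \<xi>_def)
  have yx: "y \<bullet>c x = cnj \<xi>"
    unfolding \<xi>_def using scalar_prod_commute_cnj[OF x(1) y(1)] by simp
  have yy: "y \<bullet>c y = 1"
    using self_scalar_prod[OF y(1)] y(2) by simp
  have Mxy: "(M *\<^sub>v x) \<bullet>c y = of_real \<mu>"
    unfolding Mx using y yy by simp
  have cf: "continuous_on (bdry t0) f"
    using continuous_on_bdry[OF f] s by simp

  have orth: "(\<mu>\<^sup>2 - 1) * (cmod \<xi>)\<^sup>2 \<le> sqrt \<delta> + 2 * K * sqrt \<delta> + K * \<eta>"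
  proof -
    \<comment> \<open>A perturbation of size \<tau> gains
      \<open>\<tau> * ((\<mu>\<^sup>2 - 1) * (cmod \<xi>)\<^sup>2)\<close> to first order, against a
      deficit K - \<mu> of at most \<delta> and a second order loss
      \<open>2 * K * \<tau>\<^sup>2\<close>. With \<tau> = sqrt \<delta> both are still of order
      \<tau> after division by \<tau>.\<close>
    define \<tau> where "\<tau> = sqrt \<delta>"
    have \<tau>: "0 < \<tau>" "\<tau> \<le> 1 / 2" "\<tau> * \<tau> = \<delta>"
    proof -
      have "sqrt \<delta> \<le> 1 / 2"
        by (rule real_le_lsqrt) (use \<delta> in \<open>auto simp: power_divide\<close>)
      then show "0 < \<tau>" "\<tau> \<le> 1 / 2" "\<tau> * \<tau> = \<delta>"
        unfolding \<tau>_def using \<delta> by simp_all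
    qed
    \<comment> \<open>The phase of \<open>a\<close> makes both first order terms real, with total
      \<open>\<tau> * (\<mu>\<^sup>2 - 1) * (cmod \<xi>)\<^sup>2\<close>.\<close>
    define a where "a = of_real \<tau> * cnj \<xi>"
    have ca: "cmod a = \<tau> * cmod \<xi>"
      using \<tau> by (simp add: a_def norm_mult)
    have a2: "cmod a \<le> 1 / 2"
      unfolding ca using mult_mono[OF \<tau>(2) \<xi>1] \<tau> by simp
    have ca2: "(cmod a)\<^sup>2 \<le> \<tau> * \<tau>"
      unfolding ca power2_eq_square using \<tau> \<xi>1 by (intro mult_mono) (auto simp: mult_left_le)
    define h where "h z = f z - a + cnj a * (f z * f z)" for z
    have "h holomorphic_on dom s"
      unfolding h_def by (intro holomorphic_intros f)
    moreover have "cmod (h z) \<le> 1 + 2 * (cmod a)\<^sup>2" if "z \<in> dom s" for z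
      unfolding h_def by (rule perturbed_unit_disk[OF f1[OF that] a2])
    ultimately have "vec_norm2 (\<Phi> h *\<^sub>v x) \<le> (1 + 2 * (cmod a)\<^sup>2) * K * vec_norm2 x"
      by (intro \<Phi>_bound[OF s _ _ _ x(1)]) (auto intro: add_pos_nonneg)
    moreover have "cmod ((\<Phi> h *\<^sub>v x) \<bullet>c y) \<le> vec_norm2 (\<Phi> h *\<^sub>v x) * vec_norm2 y"
      using x y by (intro scalar_prod_cauchy_schwarz[of _ d]) (auto intro: mult_mat_vec_carrier[of _ d d])
    ultimately have "cmod ((\<Phi> h *\<^sub>v x) \<bullet>c y) \<le> (1 + 2 * (cmod a)\<^sup>2) * K"
      using x y by simp
    also have "... \<le> (1 + 2 * (\<tau> * \<tau>)) * K"
      using ca2 \<open>1 < K\<close> by (intro mult_right_mono) auto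
    finally have hK: "cmod ((\<Phi> h *\<^sub>v x) \<bullet>c y) \<le> (1 + 2 * (\<tau> * \<tau>)) * K" .
    define e where "e = (M *\<^sub>v y) \<bullet>c y - of_real \<mu> * cnj \<xi>"
    have e: "cmod e \<le> \<eta>"
      using err[OF y(1)] y(2) by (simp add: e_def yx)
    have "(\<Phi> (\<lambda>z. f z * f z) *\<^sub>v x) \<bullet>c y = (M *\<^sub>v (M *\<^sub>v x)) \<bullet>c y"
      unfolding \<Phi>_mult[OF s f f] M_def[symmetric] using M x by (simp add: assoc_mult_mat_vec[of _ d d])
    also have "... = of_real \<mu> * ((M *\<^sub>v y) \<bullet>c y)"
      unfolding Mx mult_mat_vec[OF M y(1)] using M y by simp
    also have "(M *\<^sub>v y) \<bullet>c y = of_real \<mu> * cnj \<xi> + e"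
      by (simp add: e_def)
    finally have ff: "(\<Phi> (\<lambda>z. f z * f z) *\<^sub>v x) \<bullet>c y = of_real \<mu> * (of_real \<mu> * cnj \<xi> + e)" .
    have "(\<Phi> h *\<^sub>v x) \<bullet>c y = of_real \<mu> - a * \<xi> + cnj a * (of_real \<mu> * (of_real \<mu> * cnj \<xi> + e))"
      unfolding h_def using form_\<Phi>_lincomb[OF cf continuous_on_mult[OF cf cf] x(1) y(1)] ff Mxy
      by (simp add: M_def \<xi>_def)
    also have "... = of_real (\<mu> + \<tau> * ((\<mu>\<^sup>2 - 1) * (cmod \<xi>)\<^sup>2)) + cnj a * of_real \<mu> * e"
    proof -
      have n: "complex_of_real ((cmod \<xi>)\<^sup>2) = \<xi> * cnj \<xi>"
        by (rule complex_norm_square)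
      show ?thesis
        unfolding of_real_add of_real_mult n by (simp add: a_def power2_eq_square algebra_simps)
    qed
    finally have "\<mu> + \<tau> * ((\<mu>\<^sup>2 - 1) * (cmod \<xi>)\<^sup>2) = Re ((\<Phi> h *\<^sub>v x) \<bullet>c y - cnj a * of_real \<mu> * e)"
      by (simp only: add_diff_cancel_right' Re_complex_of_real)
    also have "... \<le> cmod ((\<Phi> h *\<^sub>v x) \<bullet>c y) + cmod (cnj a * of_real \<mu> * e)"
      by (rule order_trans[OF complex_Re_le_cmod norm_triangle_ineq4])
    also have "cmod (cnj a * of_real \<mu> * e) \<le> \<tau> * K * \<eta>"
    proof -
      have "cmod a \<le> \<tau>"
        unfolding ca using \<tau> \<xi>1 by (simp add: mult_left_le)
      then show ?thesis
        unfolding norm_mult using \<mu>K \<mu>1 e \<tau> by (intro mult_mono) auto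
    qed
    also have "cmod ((\<Phi> h *\<^sub>v x) \<bullet>c y) \<le> (1 + 2 * (\<tau> * \<tau>)) * K"
      by (rule hK)
    finally have "\<tau> * ((\<mu>\<^sup>2 - 1) * (cmod \<xi>)\<^sup>2) \<le> (K - \<mu>) + \<tau> * (2 * K * \<tau> + K * \<eta>)"
      by (simp add: algebra_simps)
    also have "K - \<mu> \<le> \<tau> * \<tau>"
      using \<mu>K \<tau> by simp
    finally have "\<tau> * ((\<mu>\<^sup>2 - 1) * (cmod \<xi>)\<^sup>2) \<le> \<tau> * (\<tau> + 2 * K * \<tau> + K * \<eta>)"
      by (simp add: algebra_simps)
    then show ?thesis
      using \<tau> by (simp add: \<tau>_def[symmetric])
  qed

  \<comment> \<open>The conjugate transform over \<open>bdry t\<close> lives only on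
    \<open>dom t\<close>, so its products with \<open>f\<close> are treated at this level, still
    below \<open>t0\<close>.\<close>
  define t where "t = (s + t0) / 2"
  have t: "s < t" "t < t0" "t \<le> t0" "0 \<le> t"
    using s by (auto simp: t_def)
  define k where "k = conj_transform t f"
  have cft: "continuous_on (bdry t) f"
    by (rule continuous_on_bdry[OF f s(1) t(1,3)])
  have hk: "k holomorphic_on dom t"
    unfolding k_def by (rule holomorphic_conj_transform[OF t(4,3) cft])
  have kb: "cmod (k z) \<le> 3 * \<epsilon>" if "z \<in> dom t" for z
    unfolding k_def using \<open>0 < \<epsilon>\<close> by (intro conj_transform_bound[OF s(1) t(1,2) f f1 \<epsilon> _ that]) auto
  have \<epsilon>3: "0 < 3 * \<epsilon>"
    using \<open>0 < \<epsilon>\<close> by simp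
  define N where "N = \<Phi> k"
  have N: "N \<in> carrier_mat d d"
    by (simp add: N_def)
  have ft: "f holomorphic_on dom t"
    using dom_antimono[of s t] t by (intro holomorphic_on_subset[OF f]) auto
  \<comment> \<open>Since M x = \<mu> y and the adjoint of \<open>M\<close> takes \<open>y\<close>
    nearly to \<mu> x, placing \<open>N\<close> between two copies of \<open>M\<close> multiplies
    the form of \<open>N\<close> at y and x by about \<mu>^2, while the bound on the product of the
    functions is no larger than that on \<open>k\<close>.\<close>
  have "\<Phi> (\<lambda>z. f z * (k z * f z)) = M * (N * M)"
    using t by (simp add: \<Phi>_mult[OF t(4,2)] ft hk holomorphic_on_mult M_def N_def)
  moreover have "vec_norm2 (\<Phi> (\<lambda>z. f z * (k z * f z)) *\<^sub>v x) \<le> 3 * \<epsilon> * K * vec_norm2 x"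
  proof (intro \<Phi>_bound[OF t(4,2) _ _ \<epsilon>3 x(1)] holomorphic_intros ft hk)
    fix z assume z: "z \<in> dom t"
    then have "cmod (f z) \<le> 1"
      using f1 dom_antimono[of s t] t by auto
    then have "cmod (f z) * (cmod (k z) * cmod (f z)) \<le> 1 * (3 * \<epsilon> * 1)"
      using kb[OF z] \<epsilon>3 by (intro mult_mono) auto
    then show "cmod (f z * (k z * f z)) \<le> 3 * \<epsilon>"
      by (simp add: norm_mult)
  qed
  moreover have "(M * (N * M)) *\<^sub>v x = of_real \<mu> \<cdot>\<^sub>v (M *\<^sub>v (N *\<^sub>v y))"
  proof -
    have "(M * (N * M)) *\<^sub>v x = M *\<^sub>v (N *\<^sub>v (M *\<^sub>v x))"
      using assoc_mult_mat_vec[OF M mult_carrier_mat[OF N M] x(1)] assoc_mult_mat_vec[OF N M x(1)]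
      by simp
    moreover have "N *\<^sub>v y \<in> carrier_vec d"
      using N y by simp
    ultimately show ?thesis
      unfolding Mx mult_mat_vec[OF N y(1)] by (simp add: mult_mat_vec[OF M])
  qed
  ultimately have "\<mu> * vec_norm2 (M *\<^sub>v (N *\<^sub>v y)) \<le> 3 * \<epsilon> * K"
    using x \<mu>1 by (simp add: vec_norm2_smult)
  then have MN: "vec_norm2 (M *\<^sub>v (N *\<^sub>v y)) \<le> 3 * \<epsilon> * K / \<mu>"
    using \<mu>1 by (simp add: pos_le_divide_eq mult.commute)
  have Ny: "N *\<^sub>v y \<in> carrier_vec d"
    using N y by simp
  have MNy: "M *\<^sub>v (N *\<^sub>v y) \<in> carrier_vec d"
    using M Ny by simp
  have Nb: "vec_norm2 (N *\<^sub>v y) \<le> 3 * \<epsilon> * K"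
    using \<Phi>_bound[OF t(4,2) hk kb \<epsilon>3 y(1)] y(2) by (simp add: N_def)
  have "\<mu> * cmod ((N *\<^sub>v y) \<bullet>c x) \<le> cmod ((M *\<^sub>v (N *\<^sub>v y)) \<bullet>c y) +
      cmod ((M *\<^sub>v (N *\<^sub>v y)) \<bullet>c y - of_real \<mu> * ((N *\<^sub>v y) \<bullet>c x))"
    using norm_triangle_sub[of "of_real \<mu> * ((N *\<^sub>v y) \<bullet>c x)" "(M *\<^sub>v (N *\<^sub>v y)) \<bullet>c y"] \<mu>1
    by (simp add: norm_mult norm_minus_commute)
  also have "cmod ((M *\<^sub>v (N *\<^sub>v y)) \<bullet>c y) \<le> 3 * \<epsilon> * K / \<mu>"
    using scalar_prod_cauchy_schwarz[OF MNy y(1)] MN y(2) by simp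
  also have "cmod ((M *\<^sub>v (N *\<^sub>v y)) \<bullet>c y - of_real \<mu> * ((N *\<^sub>v y) \<bullet>c x)) \<le> \<eta> * (3 * \<epsilon> * K)"
    using err[OF Ny] mult_left_mono[OF Nb \<eta>0] by (rule order_trans)
  finally have Nyx: "cmod ((N *\<^sub>v y) \<bullet>c x) \<le> 3 * \<epsilon> * K / \<mu>\<^sup>2 + 3 * \<epsilon> * K * \<eta> / \<mu>"
    using \<mu>1 by (simp add: field_simps power2_eq_square)

  have main: "\<mu> \<le> (real n + 1) + real n * cmod \<xi> + cmod ((N *\<^sub>v y) \<bullet>c x)"
  proof -
    let ?w = "\<lambda>\<xi>. cnj (f \<xi>)" and ?m = "\<lambda>j. mean t j f"
    have cw: "continuous_on (bdry t) ?w"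
      by (intro continuous_intros cft)
    define g where "g z = cyc t (\<lambda>\<xi>. ?w \<xi> / (\<xi> - z))" for z
    have hg: "g holomorphic_on dom t"
      unfolding g_def by (rule holomorphic_cauchy_integral[OF t(4,3) cw])
    have cg: "continuous_on (bdry t0) g"
      using continuous_on_bdry[OF hg] t by simp
    have mg: "mint t ?w = \<Phi> g"
      unfolding g_def using \<Phi>_cauchy_integral[OF t(4,2) cw] by simp
    \<comment> \<open>The summand with factor 0 gives \<open>k\<close> the shape expected by
      \<open>form_\<Phi>_lincomb\<close>.\<close>
    have "k = (\<lambda>z. g z - cnj (?m 0) + 0 * g z)"
      by (auto simp: k_def g_def conj_transform_def)
    then have Ng: "(N *\<^sub>v y) \<bullet>c x = (\<Phi> g *\<^sub>v y) \<bullet>c x - cnj (?m 0) * cnj \<xi>"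
      unfolding N_def using form_\<Phi>_lincomb[OF cg cg y(1) x(1), of "cnj (?m 0)" 0] yx by simp
    have "cmod (of_real \<mu> + cnj ((\<Phi> g *\<^sub>v y) \<bullet>c x) - (?m 0 - (\<Sum>j\<in>{1..n}. ?m j)) * \<xi>) \<le> real n + 1"
      using conj_pair_bound[OF s(1) t(1,3) f f1 x y] Mxy unfolding mg sum_sg
      by (simp add: M_def \<xi>_def)
    \<comment> \<open>The outer mean cancels against the constant subtracted in \<open>k\<close>;
      only the n inner means remain, each at most 1 in modulus.\<close>
    also have "of_real \<mu> + cnj ((\<Phi> g *\<^sub>v y) \<bullet>c x) - (?m 0 - (\<Sum>j\<in>{1..n}. ?m j)) * \<xi> =
        of_real \<mu> + cnj ((N *\<^sub>v y) \<bullet>c x) + (\<Sum>j\<in>{1..n}. ?m j) * \<xi>"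
      unfolding Ng by (simp add: algebra_simps)
    finally have 1: "cmod (of_real \<mu> + cnj ((N *\<^sub>v y) \<bullet>c x) + (\<Sum>j\<in>{1..n}. ?m j) * \<xi>) \<le> real n + 1" .
    have "cmod (\<Sum>j\<in>{1..n}. ?m j) \<le> (\<Sum>j\<in>{1..n}. 1)"
    proof (intro order_trans[OF norm_sum] sum_mono)
      fix j assume "j \<in> {1..n}"
      then have j: "j \<le> n"
        by simp
      have "cmod (f \<xi>) \<le> 1" if "\<xi> \<in> sphere (cc j) (rho t j)" for \<xi>
        using that sphere_subset_bdry[OF j] bdry_subset_dom[OF s(1) t(1,3)] f1 by blast
      then show "cmod (?m j) \<le> 1"
        by (intro norm_circ_mean_le_const continuous_on_circle[OF cft j]
            rho_nonneg[OF t(4,3) j])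
    qed
    then have 2: "cmod ((\<Sum>j\<in>{1..n}. ?m j) * \<xi>) \<le> real n * cmod \<xi>"
      unfolding norm_mult by (intro mult_right_mono) auto
    have tri: "cmod p \<le> cmod (p + q + w) + cmod w + cmod q" for p q w :: complex
      using norm_triangle_ineq4[of "p + q + w" "q + w"] norm_triangle_ineq[of q w] by simp
    have "\<mu> = cmod (of_real \<mu>)"
      using \<mu>1 by simp
    also have "... \<le> cmod (of_real \<mu> + cnj ((N *\<^sub>v y) \<bullet>c x) + (\<Sum>j\<in>{1..n}. ?m j) * \<xi>) +
        cmod ((\<Sum>j\<in>{1..n}. ?m j) * \<xi>) + cmod (cnj ((N *\<^sub>v y) \<bullet>c x))"
      by (rule tri)
    also have "... \<le> (real n + 1) + real n * cmod \<xi> + cmod ((N *\<^sub>v y) \<bullet>c x)"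
      using 1 2 by simp
    finally show ?thesis .
  qed
  show ?thesis
    using \<mu>K orth main Nyx unfolding \<eta>_def by (intro exI[of _ \<mu>] exI[of _ "cmod \<xi>"]) auto
qed

text \<open>For K > 1 the inequality K <= n + 1 + 3 \<epsilon> / K is quadratic in K and is solved
  by completing the square. For K <= 1 it suffices that the right side is at least n + 1.\<close>

theorem K_le:
  assumes \<epsilon>: "\<And>l. l \<le> n \<Longrightarrow> (\<Sum>j\<in>{..n} - {l}. rel_size l j) \<le> \<epsilon>" and "0 < \<epsilon>"
  shows "K \<le> (real n + 1) / 2 + sqrt ((real n + 1)\<^sup>2 / 4 + 3 * \<epsilon>)"
proof (cases "1 < K")
  case True
  have "K \<le> (real n + 1) + 3 * \<epsilon> / K"
    using True by (intro near_extremal_limit[where D = "min (K - 1) (1 / 4)" and C = "real n"]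
        extremal_step[OF assms True]) auto
  then have "K * K \<le> (real n + 1) * K + 3 * \<epsilon>"
    using True by (simp add: field_simps)
  then have "(K - (real n + 1) / 2)\<^sup>2 \<le> (real n + 1)\<^sup>2 / 4 + 3 * \<epsilon>"
    by (simp add: power2_eq_square field_simps)
  then have "K - (real n + 1) / 2 \<le> sqrt ((real n + 1)\<^sup>2 / 4 + 3 * \<epsilon>)"
    by (rule real_le_rsqrt)
  then show ?thesis
    by simp
next
  case False
  have "(real n + 1) / 2 \<le> sqrt ((real n + 1)\<^sup>2 / 4 + 3 * \<epsilon>)"
    using \<open>0 < \<epsilon>\<close> by (intro real_le_rsqrt) (simp add: power_divide)
  then have "(real n + 1) / 2 + (real n + 1) / 2 \<le> (real n + 1) / 2 + sqrt ((real n + 1)\<^sup>2 / 4 + 3 * \<epsilon>)"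
    by (rule add_left_mono)
  moreover have "K \<le> (real n + 1) / 2 + (real n + 1) / 2"
    using False by simp
  ultimately show ?thesis
    by (rule order_trans[rotated])
qed

end

section \<open>The spectral constant\<close>

lemma dist_centres_gt:
  fixes a b :: complex
  assumes "cball a r \<inter> cball b s = {}" "0 < r" "0 < s"
  shows "r + s < cmod (a - b)"
proof (rule ccontr)
  assume "\<not> r + s < cmod (a - b)"
  then have le: "cmod (a - b) \<le> r + s"
    by simp
  \<comment> \<open>This point divides the segment from \<open>a\<close> to \<open>b\<close> in the
    ratio r : s, so it would lie in both disks.\<close>
  define p where "p = a + of_real (r / (r + s)) * (b - a)"
  have "dist a p = r / (r + s) * cmod (a - b)"
    using assms(2,3)
    by (simp add: p_def dist_norm norm_mult norm_minus_commute del: of_real_divide)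
  also have "... \<le> r / (r + s) * (r + s)"
    using le assms(2,3) by (intro mult_left_mono) auto
  finally have "p \<in> cball a r"
    using assms(2,3) by simp
  moreover have "b - p = of_real (s / (r + s)) * (b - a)"
  proof -
    have "1 - r / (r + s) = s / (r + s)"
      using assms(2,3) by (simp add: field_simps)
    then have eq: "complex_of_real (s / (r + s)) = 1 - of_real (r / (r + s))"
      by (metis of_real_1 of_real_diff)
    show ?thesis
      unfolding p_def eq left_diff_distrib[of 1] by simp
  qed
  then have "dist b p = s / (r + s) * cmod (a - b)"
    using assms(2,3) by (simp add: dist_norm norm_mult norm_minus_commute del: of_real_divide)
  then have "dist b p \<le> s / (r + s) * (r + s)"
    using mult_left_mono[OF le, of "s / (r + s)"] assms(2,3) by simp
  then have "p \<in> cball b s"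
    using assms(2,3) by simp
  ultimately show False
    using assms(1) by blast
qed

lemma invertible_mat_det_nonzero:
  assumes M: "(M :: complex mat) \<in> carrier_mat d d" and "invertible_mat M"
  shows "det M \<noteq> 0"
proof -
  obtain N where N: "M * N = 1\<^sub>m (dim_row M)" "N * M = 1\<^sub>m (dim_row N)"
    using assms(2) by (auto simp: invertible_mat_def inverts_mat_def)
  have "dim_col N = d" "dim_row N = d"
    using arg_cong[OF N(1), of dim_col] arg_cong[OF N(2), of dim_col] M by auto
  then have "N \<in> carrier_mat d d"
    by auto
  then have "det M * det N = 1"
    using det_mult[OF M] N(1) M by (metis carrier_matD(1) det_one)
  then show ?thesis
    by auto
qed

text \<open>Apart from positivity of \<open>t0\<close>, the requirements of the locale and on
  \<open>rel_size\<close> hold strictly at \<open>t = 0\<close> and vary continuously with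
  \<open>t\<close>, so one small \<open>t0\<close> meets them all.\<close>

lemma BBC_class_bound:
  fixes n :: nat and R \<epsilon> :: real and c :: "nat \<Rightarrow> complex" and r :: "nat \<Rightarrow> real"
  assumes "R > 0"
    and r: "\<And>i. i \<in> {1..n} \<Longrightarrow> r i > 0"
    and outer: "\<And>i. i \<in> {1..n} \<Longrightarrow> cmod (c i) + r i < R"
    and disj: "disjoint_family_on (\<lambda>i. cball (c i) (r i)) {1..n}"
    and "\<epsilon> > 0"
    and \<epsilon>j: "\<And>j. j \<in> {1..n} \<Longrightarrow>
      (\<Sum>i\<in>{1..n} - {j}. r i / disk_gap R c r i j) + R / disk_gap R c r 0 j - 1 < \<epsilon>"
    and \<epsilon>0: "(\<Sum>i\<in>{1..n}. r i / disk_gap R c r i 0) < \<epsilon>"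
    and A: "A \<in> BBC_class R n c r" and f: "f holomorphic_on multi_disk_domain R n c r"
    and bdd: "bounded (f ` multi_disk_domain R n c r)"
  shows "mat_opnorm (hol_calc (multi_disk_domain R n c r) f A) \<le>
    ((real n + 1) / 2 + sqrt ((real n + 1)\<^sup>2 / 4 + 3 * \<epsilon>)) * (SUP z\<in>multi_disk_domain R n c r. cmod (f z))"
proof -
  obtain d where d: "1 \<le> d" "A \<in> carrier_mat d d" and AR: "mat_opnorm A < R"
    and inv: "\<And>i. i \<in> {1..n} \<Longrightarrow> invertible_mat (A - c i \<cdot>\<^sub>m 1\<^sub>m d)"
    and Bi: "\<And>i. i \<in> {1..n} \<Longrightarrow> mat_opnorm (mat_inv (A - c i \<cdot>\<^sub>m 1\<^sub>m d)) < inverse (r i)"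
    using A by (auto simp: BBC_class_def)
  \<comment> \<open>\<alpha> is the midpoint of the norm of \<open>A\<close> and \<open>R\<close>;
    \<open>\<beta> i\<close> is the reciprocal of the midpoint of the norm of the inverse and
    \<open>inverse (r i)\<close>, hence strictly above \<open>r i\<close>.\<close>
  define \<alpha> where "\<alpha> = (mat_opnorm A + R) / 2"
  define \<beta> where "\<beta> i = 2 / (mat_opnorm (mat_inv (A - c i \<cdot>\<^sub>m 1\<^sub>m d)) + inverse (r i))" for i
  have \<alpha>: "0 < \<alpha>" "\<alpha> < R" "mat_opnorm A \<le> \<alpha>"
    using mat_opnorm_nonneg[OF d(2)] AR \<open>R > 0\<close> by (auto simp: \<alpha>_def)
  have pc: "A - c i \<cdot>\<^sub>m 1\<^sub>m d \<in> carrier_mat d d" for i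
    by (intro minus_carrier_mat smult_carrier_mat one_carrier_mat)
  have det: "det (A - c i \<cdot>\<^sub>m 1\<^sub>m d) \<noteq> 0" if "i \<in> {1..n}" for i
    using invertible_mat_det_nonzero[OF pc inv[OF that]] .
  have \<beta>: "0 < \<beta> i" "r i < \<beta> i" "\<beta> i * mat_opnorm (mat_inv (A - c i \<cdot>\<^sub>m 1\<^sub>m d)) \<le> 1"
    if i: "i \<in> {1..n}" for i
  proof -
    let ?b = "mat_opnorm (mat_inv (A - c i \<cdot>\<^sub>m 1\<^sub>m d))"
    have b: "0 \<le> ?b" "?b < inverse (r i)"
      using mat_opnorm_nonneg[OF mat_inv_inverts(3)[OF pc det[OF i]]] Bi[OF i] by auto
    have pos: "0 < ?b + inverse (r i)"
      using b r[OF i] by simp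
    then show "0 < \<beta> i"
      by (simp add: \<beta>_def)
    show "\<beta> i * ?b \<le> 1"
      using pos b by (simp add: \<beta>_def divide_le_eq)
    have "r i * (?b + inverse (r i)) < r i * (inverse (r i) + inverse (r i))"
      using b r[OF i] by (intro mult_strict_left_mono) auto
    also have "... = 2"
      using r[OF i] by (simp add: field_simps)
    finally have "r i * (?b + inverse (r i)) < 2" .
    then show "r i < \<beta> i"
      using pos by (simp add: \<beta>_def less_divide_eq)
  qed
  have inner: "r i + r j < cmod (c i - c j)" if "i \<in> {1..n}" "j \<in> {1..n}" "i \<noteq> j" for i j
    using disj that r by (intro dist_centres_gt) (auto simp: disjoint_family_on_def)
  \<comment> \<open>\<open>S\<close> and \<open>S0\<close> are the sums of \<open>rel_size\<close>
    with \<open>t\<close> in place of \<open>t0\<close>; at \<open>t = 0\<close> they are the sums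
    in the hypotheses.\<close>
  define S where "S l t = (\<Sum>j\<in>{1..n} - {l}. (r j + t) / (cmod (c j - c l) - r j - r l - 2 * t)) +
    (R / (R - cmod (c l) - r l - 2 * t) - 1)" for l t
  define S0 where "S0 t = (\<Sum>j\<in>{1..n}. (r j + t) / (R - cmod (c j) - r j - 2 * t))" for t
  have ev_lt: "\<forall>\<^sub>F t in at_right (0::real). p + q * t < y" if "p < y" for p q y :: real
  proof -
    have "((\<lambda>t. p + q * t) \<longlongrightarrow> p + q * 0) (at_right 0)"
      by (intro tendsto_intros)
    then show ?thesis
      using that by (intro order_tendstoD(2)[of _ p]) auto
  qed
  have "\<forall>\<^sub>F t in at_right 0. \<forall>l\<in>{1..n}. S l t < \<epsilon>"
  proof (intro eventually_ball_finite ballI finite_atLeastAtMost)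
    fix l assume l: "l \<in> {1..n}"
    have "(S l \<longlongrightarrow> (\<Sum>j\<in>{1..n} - {l}. (r j + 0) / (cmod (c j - c l) - r j - r l - 2 * 0)) +
        (R / (R - cmod (c l) - r l - 2 * 0) - 1)) (at_right 0)"
      unfolding S_def using inner outer l by (intro tendsto_intros) force+
    moreover have "(\<Sum>j\<in>{1..n} - {l}. (r j + 0) / (cmod (c j - c l) - r j - r l - 2 * 0)) +
        (R / (R - cmod (c l) - r l - 2 * 0) - 1) < \<epsilon>"
    proof -
      have "(\<Sum>i\<in>{1..n} - {l}. r i / disk_gap R c r i l) =
          (\<Sum>j\<in>{1..n} - {l}. (r j + 0) / (cmod (c j - c l) - r j - r l - 2 * 0))"
        using l by (intro sum.cong) (auto simp: disk_gap_def)
      then show ?thesis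
        using \<epsilon>j[OF l] by (simp add: disk_gap_def)
    qed
    ultimately show "\<forall>\<^sub>F t in at_right 0. S l t < \<epsilon>"
      by (rule order_tendstoD(2))
  qed
  moreover have "\<forall>\<^sub>F t in at_right 0. S0 t < \<epsilon>"
  proof -
    have "(S0 \<longlongrightarrow> (\<Sum>j\<in>{1..n}. (r j + 0) / (R - cmod (c j) - r j - 2 * 0))) (at_right 0)"
      unfolding S0_def using outer by (intro tendsto_intros) force+
    moreover have "(\<Sum>j\<in>{1..n}. (r j + 0) / (R - cmod (c j) - r j - 2 * 0)) < \<epsilon>"
    proof -
      have "(\<Sum>i\<in>{1..n}. r i / disk_gap R c r i 0) =
          (\<Sum>j\<in>{1..n}. (r j + 0) / (R - cmod (c j) - r j - 2 * 0))"
        by (intro sum.cong) (auto simp: disk_gap_def)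
      then show ?thesis
        using \<epsilon>0 by simp
    qed
    ultimately show ?thesis
      by (rule order_tendstoD(2))
  qed
  moreover have "\<forall>\<^sub>F t in at_right 0. \<alpha> + 1 * t < R"
    using \<alpha> by (intro ev_lt)
  moreover have "\<forall>\<^sub>F t in at_right 0. \<forall>i\<in>{1..n}. r i + 1 * t < \<beta> i"
    using \<beta> by (intro eventually_ball_finite ballI ev_lt) auto
  moreover have "\<forall>\<^sub>F t in at_right 0. \<forall>i\<in>{1..n}. cmod (c i) + r i + 2 * t < R"
    using outer by (intro eventually_ball_finite ballI ev_lt) auto
  moreover have "\<forall>\<^sub>F t in at_right 0. \<forall>i\<in>{1..n}. \<forall>j\<in>{1..n} - {i}. r i + r j + 2 * t < cmod (c i - c j)"
    using inner by (intro eventually_ball_finite ballI ev_lt) auto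
  ultimately have "\<forall>\<^sub>F t in at_right 0. 0 < t \<and> (\<forall>l\<in>{1..n}. S l t < \<epsilon>) \<and> S0 t < \<epsilon> \<and> \<alpha> + 1 * t < R \<and>
      (\<forall>i\<in>{1..n}. r i + 1 * t < \<beta> i) \<and> (\<forall>i\<in>{1..n}. cmod (c i) + r i + 2 * t < R) \<and>
      (\<forall>i\<in>{1..n}. \<forall>j\<in>{1..n} - {i}. r i + r j + 2 * t < cmod (c i - c j))"
    by - (intro eventually_conj eventually_at_right_less; assumption)
  from eventually_happens'[OF trivial_limit_at_right_real this] obtain t0 where t0: "0 < t0" "\<forall>l\<in>{1..n}. S l t0 < \<epsilon>" "S0 t0 < \<epsilon>" "\<alpha> + 1 * t0 < R"
      "\<forall>i\<in>{1..n}. r i + 1 * t0 < \<beta> i" "\<forall>i\<in>{1..n}. cmod (c i) + r i + 2 * t0 < R"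
      "\<forall>i\<in>{1..n}. \<forall>j\<in>{1..n} - {i}. r i + r j + 2 * t0 < cmod (c i - c j)"
    by (elim exE conjE) (rule that)
  interpret disk_class_matrix n R t0 c r d A \<alpha> \<beta>
  proof
    fix v :: "complex Matrix.vec" assume v: "v \<in> carrier_vec d"
    show "vec_norm2 (A *\<^sub>v v) \<le> \<alpha> * vec_norm2 v"
      using mat_opnorm_bound[OF d(2) v] mult_right_mono[OF \<alpha>(3) vec_norm2_nonneg] by (rule order_trans)
    fix i assume i: "i \<in> {1..n}"
    let ?B = "mat_inv (A - c i \<cdot>\<^sub>m 1\<^sub>m d)" and ?w = "A *\<^sub>v v - c i \<cdot>\<^sub>v v"
    note B = mat_inv_inverts[OF pc det[OF i]]
    have w: "?w \<in> carrier_vec d"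
      using d(2) v by simp
    have "(A - c i \<cdot>\<^sub>m 1\<^sub>m d) *\<^sub>v v = ?w"
      using d(2) v by (subst minus_mult_distrib_mat_vec[of _ d d]) (auto simp: smult_mat_vec[of _ d d])
    then have "?B *\<^sub>v ?w = v"
      using assoc_mult_mat_vec[OF B(3) pc[of i] v] B(2) v by simp
    then have "vec_norm2 v \<le> mat_opnorm ?B * vec_norm2 ?w"
      using mat_opnorm_bound[OF B(3) w] by simp
    then have "\<beta> i * vec_norm2 v \<le> \<beta> i * mat_opnorm ?B * vec_norm2 ?w"
      using \<beta>(1)[OF i] by (simp add: mult.assoc)
    also have "... \<le> 1 * vec_norm2 ?w"
      by (intro mult_right_mono \<beta>(3)[OF i] vec_norm2_nonneg)
    finally show "\<beta> i * vec_norm2 v \<le> vec_norm2 ?w"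
      by simp
  qed (use t0 r \<alpha> d in auto)
  let ?U = "multi_disk_domain R n c r"
  have U: "dom 0 = ?U"
    by (simp add: dom_def)
  have rel: "(\<Sum>j\<in>{..n} - {l}. rel_size l j) \<le> \<epsilon>" if "l \<le> n" for l
  proof (cases "l = 0")
    case True
    have "(\<Sum>j\<in>{..n} - {0}. rel_size 0 j) = S0 t0"
      unfolding S0_def by (intro sum.cong) (auto simp: rel_size_def)
    then show ?thesis
      using t0(3) True by simp
  next
    case False
    then have l: "l \<in> {1..n}"
      using that by simp
    have "{..n} - {l} = insert 0 ({1..n} - {l})"
      using l by auto
    then have "(\<Sum>j\<in>{..n} - {l}. rel_size l j) = rel_size l 0 + (\<Sum>j\<in>{1..n} - {l}. rel_size l j)"
      by simp
    also have "(\<Sum>j\<in>{1..n} - {l}. rel_size l j) =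
        (\<Sum>j\<in>{1..n} - {l}. (r j + t0) / (cmod (c j - c l) - r j - r l - 2 * t0))"
      using l by (intro sum.cong) (auto simp: rel_size_def)
    finally have "(\<Sum>j\<in>{..n} - {l}. rel_size l j) = S l t0"
      by (simp add: S_def rel_size_def)
    then show ?thesis
      using t0(2) l by (metis less_imp_le)
  qed
  define m where "m = (SUP z\<in>?U. cmod (f z))"
  have "bdd_above ((\<lambda>z. cmod (f z)) ` ?U)"
    using bdd unfolding bounded_iff by (force intro: bdd_aboveI2)
  then have fm: "cmod (f z) \<le> m" if "z \<in> ?U" for z
    unfolding m_def using that by (intro cSUP_upper)
  \<comment> \<open>A matrix of size at least 1 has an eigenvalue, so the domain is nonempty and the
    supremum is nonnegative.\<close>
  have "spectrum A \<noteq> {}"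
    using spectrum_non_empty[OF d(2)] d(1) by simp
  then obtain z where "z \<in> ?U"
    using spectrum_subset_dom dom_antimono[of 0 t0] t0(1) U by auto
  then have m: "0 \<le> m"
    using fm norm_ge_zero order_trans by blast
  have "mat_opnorm (\<Phi> f) \<le> m * K + e" if "0 < e" for e
  proof (rule mat_opnorm_le[OF \<Phi>_carrier(1)])
    show "0 \<le> m * K + e"
      using m K_nonneg that by simp
    fix x y :: "complex Matrix.vec"
    assume x: "x \<in> carrier_vec d" "vec_norm2 x \<le> 1" and y: "y \<in> carrier_vec d" "vec_norm2 y = 1"
    \<comment> \<open>\<open>\<Phi>_bound\<close> asks for a positive bound whereas \<open>m\<close>
      may be 0, hence the enlargement by \<delta>.\<close>
    define \<delta> where "\<delta> = e / (K + 1)"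
    have \<delta>: "0 < \<delta>" "\<delta> * K \<le> e"
      using that K_nonneg by (auto simp: \<delta>_def field_simps)
    have f\<delta>: "cmod (f z) \<le> m + \<delta>" if "z \<in> dom 0" for z
      using fm[of z] that \<delta> U by simp
    have "cmod ((\<Phi> f *\<^sub>v x) \<bullet>c y) \<le> vec_norm2 (\<Phi> f *\<^sub>v x) * vec_norm2 y"
      using x y by (intro scalar_prod_cauchy_schwarz[of _ d]) (auto intro: mult_mat_vec_carrier[of _ d d])
    also have "... \<le> (m + \<delta>) * K * vec_norm2 x"
      using \<Phi>_bound[of 0 f "m + \<delta>" x] f f\<delta> t0(1) m \<delta> x(1) y(2) U by simp
    also have "... \<le> (m + \<delta>) * K * 1"
      using m \<delta> K_nonneg x(2) by (intro mult_left_mono) auto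
    also have "... \<le> m * K + e"
      using \<delta>(2) by (simp add: algebra_simps)
    finally show "cmod ((\<Phi> f *\<^sub>v x) \<bullet>c y) \<le> m * K + e" .
  qed
  then have "mat_opnorm (\<Phi> f) \<le> m * K"
    by (rule field_le_epsilon)
  also have "... \<le> m * ((real n + 1) / 2 + sqrt ((real n + 1)\<^sup>2 / 4 + 3 * \<epsilon>))"
    using K_le[OF rel \<open>\<epsilon> > 0\<close>] m by (intro mult_left_mono) auto
  finally show ?thesis
    using hol_calc_eq_\<Phi>[of f] f unfolding U m_def by (simp add: mult.commute)
qed

theorem theorem1p1:
  fixes n :: nat and R \<epsilon> :: real and c :: "nat \<Rightarrow> complex" and r :: "nat \<Rightarrow> real"
  assumes "n \<ge> 1" and "R > 0"
    and "\<And>i. i \<in> {1..n} \<Longrightarrow> r i > 0"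
    and "\<And>i. i \<in> {1..n} \<Longrightarrow> cmod (c i) + r i < R"
    and "disjoint_family_on (\<lambda>i. cball (c i) (r i)) {1..n}"
    and "\<epsilon> > 0"
    and "\<And>j. j \<in> {1..n} \<Longrightarrow>
      (\<Sum>i\<in>{1..n} - {j}. r i / disk_gap R c r i j) + R / disk_gap R c r 0 j - 1 < \<epsilon>"
    and "(\<Sum>i\<in>{1..n}. r i / disk_gap R c r i 0) < \<epsilon>"
  shows "spectral_const R n c r
    \<le> ereal ((real n + 1) / 2 + sqrt ((real n + 1)\<^sup>2 / 4 + 5 * \<epsilon>))"
proof -
  let ?U = "multi_disk_domain R n c r"
  let ?b = "(real n + 1) / 2 + sqrt ((real n + 1)\<^sup>2 / 4 + 3 * \<epsilon>)"
  have "ereal ?b \<in> ereal ` {K. \<forall>A\<in>BBC_class R n c r. \<forall>f. f holomorphic_on ?U \<and> bounded (f ` ?U) \<longrightarrow>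
      mat_opnorm (hol_calc ?U f A) \<le> K * (SUP z\<in>?U. cmod (f z))}"
    using BBC_class_bound[OF assms(2-8)] by auto
  then have "spectral_const R n c r \<le> ereal ?b"
    unfolding spectral_const_def Let_def by (rule Inf_lower)
  \<comment> \<open>The argument gives \<open>3 * \<epsilon>\<close> under the root, which is
    stronger than the claimed \<open>5 * \<epsilon>\<close>.\<close>
  also have "... \<le> ereal ((real n + 1) / 2 + sqrt ((real n + 1)\<^sup>2 / 4 + 5 * \<epsilon>))"
    using \<open>\<epsilon> > 0\<close> by simp
  finally show ?thesis .
qed

end
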